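(* Let $L>0$ be fixed, $\kappa>0$, $\gamma\ge0$, and $\omega\in\left(\frac{4\pi^2}{L^2},+\infty\right)$. Let $\psi=\psi_\omega\in H^1_{\rm per,odd}$ be the $L$-periodic odd solution with snoidal profile (defined in the context) of $$-\psi''+\omega\psi-(\kappa+\gamma B^3)\psi^5=0 .$$ Regarding the spectral stability of the periodic wave $\Psi=(\psi,B\psi,0,0)\in\mathbb{H}^1_{\rm per,odd}$ of the quintic Schrödinger system (stability being understood in the space $\mathbb{H}^1_{\rm per,odd}$), the following hold: (i) If $B=\frac{\gamma\pm\sqrt{\gamma^2-4\kappa^2}}{2\kappa}$ (with $\gamma>2\kappa$), then $\Psi$ is spectrally unstable. (ii) If $B=1$, then $\Psi$ is spectrally unstable for $\gamma\in(0,2\kappa)$ and spectrally stable for $\gamma\in\{0\}\cup[2\kappa,+\infty)$. (iii) If $B=-1$, then $\Psi$ is spectrally stable provided that $\gamma=0$.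
   Context: Function spaces: for $s\ge 0$, $H^s_{\rm per}$ is the Sobolev space of complex-valued $L$-periodic functions, $L^2_{\rm per}=H^0_{\rm per}$; $H^s_{\rm per,odd}$ is its subspace of odd functions; $\mathbb{H}^s_{\rm per,odd}=(H^s_{\rm per,odd})^4$ and $\mathbb{L}^2_{\rm per,odd}=\mathbb{H}^0_{\rm per,odd}$. System: $iu_t+u_{xx}+\kappa|u|^4u+\gamma v^3\overline{u}^2=0$, $\; iv_t+v_{xx}+\kappa|v|^4v+\gamma u^3\overline{v}^2=0$, for complex-valued $u,v$ that are $L$-periodic in $x\in\mathbb{R}$. Standing waves have the form $(u,v)=e^{i\omega t}(\psi(x),B\psi(x))$ with $\psi$ real and $B\in\mathbb{R}$ satisfying $\kappa+\gamma B^3=\kappa B^4+\gamma B$; identifying $(u,v)$ with $(\mathrm{Re}\,u,\mathrm{Re}\,v,\mathrm{Im}\,u,\mathrm{Im}\,v)$, the wave is represented by $\Psi=(\psi,B\psi,0,0)$. Snoidal profile: for $k\in(0,1)$ let $\mathrm{sn}(\cdot,k)$ be the Jacobi elliptic sine and $\mathrm{K}(k)$ the complete elliptic integral of the first kind (modulus $k$). Then $$\psi(x)=\frac{1}{\sqrt[4]{\kappa+\gamma B^3}}\,\frac{\tilde a\,\mathrm{sn}\left(\frac{4\mathrm{K}(k)}{L}x,k\right)}{\sqrt{1-\tilde q\,\mathrm{sn}^2\left(\frac{4\mathrm{K}(k)}{L}x,k\right)}},\qquad \tilde a=-\frac{a\sqrt{1-k^2}}{\sqrt{1-q}},\qquad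 \tilde q=\frac{k^2-q}{1-q},$$ $$a=\frac{2}{L}\left[\left(2-k^2+2\sqrt{k^4-k^2+1}\right)L^2\mathrm{K}(k)^2\right]^{1/4},\qquad q=-1+k^2-\sqrt{k^4-k^2+1},$$ where $k\in(0,1)$ is determined by $\omega=\frac{16\mathrm{K}(k)^2\sqrt{k^4-k^2+1}}{L^2}$, which maps $(0,1)$ bijectively onto $(4\pi^2/L^2,+\infty)$. Linearized operator: with $J=\begin{bmatrix}0&\mathrm{Id}_{2\times2}\\-\mathrm{Id}_{2\times2}&0\end{bmatrix}$, let $\mathcal{L}_{\rm odd}=(-\partial_x^2+\omega)\mathrm{Id}_{4\times4}-\psi^4S$ on $\mathbb{L}^2_{\rm per,odd}$ with domain $\mathbb{H}^2_{\rm per,odd}$, where $$S=\begin{bmatrix}5\kappa+2\gamma B^3&3\gamma B^2&0&0\\3\gamma B^2&5\kappa B^4+2\gamma B&0&0\\0&0&\kappa-2\gamma B^3&3\gamma B^2\\0&0&3\gamma B^2&\kappa B^4-2\gamma B\end{bmatrix}.$$ Spectral stability in $\mathbb{H}^1_{\rm per,odd}$: $\Psi$ is spectrally stable if $\sigma(J\mathcal{L}_{\rm odd})\subset i\mathbb{R}$, with $J\mathcal{L}_{\rm odd}$ acting in $\mathbb{L}^2_{\rm per,odd}$; it is spectrally unstable if $J\mathcal{L}_{\rm odd}$ has at least one eigenvalue $\lambda\in\mathbb{C}$ with positive real part. *)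

theory Defs
  imports "HOL-Analysis.Analysis"
begin

section \<open>Jacobi elliptic sine and the snoidal profile\<close>

text \<open>All elliptic functions are parametrised by the modulus \<open>k\<close> (not \<open>m = k\<^sup>2\<close>).
  The integral is oriented, so \<open>ellipF\<close> is odd in \<open>\<phi>\<close>; for \<open>0 < k < 1\<close> it is an
  increasing bijection of the real line, whose inverse is the amplitude.\<close>

definition ellipF :: "real \<Rightarrow> real \<Rightarrow> real" where
  "ellipF \<phi> k = (LBINT t=ereal 0..ereal \<phi>. 1 / sqrt (1 - k\<^sup>2 * (sin t)\<^sup>2))"

definition ellipK :: "real \<Rightarrow> real" where
  "ellipK k = ellipF (pi / 2) k"

definition jacobi_am :: "real \<Rightarrow> real \<Rightarrow> real" where
  "jacobi_am u k = (THE \<phi>. ellipF \<phi> k = u)"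

definition jacobi_sn :: "real \<Rightarrow> real \<Rightarrow> real" where
  "jacobi_sn u k = sin (jacobi_am u k)"

definition snoidal_q :: "real \<Rightarrow> real" where
  "snoidal_q k = - 1 + k\<^sup>2 - sqrt (k ^ 4 - k\<^sup>2 + 1)"

definition snoidal_a :: "real \<Rightarrow> real \<Rightarrow> real" where
  "snoidal_a L k =
     2 / L * root 4 ((2 - k\<^sup>2 + 2 * sqrt (k ^ 4 - k\<^sup>2 + 1)) * L\<^sup>2 * (ellipK k)\<^sup>2)"

definition snoidal_qt :: "real \<Rightarrow> real" where
  "snoidal_qt k = (k\<^sup>2 - snoidal_q k) / (1 - snoidal_q k)"

definition snoidal_at :: "real \<Rightarrow> real \<Rightarrow> real" where
  "snoidal_at L k = - (snoidal_a L k * sqrt (1 - k\<^sup>2) / sqrt (1 - snoidal_q k))"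

definition snoidal_profile :: "real \<Rightarrow> real \<Rightarrow> real \<Rightarrow> real \<Rightarrow> real \<Rightarrow> real \<Rightarrow> real" where
  "snoidal_profile L \<kappa> \<gamma> B k x =
     1 / root 4 (\<kappa> + \<gamma> * B ^ 3) *
     (snoidal_at L k * jacobi_sn (4 * ellipK k / L * x) k /
      sqrt (1 - snoidal_qt k * (jacobi_sn (4 * ellipK k / L * x) k)\<^sup>2))"

definition snoidal_freq :: "real \<Rightarrow> real \<Rightarrow> real" where
  "snoidal_freq L k = 16 * (ellipK k)\<^sup>2 * sqrt (k ^ 4 - k\<^sup>2 + 1) / L\<^sup>2"

text \<open>\<open>snoidal_freq L\<close> maps \<open>(0,1)\<close> bijectively onto \<open>(4\<pi>\<^sup>2/L\<^sup>2, \<infinity>)\<close>, so for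
  \<open>\<omega> > 4\<pi>\<^sup>2/L\<^sup>2\<close> exactly one function has the following property.\<close>

definition has_snoidal_profile ::
    "real \<Rightarrow> real \<Rightarrow> real \<Rightarrow> real \<Rightarrow> real \<Rightarrow> (real \<Rightarrow> real) \<Rightarrow> bool" where
  "has_snoidal_profile L \<kappa> \<gamma> B \<omega> \<psi> \<longleftrightarrow>
     (\<exists>k. 0 < k \<and> k < 1 \<and> \<omega> = snoidal_freq L k \<and> \<psi> = snoidal_profile L \<kappa> \<gamma> B k)"

definition solves_profile_eq ::
    "real \<Rightarrow> real \<Rightarrow> real \<Rightarrow> real \<Rightarrow> (real \<Rightarrow> real) \<Rightarrow> bool" where
  "solves_profile_eq \<kappa> \<gamma> B \<omega> \<psi> \<longleftrightarrow>
     (\<exists>\<psi>' \<psi>''. \<forall>x. (\<psi> has_real_derivative \<psi>' x) (at x) \<and>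
                    (\<psi>' has_real_derivative \<psi>'' x) (at x) \<and>
                    - \<psi>'' x + \<omega> * \<psi> x - (\<kappa> + \<gamma> * B ^ 3) * \<psi> x ^ 5 = 0)"


section \<open>Periodic Sobolev spaces\<close>

text \<open>Elements of the Lebesgue and Sobolev spaces are represented by functions on the real line
  that are Borel measurable and \<open>L\<close>-periodic (and odd) everywhere; every almost-everywhere class
  has such a representative. The classes are recovered by comparing functions only up to
  almost-everywhere equality, \<open>ae_eq\<close>.\<close>

abbreviation ae_eq :: "(real \<Rightarrow> 'b) \<Rightarrow> (real \<Rightarrow> 'b) \<Rightarrow> bool" where
  "ae_eq f g \<equiv> (AE x in lborel. f x = g x)"

definition L2_per :: "real \<Rightarrow> (real \<Rightarrow> complex) set" where
  "L2_per L = {f. f \<in> borel_measurable borel \<and> (\<forall>x. f (x + L) = f x) \<and>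
                  set_integrable lborel {0..L} (\<lambda>x. (cmod (f x))\<^sup>2)}"

definition fourier_coeff :: "real \<Rightarrow> (real \<Rightarrow> complex) \<Rightarrow> int \<Rightarrow> complex" where
  "fourier_coeff L f n =
     1 / complex_of_real L *
     (LINT x:{0..L}|lborel. f x * exp (- (2 * complex_of_real pi * \<i> * of_int n
                                         * complex_of_real x / complex_of_real L)))"

text \<open>For \<open>s = 0\<close> the summability condition holds for all of \<open>L2_per L\<close> (Bessel).\<close>

definition H_per :: "real \<Rightarrow> real \<Rightarrow> (real \<Rightarrow> complex) set" where
  "H_per s L = {f \<in> L2_per L.
     (\<lambda>n::int. (1 + (real_of_int n)\<^sup>2) powr s * (cmod (fourier_coeff L f n))\<^sup>2) summable_on UNIV}"

definition H_per_odd :: "real \<Rightarrow> real \<Rightarrow> (real \<Rightarrow> complex) set" where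
  "H_per_odd s L = {f \<in> H_per s L. \<forall>x. f (- x) = - f x}"

definition HH_per_odd :: "real \<Rightarrow> real \<Rightarrow> (real \<Rightarrow> complex ^ 4) set" where
  "HH_per_odd s L = {U. \<forall>j. (\<lambda>x. U x $ j) \<in> H_per_odd s L}"

abbreviation LL_per_odd :: "real \<Rightarrow> (real \<Rightarrow> complex ^ 4) set" where
  "LL_per_odd L \<equiv> HH_per_odd 0 L"

definition LL_norm :: "real \<Rightarrow> (real \<Rightarrow> complex ^ 4) \<Rightarrow> real" where
  "LL_norm L U = sqrt (LINT x:{0..L}|lborel. (norm (U x))\<^sup>2)"

text \<open>\<open>g\<close> represents the \<open>m\<close>-th derivative of \<open>f\<close> in the sense of periodic distributions.\<close>

definition is_per_deriv :: "nat \<Rightarrow> real \<Rightarrow> (real \<Rightarrow> complex) \<Rightarrow> (real \<Rightarrow> complex) \<Rightarrow> bool" where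
  "is_per_deriv m L f g \<longleftrightarrow> g \<in> L2_per L \<and>
     (\<forall>n. fourier_coeff L g n =
          (2 * complex_of_real pi * \<i> * of_int n / complex_of_real L) ^ m * fourier_coeff L f n)"


section \<open>The linearised operator\<close>

definition mat_J :: "complex ^ 4 ^ 4" where
  "mat_J = vector
     [vector [0, 0, 1, 0],
      vector [0, 0, 0, 1],
      vector [-1, 0, 0, 0],
      vector [0, -1, 0, 0]]"

definition mat_S :: "real \<Rightarrow> real \<Rightarrow> real \<Rightarrow> complex ^ 4 ^ 4" where
  "mat_S \<kappa> \<gamma> B = vector
     [vector [complex_of_real (5 * \<kappa> + 2 * \<gamma> * B ^ 3), complex_of_real (3 * \<gamma> * B\<^sup>2), 0, 0],
      vector [complex_of_real (3 * \<gamma> * B\<^sup>2), complex_of_real (5 * \<kappa> * B ^ 4 + 2 * \<gamma> * B), 0, 0],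
      vector [0, 0, complex_of_real (\<kappa> - 2 * \<gamma> * B ^ 3), complex_of_real (3 * \<gamma> * B\<^sup>2)],
      vector [0, 0, complex_of_real (3 * \<gamma> * B\<^sup>2), complex_of_real (\<kappa> * B ^ 4 - 2 * \<gamma> * B)]]"

text \<open>Unbounded operators are given by their graphs, i.e. by the set of pairs \<open>(U, A U)\<close> with \<open>U\<close>
  in the domain; the graphs below are closed under almost-everywhere equality in both
  components.\<close>

type_synonym operator_graph = "((real \<Rightarrow> complex ^ 4) \<times> (real \<Rightarrow> complex ^ 4)) set"

definition op_L_odd ::
    "real \<Rightarrow> real \<Rightarrow> real \<Rightarrow> real \<Rightarrow> real \<Rightarrow> (real \<Rightarrow> real) \<Rightarrow> operator_graph" where
  "op_L_odd L \<kappa> \<gamma> B \<omega> \<psi> =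
     {(U, V). U \<in> HH_per_odd 2 L \<and> V \<in> LL_per_odd L \<and>
        (\<exists>U''. (\<forall>j. is_per_deriv 2 L (\<lambda>x. U x $ j) (\<lambda>x. U'' x $ j)) \<and>
               ae_eq V (\<lambda>x. - U'' x + \<omega> *\<^sub>R U x - (\<psi> x ^ 4) *\<^sub>R (mat_S \<kappa> \<gamma> B *v U x)))}"

definition op_JL_odd ::
    "real \<Rightarrow> real \<Rightarrow> real \<Rightarrow> real \<Rightarrow> real \<Rightarrow> (real \<Rightarrow> real) \<Rightarrow> operator_graph" where
  "op_JL_odd L \<kappa> \<gamma> B \<omega> \<psi> = {(U, \<lambda>x. mat_J *v V x) | U V. (U, V) \<in> op_L_odd L \<kappa> \<gamma> B \<omega> \<psi>}"


section \<open>Spectrum and spectral stability\<close>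

text \<open>\<open>z\<close> is in the resolvent set of an operator \<open>A\<close> in \<open>LL_per_odd L\<close> iff \<open>z - A\<close> is a bijection
  from its domain onto \<open>LL_per_odd L\<close> (modulo almost-everywhere equality) with bounded inverse.\<close>

definition resolvent_eq ::
    "operator_graph \<Rightarrow> complex \<Rightarrow> (real \<Rightarrow> complex ^ 4) \<Rightarrow> (real \<Rightarrow> complex ^ 4) \<Rightarrow> bool" where
  "resolvent_eq A z U F \<longleftrightarrow> (\<exists>V. (U, V) \<in> A \<and> ae_eq (\<lambda>x. z *s U x - V x) F)"

definition resolvent_set :: "real \<Rightarrow> operator_graph \<Rightarrow> complex set" where
  "resolvent_set L A = {z.
     (\<forall>F \<in> LL_per_odd L. \<exists>U. resolvent_eq A z U F) \<and>
     (\<forall>F \<in> LL_per_odd L. \<forall>U U'. resolvent_eq A z U F \<longrightarrow> resolvent_eq A z U' F \<longrightarrow> ae_eq U U') \<and>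
     (\<exists>C. \<forall>F \<in> LL_per_odd L. \<forall>U. resolvent_eq A z U F \<longrightarrow> LL_norm L U \<le> C * LL_norm L F)}"

definition op_spectrum :: "real \<Rightarrow> operator_graph \<Rightarrow> complex set" where
  "op_spectrum L A = - resolvent_set L A"

definition op_eigenvalue :: "operator_graph \<Rightarrow> complex \<Rightarrow> bool" where
  "op_eigenvalue A z \<longleftrightarrow>
     (\<exists>U V. (U, V) \<in> A \<and> \<not> ae_eq U (\<lambda>x. 0) \<and> ae_eq V (\<lambda>x. z *s U x))"

text \<open>Spectral (in)stability of the wave \<open>\<Psi> = (\<psi>, B \<psi>, 0, 0)\<close> of frequency \<open>\<omega>\<close> in the space of
  odd functions. Instability is not defined as the negation of stability.\<close>

definition spectrally_stable ::
    "real \<Rightarrow> real \<Rightarrow> real \<Rightarrow> real \<Rightarrow> real \<Rightarrow> (real \<Rightarrow> real) \<Rightarrow> bool" where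
  "spectrally_stable L \<kappa> \<gamma> B \<omega> \<psi> \<longleftrightarrow>
     op_spectrum L (op_JL_odd L \<kappa> \<gamma> B \<omega> \<psi>) \<subseteq> {z. Re z = 0}"

definition spectrally_unstable ::
    "real \<Rightarrow> real \<Rightarrow> real \<Rightarrow> real \<Rightarrow> real \<Rightarrow> (real \<Rightarrow> real) \<Rightarrow> bool" where
  "spectrally_unstable L \<kappa> \<gamma> B \<omega> \<psi> \<longleftrightarrow>
     (\<exists>z. op_eigenvalue (op_JL_odd L \<kappa> \<gamma> B \<omega> \<psi>) z \<and> Re z > 0)"

end

theory Submission imports Defs begin

text \<open>
  \<^bold>\<open>From the operator to a two-point problem.\<close> An odd \<open>L\<close>-periodic function vanishes at \<open>0\<close> and at
  \<open>L/2\<close>, and is determined by its values in between. Multiplied by \<open>J\<close>, the equation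
  \<open>(z - J \<L>\<^sub>o\<^sub>d\<^sub>d) U = F\<close> therefore becomes the Dirichlet problem
  \<open>U'' = \<omega> U - \<psi>\<^sup>4 S U + z J U - J F\<close> on \<open>[0, L/2]\<close>. Solutions of the initial value problem depend linearly
  on the slope at \<open>0\<close>, so the map from this slope to the value at \<open>L/2\<close> is a linear endomorphism of
  \<open>\<complex>\<^sup>4\<close>: if it is injective, it is bijective, and \<open>z\<close> is in the resolvent set (\<open>resolvent_setI\<close>); if it is
  not, \<open>z\<close> is an eigenvalue. The function spaces are defined
  through Fourier coefficients; the link with differential equations is that for integrable \<open>f\<close>, \<open>g\<close> the
  coefficients satisfy the relation for \<open>g = f''\<close> iff \<open>f(x) = x p + \<integral>\<^sub>0\<^sup>x (x - s) g(s) ds\<close>, with \<open>p\<close>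
  chosen so that \<open>f(L/2) = 0\<close> (\<open>green_representation\<close>, by completeness of the sines, and \<open>sine_coeff_green\<close>).

  \<^bold>\<open>Two scalar pairs.\<close> Put \<open>c = \<kappa> + \<gamma> B\<^sup>3\<close>, \<open>d = 3 \<gamma> B (1 + B\<^sup>2)\<close> and \<open>\<phi> = - c\<^sup>1\<^sup>/\<^sup>4 \<psi>\<close>. Then
  \<open>\<phi>'' = \<omega> \<phi> - \<phi>\<^sup>5\<close>, and \<open>\<phi>\<close> is positive on \<open>(0, L/2)\<close> and symmetric about its maximum at \<open>L/4\<close>. The
  condition on \<open>B\<close> says that both diagonal blocks of \<open>S\<close> have the eigenvectors \<open>(1, B)\<close> and \<open>(-B, 1)\<close>.
  In these directions the homogeneous problem splits into two pairs
  \<open>P'' = (\<omega> - \<sigma> \<phi>\<^sup>4) P + z Q\<close>, \<open>Q'' = (\<omega> - \<tau> \<phi>\<^sup>4) Q - z P\<close> with Dirichlet conditions, where \<open>(\<sigma>, \<tau>) = (5, 1)\<close>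
  for the first and \<open>(\<sigma>, \<tau>) = ((5c - d)/c, (c - d)/c)\<close> for the second. Let \<open>L\<^sub>s = - \<partial>\<^sup>2 + \<omega> - s \<phi>\<^sup>4\<close>. The zero-free
  solution \<open>\<phi>\<close> of \<open>L\<^sub>1 \<phi> = 0\<close> makes \<open>L\<^sub>s\<close> nonnegative for \<open>s \<le> 1\<close>; the solution \<open>\<phi>'\<close> of \<open>L\<^sub>5 \<phi>' = 0\<close> has the
  single zero \<open>L/4\<close>, so \<open>L\<^sub>5\<close> is nonnegative on functions that vanish at \<open>L/4\<close>.

  \<^bold>\<open>Stability for \<open>d = 0\<close> or \<open>d \<ge> 4c\<close>.\<close> Here each pair has either \<open>\<sigma>, \<tau> \<le> 1\<close> or \<open>(\<sigma>, \<tau>) = (5, 1)\<close>. If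
  both quadratic forms are nonnegative at the solution, then \<open>z \<langle>P, Q\<rangle>\<close> and \<open>- z \<langle>Q, P\<rangle>\<close> are both nonnegative
  real numbers, which for \<open>Re z \<noteq> 0\<close> forces \<open>\<langle>P, Q\<rangle> = 0\<close> and then \<open>P = Q = 0\<close> (\<open>pair_rigid\<close>). For
  \<open>(\<sigma>, \<tau>) = (5, 1)\<close>, the second equation shows that \<open>P\<close> is orthogonal to \<open>\<phi>\<close>, and \<open>L\<^sub>5\<close> is nonnegative
  on that complement because the solution of \<open>L\<^sub>5 \<eta> = \<phi>\<close> satisfies the criterion of Vakhitov and Kolokolov
  \<open>\<langle>\<phi>, \<eta>\<rangle> \<le> 0\<close> (\<open>vakhitov_kolokolov\<close>). The sign is elementary: \<open>\<eta>\<close> is explicit, since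
  the linearised equation has an explicit second solution (\<open>second_solution\<close>), and everything reduces to
  \<open>\<integral>\<^sub>0\<^sup>L\<^sup>/\<^sup>4 \<phi>\<^sup>4 \<le> \<omega> L / 4\<close> (\<open>integral_quartic_le\<close>).

  \<^bold>\<open>Instability for \<open>0 < d < 4c\<close>.\<close> The second pair has \<open>1 < \<sigma> < 5\<close> and \<open>\<tau> < 1\<close>. For real \<open>z = \<rho>\<close> let \<open>D(\<rho>)\<close> be
  the determinant of the map from initial slopes to values of \<open>(P, Q)\<close> at \<open>L/2\<close>. At \<open>\<rho> = 0\<close> the equations
  decouple, and Sturm comparison with \<open>\<phi>\<close> and \<open>\<phi>'\<close> gives exactly one sign change to the first solution and
  none to the second, so \<open>D(0) < 0\<close>. For large \<open>\<rho>\<close> the coupling prevents conjugate points, so \<open>D(\<rho>) > 0\<close>. A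
  zero \<open>\<rho> > 0\<close> in between is an unstable eigenvalue (\<open>unstable_pair\<close>).

  It remains to compare \<open>d\<close> with \<open>4c\<close>. For \<open>\<gamma> = 0\<close>, \<open>d = 0\<close>. For \<open>B = 1\<close>, \<open>c = \<kappa> + \<gamma>\<close> and \<open>d = 6\<gamma>\<close>. The values of \<open>B\<close> in the first case
  are the roots of \<open>\<kappa> (B\<^sup>2 + 1) = \<gamma> B\<close>, which gives \<open>4c - d = \<kappa> (B\<^sup>2 - 1)\<^sup>2 > 0\<close>.
\<close>

section \<open>Calculus on an interval\<close>

lemma nonneg_integral_zero:
  assumes "continuous_on {a..b::real} f" "\<And>x. x \<in> {a..b} \<Longrightarrow> 0 \<le> (f x :: real)" "integral {a..b} f = 0" "x \<in> {a..b}" "a < b"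
  shows "f x = 0"
proof -
  have "(f has_integral 0) (cbox a b)"
    using assms(1,3) by (metis box_real(2) integrable_continuous_interval integrable_integral)
  then show ?thesis using has_integral_0_cbox_imp_0[of a b f x] assms by auto
qed

lemma zero_function_derivative:
  fixes f :: "real \<Rightarrow> real"
  assumes "a < b" "t \<in> {a..b}" "\<And>s. s \<in> {a..b} \<Longrightarrow> f s = 0" "(f has_real_derivative D) (at t within {a..b})"
  shows "D = 0"
proof -
  have "(f has_vector_derivative 0) (at t within {a..b})"
    by (rule has_vector_derivative_transform[of t "{a..b}" _ "\<lambda>_. 0"]) (use assms in auto)
  then show ?thesis using assms vector_derivative_unique_within_closed_interval[of a b t f 0 D]
    by (simp add: has_real_derivative_iff_has_vector_derivative)
qed

text \<open>A quadratic polynomial in \<open>c\<close> without constant term that is never negative has no linear term. This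
  is how a null vector of a nonnegative form is seen to be orthogonal to everything.\<close>

lemma linear_term_zero:
  fixes b q :: real
  assumes "\<And>c. 0 \<le> 2 * c * b + c\<^sup>2 * q" shows "b = 0"
proof (rule ccontr)
  assume b: "b \<noteq> 0"
  define d where "d = \<bar>q\<bar> + 1"
  have d: "d > 0" "q < d" by (auto simp: d_def)
  have "0 \<le> 2 * (- b / d) * b + (- b / d)\<^sup>2 * q" by (rule assms)
  also have "\<dots> = (b\<^sup>2 / d\<^sup>2) * (q - 2 * d)" using d by (simp add: field_simps power2_eq_square)
  also have "\<dots> < 0" using b d by (intro mult_pos_neg) auto
  finally show False by simp
qed

lemma singular_2x2_kernel:
  fixes p1 p2 q1 q2 :: real
  assumes "p1 * q2 - p2 * q1 = 0"
  obtains a b where "a \<noteq> 0 \<or> b \<noteq> 0" "a * p1 + b * p2 = 0" "a * q1 + b * q2 = 0"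
proof (cases "p1 = 0 \<and> p2 = 0")
  case True
  show ?thesis
  proof (cases "q1 = 0 \<and> q2 = 0")
    case True
    then show ?thesis using that[of 1 0] \<open>p1 = 0 \<and> p2 = 0\<close> by simp
  next
    case False
    then show ?thesis using that[of "q2" "- q1"] True by (auto simp: algebra_simps)
  qed
next
  case False
  then show ?thesis using that[of p2 "- p1"] assms by (auto simp: algebra_simps)
qed

text \<open>Jacobi's substitution: if \<open>y'' = q y\<close> and \<open>y > 0\<close>, then
  \<open>f'\<^sup>2 + q f\<^sup>2 = (f' - f y'/y)\<^sup>2 + (f\<^sup>2 y'/y)'\<close>, and the exact derivative integrates to \<open>0\<close>. As \<open>y\<close> may vanish at the
  end points, where \<open>f\<^sup>2 y'/y\<close> is then undefined, the proof divides by \<open>y + \<epsilon>\<close> and lets \<open>\<epsilon> \<rightarrow> 0\<close>.\<close>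

lemma jacobi_form_nonneg:
  fixes y y' q f f' :: "real \<Rightarrow> real"
  assumes ab: "a < b"
    and y: "\<And>x. x \<in> {a..b} \<Longrightarrow> (y has_real_derivative y' x) (at x within {a..b})"
    and y': "\<And>x. x \<in> {a..b} \<Longrightarrow> (y' has_real_derivative q x * y x) (at x within {a..b})"
    and pos: "\<And>x. a < x \<Longrightarrow> x < b \<Longrightarrow> y x > 0"
    and f: "\<And>x. x \<in> {a..b} \<Longrightarrow> (f has_real_derivative f' x) (at x within {a..b})"
    and f': "continuous_on {a..b} f'" and q: "continuous_on {a..b} q"
    and fa: "f a = 0" and fb: "f b = 0"
  shows "0 \<le> integral {a..b} (\<lambda>x. (f' x)\<^sup>2 + q x * (f x)\<^sup>2)"
proof -
  have cy: "continuous_on {a..b} y" and cy': "continuous_on {a..b} y'" and cf: "continuous_on {a..b} f"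
    using DERIV_continuous_on[OF y] DERIV_continuous_on[OF y'] DERIV_continuous_on[OF f] by auto
  have y0: "y x \<ge> 0" if "x \<in> {a..b}" for x
  proof -
    have "closure {a<..<b} = {a..b}" using ab by simp
    moreover have "y ` closure {a<..<b} \<subseteq> {0..}"
      by (rule image_closure_subset) (use cy ab pos in \<open>auto intro: less_imp_le\<close>)
    ultimately have "y ` {a..b} \<subseteq> {0..}" by simp
    then have "y x \<in> {0..}" using that by (rule subsetD[OF _ imageI])
    then show ?thesis by simp
  qed
  define e where "e = (\<lambda>n::nat. 1 / real (Suc n))"
  have e: "e n > 0" for n by (simp add: e_def)
  have elim: "e \<longlonglongrightarrow> 0" unfolding e_def by (rule LIMSEQ_Suc[OF lim_1_over_n])
  define g where "g = (\<lambda>n x. (f' x)\<^sup>2 + q x * (y x / (y x + e n)) * (f x)\<^sup>2)"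
  have ne: "y x + e n \<noteq> 0" "y x + e n > 0" if "x \<in> {a..b}" for x n
    using y0[OF that] e[of n] by auto
  have gint: "g n integrable_on {a..b}" for n
    unfolding g_def by (intro integrable_continuous_interval continuous_intros f' q cy cf)
      (use ne in blast)
  have gpos: "0 \<le> integral {a..b} (g n)" for n
  proof -
    (* The derivative w' of f^2 y' / (y + e) is g minus a square. *)
    define w where "w = (\<lambda>x. (f x)\<^sup>2 * y' x / (y x + e n))"
    define w' where "w' = (\<lambda>x. g n x - (f' x - f x * y' x / (y x + e n))\<^sup>2)"
    have "(w has_vector_derivative w' x) (at x within {a..b})" if x: "x \<in> {a..b}" for x
    proof -
      have "(w has_real_derivative w' x) (at x within {a..b})"
        unfolding w_def w'_def g_def
        by (rule derivative_eq_intros f[OF x] y[OF x] y'[OF x] ne[OF x] refl)+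
           (use ne[OF x, of n] in \<open>simp add: divide_simps; algebra\<close>)
      then show ?thesis by (simp add: has_real_derivative_iff_has_vector_derivative)
    qed
    then have "(w' has_integral (w b - w a)) {a..b}"
      using ab by (intro fundamental_theorem_of_calculus) auto
    moreover have "w b - w a = 0" by (simp add: w_def fa fb)
    ultimately have "(w' has_integral 0) {a..b}" by simp
    moreover have "(g n has_integral integral {a..b} (g n)) {a..b}" using gint by blast
    ultimately show ?thesis
      by (rule has_integral_le) (simp add: w'_def)
  qed
  have "(\<lambda>n. integral {a..b} (g n)) \<longlonglongrightarrow> integral {a..b} (\<lambda>x. (f' x)\<^sup>2 + q x * (f x)\<^sup>2)"
  proof (rule dominated_convergence(2)[where h = "\<lambda>x. (f' x)\<^sup>2 + \<bar>q x\<bar> * (f x)\<^sup>2"])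
    show "(\<lambda>x. (f' x)\<^sup>2 + \<bar>q x\<bar> * (f x)\<^sup>2) integrable_on {a..b}"
      by (intro integrable_continuous_interval continuous_intros f' q cf)
    show "norm (g n x) \<le> (f' x)\<^sup>2 + \<bar>q x\<bar> * (f x)\<^sup>2" if x: "x \<in> {a..b}" for n x
    proof -
      have "0 \<le> y x / (y x + e n)" "y x / (y x + e n) \<le> 1"
        using y0[OF x] e[of n] by (auto simp: field_simps)
      then have 1: "\<bar>q x\<bar> * (y x / (y x + e n)) * (f x)\<^sup>2 \<le> \<bar>q x\<bar> * (f x)\<^sup>2"
        by (intro mult_right_mono mult_left_le) auto
      have "norm (g n x) \<le> (f' x)\<^sup>2 + \<bar>q x\<bar> * t * (f x)\<^sup>2" if "t = y x / (y x + e n)" "0 \<le> t" for t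
        unfolding g_def that(1)[symmetric] using that(2)
        by (intro order_trans[OF norm_triangle_ineq]) (simp add: abs_mult)
      from this[OF refl \<open>0 \<le> y x / (y x + e n)\<close>] 1
      show ?thesis by linarith
    qed
    show "(\<lambda>n. g n x) \<longlonglongrightarrow> (f' x)\<^sup>2 + q x * (f x)\<^sup>2" if x: "x \<in> {a..b}" for x
    proof (cases "x = a \<or> x = b")
      case True
      then have "f x = 0" using fa fb by auto
      then show ?thesis by (simp add: g_def)
    next
      case False
      then have "y x > 0" using x pos by force
      then have "(\<lambda>n. g n x) \<longlonglongrightarrow> (f' x)\<^sup>2 + q x * (y x / (y x + 0)) * (f x)\<^sup>2"
        unfolding g_def by (intro tendsto_intros elim) auto
      then show ?thesis using \<open>y x > 0\<close> by simp
    qed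
  qed (use gint in auto)
  then show ?thesis
    by (rule LIMSEQ_le_const) (use gpos in auto)
qed

text \<open>The first point after \<open>a\<close> where \<open>f\<close> is no longer positive. The sign of the derivative there is what
  the comparison arguments below contradict.\<close>

lemma first_zero:
  fixes f f' :: "real \<Rightarrow> real"
  assumes ab: "a < b" and d: "\<And>x. x \<in> {a..b} \<Longrightarrow> (f has_real_derivative f' x) (at x within {a..b})"
    and fa: "f a = 0" "f' a > 0" and fb: "\<not> f b > 0"
  obtains c where "a < c" "c \<le> b" "f c = 0" "\<And>x. a < x \<Longrightarrow> x < c \<Longrightarrow> f x > 0" "f' c \<le> 0"
proof -
  obtain \<delta> where \<delta>: "\<delta> > 0" "\<And>h. 0 < h \<Longrightarrow> a + h \<in> {a..b} \<Longrightarrow> h < \<delta> \<Longrightarrow> f a < f (a + h)"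
    using has_real_derivative_pos_inc_right[OF d fa(2)] ab by auto
  have near: "f x > 0" if "a < x" "x < a + \<delta>" "x \<le> b" for x
    using \<delta>(2)[of "x - a"] that fa by auto
  have b: "a + \<delta> \<le> b"
  proof (rule ccontr)
    assume "\<not> a + \<delta> \<le> b"
    then have "f b > 0" using ab by (intro near) auto
    then show False using fb by simp
  qed
  have cf: "continuous_on {a..b} f" using d by (rule DERIV_continuous_on)
  (* Staying at least delta beyond a keeps a itself out of this closed set of points with nonpositive value. *)
  define S where "S = {a + \<delta>..b} \<inter> ({a..b} \<inter> f -` {..0})"
  have "closed ({a..b} \<inter> f -` {..0})"
    by (rule continuous_closed_preimage[OF cf]) simp_all
  then have S1: "closed S" unfolding S_def by (rule closed_Int[OF closed_atLeastAtMost])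
  have S2: "b \<in> S" unfolding S_def using fb b ab by simp
  have S3: "bdd_below S" unfolding S_def using \<delta>(1) by (intro bdd_belowI[of _ a]) simp
  define c where "c = Inf S"
  have cS: "c \<in> S" unfolding c_def by (rule closed_contains_Inf[OF _ S3 S1]) (use S2 in blast)
  have c: "a < c" "c \<le> b" "f c \<le> 0" using cS \<delta> by (auto simp: S_def)
  have pos: "f x > 0" if "a < x" "x < c" for x
  proof (rule ccontr)
    assume "\<not> f x > 0"
    then have "\<not> x < a + \<delta>" using near[of x] that c by linarith
    then have "x \<in> S" using that c \<open>\<not> f x > 0\<close> by (simp add: S_def)
    then have "c \<le> x" unfolding c_def using S3 by (rule cInf_lower)
    then show False using that by simp
  qed
  have "f c = 0"
  proof -
    have "closure {a<..<c} = {a..c}" using c by simp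
    moreover have "f ` closure {a<..<c} \<subseteq> {0..}"
    proof (rule image_closure_subset)
      show "continuous_on (closure {a<..<c}) f"
        using c by (simp add: continuous_on_subset[OF cf])
    qed (use pos in \<open>auto intro: less_imp_le\<close>)
    ultimately have "f ` {a..c} \<subseteq> {0..}" by simp
    moreover have "f c \<in> f ` {a..c}" using c by simp
    ultimately have "f c \<in> {0..}" by (rule subsetD)
    then show ?thesis using c by simp
  qed
  moreover have "f' c \<le> 0"
  proof (rule ccontr)
    assume "\<not> f' c \<le> 0"
    then have "f' c > 0" by simp
    then obtain \<epsilon> where \<epsilon>: "\<epsilon> > 0" "\<And>h. 0 < h \<Longrightarrow> c - h \<in> {a..b} \<Longrightarrow> h < \<epsilon> \<Longrightarrow> f (c - h) < f c"
      using has_real_derivative_pos_inc_left[OF d, of c] c by auto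
    define h where "h = min \<epsilon> (c - a) / 2"
    have "0 < h" "h < \<epsilon>" "a < c - h" using \<epsilon>(1) c by (auto simp: h_def min_def field_simps)
    then show False using \<epsilon>(2)[of h] pos[of "c - h"] c \<open>f c = 0\<close> by auto
  qed
  ultimately show ?thesis using that c pos by blast
qed

section \<open>Linear Volterra equations\<close>

text \<open>The estimate in the norm weighted by \<open>exp (- K x)\<close>: for \<open>K \<ge> 2 C T\<close> it turns a Volterra operator whose
  coefficient is bounded by \<open>C\<close> into a contraction with factor \<open>1/2\<close> on the whole interval.\<close>

lemma weighted_kernel_bound:
  fixes g :: "real \<Rightarrow> real"
  assumes x: "0 \<le> x" "x \<le> T" and K: "K > 0" and m: "m \<ge> 0"
    and g: "continuous_on {0..T} g" and le: "\<And>s. s \<in> {0..T} \<Longrightarrow> g s \<le> m * exp (K * s)"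
  shows "integral {0..x} (\<lambda>s. (x - s) * g s) \<le> T * m / K * exp (K * x)"
proof -
  have gx: "continuous_on {0..x} g" using g x by (auto intro: continuous_on_subset)
  have "((\<lambda>s. T * m * exp (K * s)) has_integral (T * m / K * exp (K * x) - T * m / K * exp (K * 0))) {0..x}"
    using x K
    by (intro fundamental_theorem_of_calculus)
      (auto intro!: derivative_eq_intros simp: has_real_derivative_iff_has_vector_derivative[symmetric])
  moreover have "(x - s) * g s \<le> T * m * exp (K * s)" if "s \<in> {0..x}" for s
  proof -
    have "(x - s) * g s \<le> (x - s) * (m * exp (K * s))" using that le[of s] x by (intro mult_left_mono) auto
    also have "\<dots> \<le> T * (m * exp (K * s))" using that x m by (intro mult_right_mono) auto
    finally show ?thesis by simp
  qed
  ultimately have "integral {0..x} (\<lambda>s. (x - s) * g s) \<le> T * m / K * exp (K * x) - T * m / K * exp (K * 0)"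
    by (intro has_integral_le[OF integrable_integral]) (auto intro!: integrable_continuous_interval continuous_intros gx)
  also have "\<dots> \<le> T * m / K * exp (K * x)" using x m K by simp
  finally show ?thesis .
qed

lemma volterra_gronwall:
  fixes u :: "real \<Rightarrow> real"
  assumes T: "T > 0" and C: "C \<ge> 0" and h: "h \<ge> 0" and u: "continuous_on {0..T} u" "\<And>x. x \<in> {0..T} \<Longrightarrow> 0 \<le> u x"
    and le: "\<And>x. x \<in> {0..T} \<Longrightarrow> u x \<le> h + integral {0..x} (\<lambda>s. (x - s) * (C * u s))"
    and x: "x \<in> {0..T}"
  shows "u x \<le> 2 * exp ((2 * C * T + 1) * T) * h"
proof -
  (* The weight exp (- K x); with this K the integral term costs half of the maximum of w. *)
  define K where "K = 2 * C * T + 1"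
  have K: "K > 0" using C T by (simp add: K_def add_nonneg_pos)
  define w where "w = (\<lambda>x. exp (- (K * x)) * u x)"
  have "continuous_on {0..T} w" unfolding w_def by (intro continuous_intros u)
  then obtain t where t: "t \<in> {0..T}" and max: "\<And>s. s \<in> {0..T} \<Longrightarrow> w s \<le> w t"
    using continuous_attains_sup[of "{0..T}" w] T by auto
  have wt: "w t \<ge> 0" using u(2)[OF t] by (simp add: w_def)
  have us: "u s = w s * exp (K * s)" for s by (simp add: w_def flip: exp_add)
  have "integral {0..t} (\<lambda>s. (t - s) * (C * u s)) \<le> T * (C * w t) / K * exp (K * t)"
    using t C K wt u max
    by (intro weighted_kernel_bound) (auto intro!: continuous_intros mult_left_mono simp: us mult.assoc)
  also have "T * (C * w t) / K \<le> w t / 2"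
  proof -
    have "2 * (T * C) * w t \<le> K * w t" using wt by (intro mult_right_mono) (auto simp: K_def)
    then show ?thesis using K by (simp add: field_simps)
  qed
  finally have "u t \<le> h + w t / 2 * exp (K * t)" using le[OF t] by (simp add: mult_right_mono)
  then have "w t \<le> h * exp (- (K * t)) + w t / 2"
    using mult_right_mono[of "u t" "h + w t / 2 * exp (K * t)" "exp (- (K * t))"]
    by (simp add: w_def algebra_simps flip: exp_add)
  also have "h * exp (- (K * t)) \<le> h * 1" using t K h by (intro mult_left_mono) auto
  finally have wt2: "w t \<le> 2 * h" by simp
  have "u x = w x * exp (K * x)" by (rule us)
  also have "\<dots> \<le> (2 * h) * exp (K * T)"
    using max[OF x] wt2 x K h by (intro mult_mono) auto
  finally show ?thesis by (simp add: K_def mult_ac)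
qed

text \<open>With \<open>x - s\<close> under the integral, one differentiation removes the kernel: \<open>\<integral>\<^sub>0\<^sup>x (x - s) W(s) ds\<close> is the second
  antiderivative of \<open>W\<close> with vanishing initial data.\<close>

lemma volterra_integral_deriv:
  fixes W :: "real \<Rightarrow> 'a::banach"
  assumes W: "continuous_on {0..T} W" and x: "x \<in> {0..T}"
  shows "((\<lambda>x. integral {0..x} (\<lambda>s. (x - s) *\<^sub>R W s)) has_vector_derivative integral {0..x} W) (at x within {0..T})"
proof -
  have eq: "integral {0..x} (\<lambda>s. (x - s) *\<^sub>R W s) = x *\<^sub>R integral {0..x} W - integral {0..x} (\<lambda>s. s *\<^sub>R W s)"
    if "x \<in> {0..T}" for x
  proof -
    have "continuous_on {0..x} W" using W that by (auto intro: continuous_on_subset)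
    then have "integral {0..x} (\<lambda>s. x *\<^sub>R W s - s *\<^sub>R W s) = integral {0..x} (\<lambda>s. x *\<^sub>R W s) - integral {0..x} (\<lambda>s. s *\<^sub>R W s)"
      by (intro integral_diff integrable_continuous_interval continuous_intros)
    then show ?thesis by (simp add: scaleR_left_diff_distrib)
  qed
  have "((\<lambda>x. x *\<^sub>R integral {0..x} W - integral {0..x} (\<lambda>s. s *\<^sub>R W s)) has_vector_derivative
      (x *\<^sub>R W x + 1 *\<^sub>R integral {0..x} W) - x *\<^sub>R W x) (at x within {0..T})"
    by (intro has_vector_derivative_diff has_vector_derivative_scaleR DERIV_ident integral_has_vector_derivative
          continuous_intros W x)
  then have "((\<lambda>x. x *\<^sub>R integral {0..x} W - integral {0..x} (\<lambda>s. s *\<^sub>R W s)) has_vector_derivative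
      integral {0..x} W) (at x within {0..T})" by simp
  then show ?thesis
    by (rule has_vector_derivative_transform[OF x, rotated]) (simp add: eq)
qed

text \<open>Equations \<open>U'' = M U + H''\<close> are solved in integrated form, so that a rough inhomogeneity only has to
  enter through a continuous \<open>H\<close>. The unknown of the fixed-point argument is \<open>exp (- K x) U x\<close>.\<close>

lemma volterra_exists:
  fixes M :: "real \<Rightarrow> 'a::euclidean_space \<Rightarrow> 'a"
  assumes T: "T > 0" and C: "C \<ge> 0"
    and lin: "\<And>s u v. s \<in> {0..T} \<Longrightarrow> M s (u - v) = M s u - M s v"
    and bnd: "\<And>s v. s \<in> {0..T} \<Longrightarrow> norm (M s v) \<le> C * norm v"
    and cont: "\<And>U. continuous_on {0..T} U \<Longrightarrow> continuous_on {0..T} (\<lambda>s. M s (U s))"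
    and H: "continuous_on {0..T} H"
  obtains U where "continuous_on {0..T} U"
    "\<And>x. x \<in> {0..T} \<Longrightarrow> U x = H x + integral {0..x} (\<lambda>s. (x - s) *\<^sub>R M s (U s))"
proof -
  define K where "K = 2 * C * T + 1"
  have K: "K > 0" using C T by (simp add: K_def add_nonneg_pos)
  (* Clamping to [0, T] turns functions on the interval into bounded continuous functions on the line. *)
  define c where "c = (\<lambda>x::real. max 0 (min T x))"
  have c: "c x \<in> {0..T}" for x using T by (auto simp: c_def)
  have cid: "x \<in> {0..T} \<Longrightarrow> c x = x" for x by (auto simp: c_def)
  have cc: "continuous_on UNIV c" unfolding c_def by (intro continuous_intros)
  define I where "I = (\<lambda>Z x. integral {0..x} (\<lambda>s. (x - s) *\<^sub>R M s (exp (K * s) *\<^sub>R Z s)))"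
  define P where "P = (\<lambda>Z x. exp (- (K * c x)) *\<^sub>R (H (c x) + I Z (c x)))"
  have Wc: "continuous_on {0..T} (\<lambda>s. M s (exp (K * s) *\<^sub>R Z s))" if "continuous_on {0..T} Z" for Z
    by (rule cont) (intro continuous_intros that)
  have Ic: "continuous_on {0..T} (I Z)" if "continuous_on {0..T} Z" for Z
    unfolding I_def
    by (rule continuous_on_vector_derivative[OF volterra_integral_deriv[OF Wc[OF that]]])
  have Pb: "P (apply_bcontfun Z) \<in> bcontfun" for Z :: "real \<Rightarrow>\<^sub>C 'a"
  proof -
    have Zc: "continuous_on {0..T} (apply_bcontfun Z)"
      by (rule continuous_on_subset[OF continuous_on_apply_bcontfun]) auto
    define Q where "Q = (\<lambda>t. exp (- (K * t)) *\<^sub>R (H t + I (apply_bcontfun Z) t))"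
    have Q: "continuous_on {0..T} Q" unfolding Q_def by (intro continuous_intros H Ic Zc)
    then have "bounded (Q ` {0..T})" by (intro compact_imp_bounded compact_continuous_image) auto
    then obtain b where "\<And>t. t \<in> {0..T} \<Longrightarrow> norm (Q t) \<le> b" unfolding bounded_iff by blast
    moreover have "P (apply_bcontfun Z) = (\<lambda>x. Q (c x))" by (simp add: P_def Q_def)
    moreover have "continuous_on UNIV (\<lambda>x. Q (c x))"
      by (rule continuous_on_compose2[OF Q cc]) (use c in auto)
    ultimately show ?thesis using c by (auto intro: bcontfun_normI)
  qed
  define \<Phi> where "\<Phi> = (\<lambda>Z::real \<Rightarrow>\<^sub>C 'a. Bcontfun (P (apply_bcontfun Z)))"
  have \<Phi>: "apply_bcontfun (\<Phi> Z) = P (apply_bcontfun Z)" for Z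
    unfolding \<Phi>_def by (rule Bcontfun_inverse[OF Pb])
  have "dist (\<Phi> Z) (\<Phi> Y) \<le> 1/2 * dist Z Y" for Z Y
  proof (rule dist_bound)
    fix x
    define t where "t = c x"
    have t: "0 \<le> t" "t \<le> T" using c[of x] by (auto simp: t_def)
    have cZ: "continuous_on {0..T} (apply_bcontfun Z)" for Z :: "real \<Rightarrow>\<^sub>C 'a"
      by (rule continuous_on_subset[OF continuous_on_apply_bcontfun]) auto
    define D where "D = (\<lambda>s. M s (exp (K * s) *\<^sub>R apply_bcontfun Z s) - M s (exp (K * s) *\<^sub>R apply_bcontfun Y s))"
    have Dc: "continuous_on {0..T} D" unfolding D_def by (intro continuous_intros Wc cZ)
    have Dn: "norm (D s) \<le> C * dist Z Y * exp (K * s)" if s: "s \<in> {0..T}" for s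
    proof -
      have "D s = M s (exp (K * s) *\<^sub>R apply_bcontfun Z s - exp (K * s) *\<^sub>R apply_bcontfun Y s)"
        unfolding D_def by (rule lin[OF s, symmetric])
      also have "norm \<dots> \<le> C * norm (exp (K * s) *\<^sub>R (apply_bcontfun Z s - apply_bcontfun Y s))"
        using bnd[OF s] by (simp add: scaleR_right_diff_distrib)
      also have "\<dots> \<le> C * (exp (K * s) * dist Z Y)"
        using dist_bounded[of Z s Y] C by (intro mult_left_mono) (auto simp: dist_norm)
      finally show ?thesis by (simp add: mult_ac)
    qed
    have sub: "continuous_on {0..t} (\<lambda>s. M s (exp (K * s) *\<^sub>R apply_bcontfun Z s))" for Z :: "real \<Rightarrow>\<^sub>C 'a"
      by (rule continuous_on_subset[OF Wc[OF cZ]]) (use t in auto)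
    have "I (apply_bcontfun Z) t - I (apply_bcontfun Y) t = integral {0..t} (\<lambda>s. (t - s) *\<^sub>R D s)"
      unfolding I_def D_def scaleR_right_diff_distrib
      by (intro integral_diff[symmetric] integrable_continuous_interval continuous_intros sub)
    also have "norm \<dots> \<le> integral {0..t} (\<lambda>s. (t - s) * norm (D s))"
    proof (rule integral_norm_bound_integral)
      have "continuous_on {0..t} D" by (rule continuous_on_subset[OF Dc]) (use t in auto)
      then show "(\<lambda>s. (t - s) *\<^sub>R D s) integrable_on {0..t}" "(\<lambda>s. (t - s) * norm (D s)) integrable_on {0..t}"
        by (auto intro!: integrable_continuous_interval continuous_intros)
    qed auto
    also have "\<dots> \<le> T * (C * dist Z Y) / K * exp (K * t)"
      using t K C Dn by (intro weighted_kernel_bound) (auto intro!: continuous_intros Dc)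
    finally have "norm (I (apply_bcontfun Z) t - I (apply_bcontfun Y) t) \<le> T * (C * dist Z Y) / K * exp (K * t)" .
    note N = this
    have "dist (P (apply_bcontfun Z) x) (P (apply_bcontfun Y) x) = exp (- (K * t)) * norm (I (apply_bcontfun Z) t - I (apply_bcontfun Y) t)"
      by (simp only: P_def t_def[symmetric] dist_norm add_diff_cancel_left scaleR_right_diff_distrib[symmetric] norm_scaleR) simp
    also have "\<dots> \<le> exp (- (K * t)) * (T * (C * dist Z Y) / K * exp (K * t))"
      by (rule mult_left_mono[OF N]) simp
    also have "\<dots> = T * (C * dist Z Y) / K" by (simp add: exp_minus)
    also have "\<dots> \<le> 1/2 * dist Z Y"
    proof -
      have "2 * (T * C) * dist Z Y \<le> K * dist Z Y" by (intro mult_right_mono) (auto simp: K_def)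
      then show ?thesis using K by (simp add: field_simps)
    qed
    finally show "dist (apply_bcontfun (\<Phi> Z) x) (apply_bcontfun (\<Phi> Y) x) \<le> 1/2 * dist Z Y" by (simp add: \<Phi>)
  qed
  then have "\<exists>!Z. \<Phi> Z = Z" by (intro banach_fix_type[of "1/2"]) auto
  then obtain Z where "\<Phi> Z = Z" by auto
  then have Z: "apply_bcontfun Z x = P (apply_bcontfun Z) x" for x by (metis \<Phi>)
  define U where "U = (\<lambda>x. exp (K * x) *\<^sub>R apply_bcontfun Z x)"
  have cZ: "continuous_on {0..T} (apply_bcontfun Z)"
    by (rule continuous_on_subset[OF continuous_on_apply_bcontfun]) auto
  show ?thesis
  proof (rule that)
    show "continuous_on {0..T} U" unfolding U_def by (intro continuous_intros cZ)
    show "U x = H x + integral {0..x} (\<lambda>s. (x - s) *\<^sub>R M s (U s))" if x: "x \<in> {0..T}" for x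
      unfolding U_def using Z[of x] by (simp add: P_def cid[OF x] I_def flip: exp_add)
  qed
qed

lemma volterra_bound:
  fixes M :: "real \<Rightarrow> 'a::euclidean_space \<Rightarrow> 'a"
  assumes T: "T > 0" and C: "C \<ge> 0"
    and bnd: "\<And>s v. s \<in> {0..T} \<Longrightarrow> norm (M s v) \<le> C * norm v"
    and MU: "continuous_on {0..T} (\<lambda>s. M s (U s))"
    and U: "continuous_on {0..T} U"
      "\<And>x. x \<in> {0..T} \<Longrightarrow> U x = H x + integral {0..x} (\<lambda>s. (x - s) *\<^sub>R M s (U s))"
    and h: "\<And>x. x \<in> {0..T} \<Longrightarrow> norm (H x) \<le> h"
    and x: "x \<in> {0..T}"
  shows "norm (U x) \<le> 2 * exp ((2 * C * T + 1) * T) * h"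
proof (rule volterra_gronwall[OF T C, where u = "\<lambda>x. norm (U x)"])
  show "0 \<le> h" using h[OF x] norm_ge_zero order_trans by blast
  show "continuous_on {0..T} (\<lambda>x. norm (U x))" by (intro continuous_intros U)
  fix x assume x: "x \<in> {0..T}"
  have sub: "continuous_on {0..x} U" "continuous_on {0..x} (\<lambda>s. M s (U s))"
    using x U(1) MU by (auto intro: continuous_on_subset)
  have "norm (U x) \<le> h + norm (integral {0..x} (\<lambda>s. (x - s) *\<^sub>R M s (U s)))"
    unfolding U(2)[OF x] by (rule norm_triangle_mono[OF h[OF x] order_refl])
  also have "norm (integral {0..x} (\<lambda>s. (x - s) *\<^sub>R M s (U s))) \<le> integral {0..x} (\<lambda>s. (x - s) * (C * norm (U s)))"
  proof (rule integral_norm_bound_integral)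
    show "(\<lambda>s. (x - s) *\<^sub>R M s (U s)) integrable_on {0..x}" "(\<lambda>s. (x - s) * (C * norm (U s))) integrable_on {0..x}"
      by (intro integrable_continuous_interval continuous_intros sub)+
    show "norm ((x - s) *\<^sub>R M s (U s)) \<le> (x - s) * (C * norm (U s))" if "s \<in> {0..x}" for s
      using that x bnd[of s "U s"] by (auto intro!: mult_left_mono)
  qed
  finally show "norm (U x) \<le> h + integral {0..x} (\<lambda>s. (x - s) * (C * norm (U s)))" by simp
qed (use x in auto)

section \<open>The wave on half a period\<close>

text \<open>The properties of the profile that the spectral argument uses: the equation, the shape of one arch
  \<open>[0, T]\<close> with top at \<open>l = T/2\<close>, and the range of the amplitude. In the plane of \<open>\<phi>\<close> and \<open>\<phi>'\<close>, the bound
  \<open>\<phi>(l)\<^sup>4 > 3\<omega>\<close> says that the orbit has positive energy and thus crosses \<open>0\<close>, and \<open>\<phi>(l)\<^sup>4 < 4\<omega>\<close> that the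
  other two roots of the cubic in \<open>integral_quartic_le\<close> are real.\<close>

locale quintic_wave =
  fixes \<phi> \<phi>1 :: "real \<Rightarrow> real" and \<omega> l T :: real
  assumes l: "0 < l" and T: "T = 2 * l" and \<omega>: "0 < \<omega>"
    and \<phi>: "\<And>x. (\<phi> has_real_derivative \<phi>1 x) (at x)"
    and \<phi>1: "\<And>x. (\<phi>1 has_real_derivative \<omega> * \<phi> x - \<phi> x ^ 5) (at x)"
    and \<phi>_0: "\<phi> 0 = 0" and \<phi>_sym: "\<And>x. \<phi> (T - x) = \<phi> x"
    and \<phi>1_pos: "\<And>x. 0 \<le> x \<Longrightarrow> x < l \<Longrightarrow> \<phi>1 x > 0"
    and amp: "3 * \<omega> < \<phi> l ^ 4" "\<phi> l ^ 4 < 4 * \<omega>"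
begin

lemma continuous_\<phi> [continuous_intros]: "continuous_on S \<phi>" "continuous_on S \<phi>1"
  using \<phi> \<phi>1 by (auto intro!: DERIV_continuous_on[OF has_field_derivative_at_within])

lemma \<phi>1_sym: "\<phi>1 (T - x) = - \<phi>1 x"
proof -
  have "((\<lambda>x. \<phi> (T - x)) has_real_derivative \<phi>1 (T - x) * (- 1)) (at x)"
    by (rule DERIV_chain2[OF \<phi>]) (auto intro!: derivative_eq_intros)
  then have "(\<phi> has_real_derivative \<phi>1 (T - x) * (- 1)) (at x)"
    by (simp add: \<phi>_sym)
  from DERIV_unique[OF this \<phi>[of x]] show ?thesis by simp
qed

lemma \<phi>1_l: "\<phi>1 l = 0"
  using \<phi>1_sym[of l] by (simp add: T)

lemma \<phi>_T: "\<phi> T = 0" using \<phi>_sym[of T] \<phi>_0 by simp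

lemma \<phi>1_neg: "l < x \<Longrightarrow> x \<le> T \<Longrightarrow> \<phi>1 x < 0"
  using \<phi>1_sym[of x] \<phi>1_pos[of "T - x"] by (simp add: T)

lemma \<phi>_pos: assumes "0 < x" "x < T" shows "\<phi> x > 0"
proof -
  have *: "\<phi> x > 0" if "0 < x" "x \<le> l" for x
  proof -
    have "\<phi> 0 < \<phi> x"
      by (rule DERIV_pos_imp_increasing_open[OF that(1)])
        (use that \<phi> \<phi>1_pos continuous_\<phi> in \<open>auto intro!: exI\<close>)
    then show ?thesis by (simp add: \<phi>_0)
  qed
  show ?thesis
  proof (cases "x \<le> l")
    case False
    then have "\<phi> (T - x) > 0" using assms by (intro *) (auto simp: T)
    then show ?thesis by (simp add: \<phi>_sym)
  qed (use * assms in auto)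
qed

lemma \<phi>_nonneg: "0 \<le> x \<Longrightarrow> x \<le> T \<Longrightarrow> \<phi> x \<ge> 0"
  using \<phi>_pos[of x] \<phi>_0 \<phi>_T by (cases "x = 0 \<or> x = T") auto

lemma T_pos: "0 < T" using l T by simp

lemma \<phi>1_deriv2: "((\<lambda>x. \<omega> * \<phi> x - \<phi> x ^ 5) has_real_derivative (\<omega> - 5 * \<phi> x ^ 4) * \<phi>1 x) (at x)"
  by (auto intro!: derivative_eq_intros \<phi> simp: algebra_simps)

lemma energy: "(\<phi>1 x)\<^sup>2 = (\<phi>1 0)\<^sup>2 + \<omega> * (\<phi> x)\<^sup>2 - \<phi> x ^ 6 / 3"
proof -
  have "((\<lambda>x. (\<phi>1 x)\<^sup>2 - \<omega> * (\<phi> x)\<^sup>2 + (1/3) * \<phi> x ^ 6) has_real_derivative 0) (at x)" for x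
    by (rule derivative_eq_intros \<phi> \<phi>1 refl)+ (simp add: algebra_simps eval_nat_numeral)
  then have "(\<phi>1 x)\<^sup>2 - \<omega> * (\<phi> x)\<^sup>2 + (1/3) * \<phi> x ^ 6 = (\<phi>1 0)\<^sup>2 - \<omega> * (\<phi> 0)\<^sup>2 + (1/3) * \<phi> 0 ^ 6"
    by (intro DERIV_isconst_all[rule_format]) auto
  then show ?thesis by (simp add: \<phi>_0)
qed

text \<open>With \<open>v = \<phi>\<^sup>2\<close> the energy becomes \<open>3 \<phi>'\<^sup>2 = (a + b - v) (v + a) (v + b)\<close> with \<open>0 < a < b\<close>. Up to a
  multiple of the derivative of \<open>\<phi> \<phi>' / (v + a)\<close>, which has vanishing boundary values, \<open>\<phi>\<^sup>4 - \<omega>\<close> equals a positive multiple of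
  \<open>(a/2 - v) / (v + a)\<close>. This changes sign at \<open>v = a/2\<close>, so it is compared with another function that changes
  sign at the same place and has integral zero: the derivative of \<open>F = \<phi> \<phi>' / ((v + \<nu>) S(v))\<close>,
  where \<open>S(v)\<^sup>2 = (v + a) (v + b)\<close>. Their quotient \<open>h(v)\<close> is nondecreasing in \<open>v\<close>, hence
  \<open>(a/2 - v) h(v) \<le> (a/2 - v) h(a/2)\<close>, and multiplied by \<open>S(v) / (v + \<nu>)\<^sup>2\<close> the right-hand side
  integrates to \<open>0\<close>.\<close>

lemma integral_quartic_le: "integral {0..l} (\<lambda>x. \<phi> x ^ 4 - \<omega>) \<le> 0"
proof -
  define M where "M = (\<phi> l)\<^sup>2"
  (* M = a + b, - a and - b are the roots of the cubic 3 (phi'(0))^2 + 3 omega v - v^3. *)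
  define s where "s = sqrt (12 * \<omega> - 3 * M\<^sup>2)"
  define a where "a = (M - s) / 2"
  define b where "b = (M + s) / 2"
  define v where "v = (\<lambda>x. (\<phi> x)\<^sup>2)"
  have M4: "\<phi> l ^ 4 = M\<^sup>2" by (simp add: M_def flip: power_mult)
  have M: "0 < M" using \<phi>_pos[of l] l by (simp add: M_def T)
  have s2: "s\<^sup>2 = 12 * \<omega> - 3 * M\<^sup>2" using amp by (simp add: s_def M4)
  have s: "0 < s" using amp by (simp add: s_def M4)
  have sM: "s < M" by (rule power2_less_imp_less) (use s2 amp M M4 in auto)
  have ab: "0 < a" "a < b" "a + b = M" using s sM by (auto simp: a_def b_def field_simps)
  have w3: "3 * \<omega> = a\<^sup>2 + a * b + b\<^sup>2"
    using s2 by (simp add: a_def b_def power2_eq_square field_simps)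
  have e3: "3 * (\<phi>1 0)\<^sup>2 = M * a * b"
  proof -
    have "0 = (\<phi>1 0)\<^sup>2 + \<omega> * M - M ^ 3 / 3"
      using energy[of l] by (simp add: M_def \<phi>1_l flip: power_mult)
    then have "3 * (\<phi>1 0)\<^sup>2 = M ^ 3 - 3 * \<omega> * M" by simp
    also have "\<dots> = M * a * b"
      unfolding w3 using ab(3)[symmetric] by (simp add: power2_eq_square power3_eq_cube algebra_simps)
    finally show ?thesis .
  qed
  have v0: "v x \<ge> 0" for x by (simp add: v_def)
  have en: "3 * (\<phi>1 x)\<^sup>2 = (a + b - v x) * (v x + a) * (v x + b)" for x
  proof -
    have "3 * (\<phi>1 x)\<^sup>2 = 3 * (\<phi>1 0)\<^sup>2 + 3 * \<omega> * v x - v x ^ 3"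
      using energy[of x] by (simp add: v_def flip: power_mult)
    then show ?thesis unfolding e3 w3 ab(3)[symmetric]
      by (simp add: power2_eq_square power3_eq_cube algebra_simps)
  qed
  have dv: "(v has_real_derivative 2 * \<phi> x * \<phi>1 x) (at x)" for x
    unfolding v_def by (rule derivative_eq_intros \<phi> refl)+ simp
  have dp: "((\<lambda>x. \<phi> x * \<phi>1 x) has_real_derivative (\<phi>1 x)\<^sup>2 + \<omega> * v x - v x ^ 3) (at x)" for x
    by (rule derivative_eq_intros \<phi> \<phi>1 refl)+
       (simp add: v_def algebra_simps eval_nat_numeral)
  define F1 where "F1 = (\<lambda>x. \<phi> x * \<phi>1 x / (v x + a))"
  have dF1: "(F1 has_real_derivative (2/3) * ((\<omega> - a\<^sup>2) * ((a / 2 - v x) / (v x + a)) - (v x ^ 2 - \<omega>))) (at x)" for x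
  proof -
    have *: "(2/3) * ((\<omega> - a\<^sup>2) * ((a / 2 - v) / (v + a)) - (v ^ 2 - \<omega>))
       = ((p + \<omega> * v - v ^ 3) * (v + a) - 2 * v * p) / (v + a)\<^sup>2"
      if "3 * p = (a + b - v) * (v + a) * (v + b)" "v \<ge> 0" for v p
    proof -
      have p: "p = (a + b - v) * (v + a) * (v + b) / 3" using that(1) by simp
      have w: "\<omega> = (a\<^sup>2 + a * b + b\<^sup>2) / 3" using w3 by simp
      have "v + a \<noteq> 0" using that(2) ab by simp
      then show ?thesis unfolding p w
        by (simp add: divide_simps) algebra
    qed
    have "v x + a \<noteq> 0" using v0[of x] ab by simp
    then have "(F1 has_real_derivative (((\<phi>1 x)\<^sup>2 + \<omega> * v x - v x ^ 3) * (v x + a) - 2 * v x * (\<phi>1 x)\<^sup>2) / (v x + a)\<^sup>2) (at x)"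
      unfolding F1_def
      by (rule_tac derivative_eq_intros dp dv refl | assumption)+ (simp add: v_def power2_eq_square algebra_simps)
    then show ?thesis by (simp only: *[OF en v0])
  qed
  (* With this shift the derivative of F below has its only zero at v = a / 2. *)
  define \<nu> where "\<nu> = a * (a + b) / (2 * b)"
  have \<nu>: "0 < \<nu>" "\<nu> * (3 * b + a) \<le> 4 * a * b" "4 * \<nu> \<le> 3 * a + b"
  proof -
    show "0 < \<nu>" using ab by (simp add: \<nu>_def)
    have "0 \<le> (5 * b + a) * (b - a)" using ab by simp
    then have "(a + b) * (3 * b + a) \<le> 8 * b * b" by (simp add: algebra_simps)
    then have "a * ((a + b) * (3 * b + a)) \<le> a * (8 * b * b)" using ab by (intro mult_left_mono) auto
    then show 1: "\<nu> * (3 * b + a) \<le> 4 * a * b" using ab by (simp add: \<nu>_def field_simps)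
    have "16 * a * b \<le> (3 * a + b) * (3 * b + a)"
      using sum_squares_ge_zero[of "a - b" 0] by (simp add: algebra_simps)
    with 1 have "4 * \<nu> * (3 * b + a) \<le> (3 * a + b) * (3 * b + a)" by simp
    then show "4 * \<nu> \<le> 3 * a + b" using ab by simp
  qed
  define S where "S = (\<lambda>u. sqrt ((u + a) * (u + b)))"
  have S: "S u > 0" "(S u)\<^sup>2 = (u + a) * (u + b)" if "u \<ge> 0" for u
    using that ab by (auto simp: S_def)
  define h where "h = (\<lambda>u. (u + \<nu>)\<^sup>2 / ((u + a) * S u))"
  have hpos: "h u > 0" if "u \<ge> 0" for u
    using S[OF that] that ab \<nu> by (simp add: h_def)
  (* Monotonicity of h is read off from k = h^2, which is rational. *)
  have hmono: "h u \<le> h w" if "0 \<le> u" "u \<le> w" for u w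
  proof -
    define k where "k = (\<lambda>u. (u + \<nu>) ^ 4 / ((u + a) ^ 3 * (u + b)))"
    have hk: "(h u)\<^sup>2 = k u" if "u \<ge> 0" for u
    proof -
      have "((u + a) * S u)\<^sup>2 = (u + a)\<^sup>2 * ((u + a) * (u + b))"
        by (simp only: power_mult_distrib S(2)[OF that])
      also have "\<dots> = (u + a) ^ 3 * (u + b)" by (simp only: power2_eq_square power3_eq_cube mult.assoc)
      finally have "((u + a) * S u)\<^sup>2 = (u + a) ^ 3 * (u + b)" .
      moreover have "((u + \<nu>)\<^sup>2)\<^sup>2 = (u + \<nu>) ^ 4" by (simp only: power_mult[symmetric]) simp
      ultimately show ?thesis by (simp only: h_def k_def power_divide)
    qed
    have "k u \<le> k w"
    proof (rule DERIV_nonneg_imp_nondecreasing[OF that(2)])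
      fix x assume "u \<le> x" "x \<le> w"
      then have x: "0 \<le> x" using that by simp
      have pos: "0 < x + a" "0 < x + b" "0 < x + \<nu>" using x ab \<nu> by auto
      define X Y Z where "X = x + \<nu>" and "Y = x + a" and "Z = x + b"
      have XYZ: "0 < X" "0 < Y" "0 < Z" using pos by (auto simp: X_def Y_def Z_def)
      have "((\<lambda>u. (u + \<nu>) ^ 4) has_real_derivative 4 * X ^ 3) (at x)"
        by (auto intro!: derivative_eq_intros simp: X_def)
      moreover have "((\<lambda>u. (u + a) ^ 3 * (u + b)) has_real_derivative 3 * Y\<^sup>2 * Z + Y ^ 3) (at x)"
        by (auto intro!: derivative_eq_intros simp: Y_def Z_def)
      ultimately have "(k has_real_derivative (4 * X ^ 3 * (Y ^ 3 * Z) - X ^ 4 * (3 * Y\<^sup>2 * Z + Y ^ 3))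
          / ((Y ^ 3 * Z) * (Y ^ 3 * Z))) (at x)"
        unfolding k_def X_def Y_def Z_def by (rule DERIV_divide) (use pos in auto)
      moreover have "0 \<le> (4 * X ^ 3 * (Y ^ 3 * Z) - X ^ 4 * (3 * Y\<^sup>2 * Z + Y ^ 3)) / ((Y ^ 3 * Z) * (Y ^ 3 * Z))"
      proof (rule divide_nonneg_nonneg)
        have "4 * Y * Z - X * (3 * Z + Y) = (4 * a * b - \<nu> * (3 * b + a)) + x * (3 * a + b - 4 * \<nu>)"
          by (simp add: X_def Y_def Z_def algebra_simps)
        also have "\<dots> \<ge> 0" using \<nu> x by (intro add_nonneg_nonneg mult_nonneg_nonneg) auto
        finally have "0 \<le> X ^ 3 * Y\<^sup>2 * (4 * Y * Z - X * (3 * Z + Y))" using XYZ by simp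
        also have "\<dots> = 4 * X ^ 3 * (Y ^ 3 * Z) - X ^ 4 * (3 * Y\<^sup>2 * Z + Y ^ 3)" by algebra
        finally show "0 \<le> 4 * X ^ 3 * (Y ^ 3 * Z) - X ^ 4 * (3 * Y\<^sup>2 * Z + Y ^ 3)" .
      qed (use XYZ in simp)
      ultimately show "\<exists>y. (k has_real_derivative y) (at x) \<and> 0 \<le> y" by blast
    qed
    then have "(h u)\<^sup>2 \<le> (h w)\<^sup>2" using hk that by simp
    then show ?thesis by (rule power2_le_imp_le) (use hpos[of w] that in auto)
  qed
  define F where "F = (\<lambda>x. \<phi> x * \<phi>1 x / ((v x + \<nu>) * S (v x)))"
  define K where "K = (a + b + 2 * \<nu>) / 3"
  have K: "K > 0" using ab \<nu> by (simp add: K_def)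
  have dF: "(F has_real_derivative K * (a / 2 - v x) * S (v x) / (v x + \<nu>)\<^sup>2) (at x)" for x
  proof -
    define u where "u = v x"
    have u: "u \<ge> 0" by (simp add: u_def v0)
    have pos: "0 < u + a" "0 < u + b" "0 < u + \<nu>" using u ab \<nu> by auto
    define r p where "r = S u" and "p = (\<phi>1 x)\<^sup>2"
    have r: "r > 0" "r\<^sup>2 = (u + a) * (u + b)" using S[OF u] by (auto simp: r_def)
    have "((\<lambda>x. (v x + a) * (v x + b)) has_real_derivative 2 * (2 * u + a + b) * (\<phi> x * \<phi>1 x)) (at x)"
      unfolding u_def by (auto intro!: derivative_eq_intros dv simp: algebra_simps)
    then have d1: "((\<lambda>x. (v x + a) * (v x + b)) has_real_derivative 2 * (2 * u + a + b) * (\<phi> x * \<phi>1 x)) (at x)" .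
    have p1: "0 < (v x + a) * (v x + b)" using pos by (simp add: u_def)
    have "((\<lambda>x. S (v x)) has_real_derivative inverse r / 2 * (2 * (2 * u + a + b) * (\<phi> x * \<phi>1 x))) (at x)"
      using DERIV_chain2[OF DERIV_real_sqrt[OF p1] d1] by (simp only: S_def r_def u_def)
    then have dS: "((\<lambda>x. S (v x)) has_real_derivative (2 * u + a + b) * (\<phi> x * \<phi>1 x) / r) (at x)"
      by (rule DERIV_cong) (use r in \<open>simp add: field_simps\<close>)
    have dd: "((\<lambda>x. (v x + \<nu>) * S (v x)) has_real_derivative
        2 * (\<phi> x * \<phi>1 x) * r + (2 * u + a + b) * (\<phi> x * \<phi>1 x) / r * (u + \<nu>)) (at x)"
      unfolding u_def r_def
      by (rule derivative_eq_intros dv dS[unfolded u_def r_def] refl)+ (simp add: mult_ac)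
    have "(F has_real_derivative ((p + \<omega> * u - u ^ 3) * ((u + \<nu>) * r)
        - \<phi> x * \<phi>1 x * (2 * (\<phi> x * \<phi>1 x) * r + (2 * u + a + b) * (\<phi> x * \<phi>1 x) / r * (u + \<nu>)))
          / (((u + \<nu>) * r) * ((u + \<nu>) * r))) (at x)"
      unfolding F_def p_def u_def r_def
      by (rule DERIV_divide[OF dp dd[unfolded u_def r_def]])
         (use pos r in \<open>auto simp: u_def r_def\<close>)
    moreover have "((p + \<omega> * u - u ^ 3) * ((u + \<nu>) * r)
        - \<phi> x * \<phi>1 x * (2 * (\<phi> x * \<phi>1 x) * r + (2 * u + a + b) * (\<phi> x * \<phi>1 x) / r * (u + \<nu>)))
          / (((u + \<nu>) * r) * ((u + \<nu>) * r)) = K * (a / 2 - u) * r / (u + \<nu>)\<^sup>2"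
    proof -
      define A U R where "A = a + b" and "U = u + \<nu>" and "R = r\<^sup>2"
      have p: "p = (A - u) * R / 3" using en[of x] r by (simp add: A_def R_def p_def u_def)
      have Ka: "K * (a / 2 - u) = ((A - 2 * u) * U - 2 * u * (A - u)) / 3"
      proof -
        have "A * (a / 2) = (A - a) * \<nu>" unfolding A_def \<nu>_def using ab(1,2) by (simp add: field_simps)
        then show ?thesis by (simp add: K_def A_def[symmetric] U_def field_simps)
      qed
      have w: "\<omega> * u - u ^ 3 = u * ((A - u) * (2 * u + A) - R) / 3"
      proof -
        have w: "\<omega> = (a\<^sup>2 + a * b + b\<^sup>2) / 3" using w3 by simp
        show ?thesis unfolding R_def r(2) A_def w
          by (simp add: field_simps power2_eq_square power3_eq_cube)
      qed
      have pp: "\<phi> x * \<phi>1 x * (\<phi> x * \<phi>1 x) = u * p" by (simp add: u_def v_def p_def power2_eq_square)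
      have rR: "r * r = R" by (simp add: R_def power2_eq_square)
      have key: "(p + \<omega> * u - u ^ 3) * U * R - u * p * (2 * R + (2 * u + A) * U) = K * (a / 2 - u) * R * R"
      proof -
        have e: "p + \<omega> * u - u ^ 3 = (A - u) * R / 3 + u * ((A - u) * (2 * u + A) - R) / 3"
          using p w by simp
        show ?thesis unfolding e Ka unfolding p by (simp add: field_simps)
      qed
      have "((p + \<omega> * u - u ^ 3) * (U * r)
          - \<phi> x * \<phi>1 x * (2 * (\<phi> x * \<phi>1 x) * r + (2 * u + A) * (\<phi> x * \<phi>1 x) / r * U))
        = ((p + \<omega> * u - u ^ 3) * U * R - (\<phi> x * \<phi>1 x * (\<phi> x * \<phi>1 x)) * (2 * R + (2 * u + A) * U)) / r"
        using r(1) by (simp add: rR[symmetric] field_simps)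
      also have "\<dots> = K * (a / 2 - u) * R * R / r" by (simp only: pp key)
      finally have "((p + \<omega> * u - u ^ 3) * (U * r)
          - \<phi> x * \<phi>1 x * (2 * (\<phi> x * \<phi>1 x) * r + (2 * u + A) * (\<phi> x * \<phi>1 x) / r * U)) / ((U * r) * (U * r))
        = K * (a / 2 - u) * R * R / r / ((U * r) * (U * r))" by (rule arg_cong)
      also have "\<dots> = K * (a / 2 - u) * r / U\<^sup>2"
        using r(1) pos(3) by (simp add: rR[symmetric] power2_eq_square U_def[symmetric])
      finally show ?thesis by (simp add: U_def A_def add.assoc)
    qed
    ultimately show ?thesis by (simp add: u_def r_def)
  qed
  have \<omega>a: "\<omega> - a\<^sup>2 > 0"
  proof -
    have "a * a < a * b" "a * b < b * b" using ab by auto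
    then show ?thesis using w3 by (simp add: power2_eq_square)
  qed
  (* The quotient h, rescaled, at the common zero v = a / 2. *)
  define c where "c = (\<omega> - a\<^sup>2) * h (a / 2) / K"
  define G where "G = (\<lambda>x. c * (K * (a / 2 - v x) * S (v x) / (v x + \<nu>)\<^sup>2)
      - (3/2) * ((2/3) * ((\<omega> - a\<^sup>2) * ((a / 2 - v x) / (v x + a)) - (v x ^ 2 - \<omega>))))"
  have "((\<lambda>x. c * F x - (3/2) * F1 x) has_real_derivative G x) (at x)" for x
    unfolding G_def by (intro DERIV_diff DERIV_cmult dF dF1)
  then have "(G has_integral ((c * F l - (3/2) * F1 l) - (c * F 0 - (3/2) * F1 0))) {0..l}"
    using l by (intro fundamental_theorem_of_calculus)
      (auto simp flip: has_real_derivative_iff_has_vector_derivative intro: has_field_derivative_at_within)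
  then have G0: "(G has_integral 0) {0..l}" by (simp add: F_def F1_def \<phi>_0 \<phi>1_l)
  have "integral {0..l} (\<lambda>x. \<phi> x ^ 4 - \<omega>) \<le> integral {0..l} G"
  proof (rule integral_le)
    show "(\<lambda>x. \<phi> x ^ 4 - \<omega>) integrable_on {0..l}"
      by (intro integrable_continuous_interval continuous_intros)
    show "G integrable_on {0..l}" using G0 by blast
    fix x assume "x \<in> {0..l}"
    define u where "u = v x"
    have u: "u \<ge> 0" by (simp add: u_def v0)
    have pos: "0 < u + a" "0 < u + b" "0 < u + \<nu>" using u ab \<nu> by auto
    have "(a / 2 - u) * h u \<le> (a / 2 - u) * h (a / 2)"
    proof (cases "u \<le> a / 2")
      case True
      then show ?thesis using hmono[OF u True] by (intro mult_left_mono) auto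
    next
      case False
      then show ?thesis using hmono[of "a / 2" u] ab by (intro mult_left_mono_neg) auto
    qed
    then have "(a / 2 - u) * h u * (S u / (u + \<nu>)\<^sup>2) \<le> (a / 2 - u) * h (a / 2) * (S u / (u + \<nu>)\<^sup>2)"
      using S[OF u] pos by (intro mult_right_mono) auto
    moreover have "(a / 2 - u) * h u * (S u / (u + \<nu>)\<^sup>2) = (a / 2 - u) / (u + a)"
      using S[OF u] pos by (simp add: h_def)
    ultimately have "(a / 2 - u) / (u + a) \<le> (a / 2 - u) * h (a / 2) * (S u / (u + \<nu>)\<^sup>2)" by simp
    then have "(\<omega> - a\<^sup>2) * ((a / 2 - u) / (u + a)) \<le> (\<omega> - a\<^sup>2) * ((a / 2 - u) * h (a / 2) * (S u / (u + \<nu>)\<^sup>2))"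
      using \<omega>a by (intro mult_left_mono) auto
    also have "\<dots> = c * (K * (a / 2 - u) * S u / (u + \<nu>)\<^sup>2)"
      using K by (simp add: c_def)
    finally have le: "(\<omega> - a\<^sup>2) * ((a / 2 - u) / (u + a)) \<le> c * (K * (a / 2 - u) * S u / (u + \<nu>)\<^sup>2)" .
    have "w - \<omega> \<le> Y - (3/2) * ((2/3) * (X - (w - \<omega>)))" if "X \<le> Y" for w X Y :: real
      using that by (simp add: field_simps)
    from this[OF le] have "u\<^sup>2 - \<omega> \<le> G x" by (simp only: G_def u_def)
    then show "\<phi> x ^ 4 - \<omega> \<le> G x" by (simp add: u_def v_def flip: power_mult)
  qed
  also have "\<dots> = 0" using G0 by (rule integral_unique)
  finally show ?thesis .
qed

section \<open>Quadratic forms of the linearised equations\<close>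

definition form :: "real \<Rightarrow> real \<Rightarrow> real \<Rightarrow> (real \<Rightarrow> real) \<Rightarrow> (real \<Rightarrow> real) \<Rightarrow> real" where
  "form \<sigma> a b f f' = integral {a..b} (\<lambda>x. (f' x)\<^sup>2 + (\<omega> - \<sigma> * \<phi> x ^ 4) * (f x)\<^sup>2)"

definition dirichlet :: "(real \<Rightarrow> real) \<Rightarrow> (real \<Rightarrow> real) \<Rightarrow> bool" where
  "dirichlet f f' \<longleftrightarrow> (\<forall>x\<in>{0..T}. (f has_real_derivative f' x) (at x within {0..T})) \<and>
     continuous_on {0..T} f' \<and> f 0 = 0 \<and> f T = 0"

lemma dirichlet_cont: "dirichlet f f' \<Longrightarrow> continuous_on {0..T} f" "dirichlet f f' \<Longrightarrow> continuous_on {0..T} f'"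
  by (auto simp: dirichlet_def intro!: DERIV_continuous_on)

lemma dirichlet_deriv:
  "dirichlet f f' \<Longrightarrow> x \<in> {a..b} \<Longrightarrow> 0 \<le> a \<Longrightarrow> b \<le> T \<Longrightarrow> (f has_real_derivative f' x) (at x within {a..b})"
  unfolding dirichlet_def by (rule has_field_derivative_subset[of f "f' x" x "{0..T}"]) auto

lemma \<phi>_dirichlet: "dirichlet \<phi> \<phi>1"
  unfolding dirichlet_def using \<phi>_0 \<phi>_T by (auto intro: has_field_derivative_at_within \<phi> continuous_intros)

lemma dirichlet_add_scaled:
  assumes "dirichlet f f'" "dirichlet g g'"
  shows "dirichlet (\<lambda>x. f x + c * g x) (\<lambda>x. f' x + c * g' x)"
  using assms dirichlet_cont[OF assms(1)] dirichlet_cont[OF assms(2)] unfolding dirichlet_def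
  by (auto intro!: derivative_eq_intros continuous_intros)

lemma form_integrable:
  assumes "dirichlet f f'" "dirichlet g g'" "0 \<le> a" "b \<le> T"
  shows "(\<lambda>x. f' x * g' x + (\<omega> - \<sigma> * \<phi> x ^ 4) * (f x * g x)) integrable_on {a..b}"
  using assms
  by (intro integrable_continuous_interval continuous_intros
        continuous_on_subset[OF dirichlet_cont(1)] continuous_on_subset[OF dirichlet_cont(2)]) auto

lemma form_expand:
  assumes f: "dirichlet f f'" and g: "dirichlet g g'" and ab: "0 \<le> a" "b \<le> T"
  shows "form \<sigma> a b (\<lambda>x. f x + c * g x) (\<lambda>x. f' x + c * g' x) = form \<sigma> a b f f'
     + 2 * c * integral {a..b} (\<lambda>x. f' x * g' x + (\<omega> - \<sigma> * \<phi> x ^ 4) * (f x * g x)) + c\<^sup>2 * form \<sigma> a b g g'"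
proof -
  let ?B = "\<lambda>f f' g g' x. f' x * g' x + (\<omega> - \<sigma> * \<phi> x ^ 4) * (f x * g x)"
  have eq: "form \<sigma> a b f f' = integral {a..b} (?B f f' f f')" for f f'
    by (simp add: form_def power2_eq_square)
  note I = form_integrable[OF f f ab, of \<sigma>] form_integrable[OF f g ab, of \<sigma>] form_integrable[OF g g ab, of \<sigma>]
  have "((\<lambda>x. ?B f f' f f' x + (2 * c) * ?B f f' g g' x + c\<^sup>2 * ?B g g' g g' x) has_integral
     integral {a..b} (?B f f' f f') + (2 * c) * integral {a..b} (?B f f' g g') + c\<^sup>2 * integral {a..b} (?B g g' g g')) {a..b}"
    using I by (intro has_integral_add has_integral_mult_right) (auto simp: has_integral_integral)
  then have "integral {a..b} (\<lambda>x. ?B f f' f f' x + (2 * c) * ?B f f' g g' x + c\<^sup>2 * ?B g g' g g' x)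
     = integral {a..b} (?B f f' f f') + (2 * c) * integral {a..b} (?B f f' g g') + c\<^sup>2 * integral {a..b} (?B g g' g g')"
    by (rule integral_unique)
  then show ?thesis unfolding eq
    by (simp add: algebra_simps power2_eq_square)
qed

lemma form_by_parts:
  assumes f: "dirichlet f f'" and g: "dirichlet g g'" and ab: "0 \<le> a" "a \<le> b" "b \<le> T"
    and gb: "g a = 0" "g b = 0"
    and f': "\<And>x. x \<in> {a..b} \<Longrightarrow> (f' has_real_derivative (\<omega> - \<sigma> * \<phi> x ^ 4) * f x - h x) (at x within {a..b})"
  shows "((\<lambda>x. h x * g x) has_integral integral {a..b} (\<lambda>x. f' x * g' x + (\<omega> - \<sigma> * \<phi> x ^ 4) * (f x * g x))) {a..b}"
proof -
  let ?B = "\<lambda>x. f' x * g' x + (\<omega> - \<sigma> * \<phi> x ^ 4) * (f x * g x)"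
  have 1: "((\<lambda>x. ?B x - h x * g x) has_integral (f' b * g b - f' a * g a)) {a..b}"
    using ab
    by (intro fundamental_theorem_of_calculus)
      (auto simp: algebra_simps simp flip: has_real_derivative_iff_has_vector_derivative
        intro!: derivative_eq_intros f' dirichlet_deriv[OF g])
  have 2: "(?B has_integral integral {a..b} ?B) {a..b}"
    using form_integrable[OF f g ab(1,3)] by (auto simp: has_integral_integral)
  have "((\<lambda>x. ?B x - (?B x - h x * g x)) has_integral (integral {a..b} ?B - (f' b * g b - f' a * g a))) {a..b}"
    by (rule has_integral_diff[OF 2 1])
  moreover have "(\<lambda>x. ?B x - (?B x - h x * g x)) = (\<lambda>x. h x * g x)" by auto
  ultimately show ?thesis using gb by simp
qed

lemma form_mono:
  assumes f: "dirichlet f f'" and "0 \<le> a" "b \<le> T" "\<sigma> \<le> \<tau>"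
  shows "form \<tau> a b f f' \<le> form \<sigma> a b f f'"
  unfolding form_def
proof (rule integral_le)
  show "(\<lambda>x. (f' x)\<^sup>2 + (\<omega> - \<tau> * \<phi> x ^ 4) * (f x)\<^sup>2) integrable_on {a..b}"
    "(\<lambda>x. (f' x)\<^sup>2 + (\<omega> - \<sigma> * \<phi> x ^ 4) * (f x)\<^sup>2) integrable_on {a..b}"
    using form_integrable[OF f f assms(2,3)] by (auto simp: power2_eq_square)
qed (use assms(4) in \<open>auto intro!: mult_right_mono add_left_mono\<close>)

lemma form_1_nonneg:
  assumes f: "dirichlet f f'" shows "0 \<le> form 1 0 T f f'"
  unfolding form_def
proof (rule jacobi_form_nonneg[where y = \<phi> and y' = \<phi>1])
  show "(\<phi>1 has_real_derivative (\<omega> - 1 * \<phi> x ^ 4) * \<phi> x) (at x within {0..T})" for x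
    using has_field_derivative_at_within[OF \<phi>1[of x]] by (simp add: algebra_simps eval_nat_numeral)
qed (use f T_pos in \<open>auto simp: dirichlet_def intro!: has_field_derivative_at_within[OF \<phi>] \<phi>_pos continuous_intros\<close>)

text \<open>On each side of the node \<open>l\<close>, the function \<open>\<phi>'\<close> is a solution of fixed sign.\<close>

lemma form_5_nonneg_half:
  assumes f: "dirichlet f f'" and fl: "f l = 0"
  shows "0 \<le> form 5 0 l f f'" "0 \<le> form 5 l T f f'"
proof -
  show "0 \<le> form 5 0 l f f'" unfolding form_def
  proof (rule jacobi_form_nonneg[where y = \<phi>1 and y' = "\<lambda>x. \<omega> * \<phi> x - \<phi> x ^ 5"])
    show "continuous_on {0..l} f'" using dirichlet_cont(2)[OF f] l T by (auto intro: continuous_on_subset)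
    show "(f has_real_derivative f' x) (at x within {0..l})" if "x \<in> {0..l}" for x
      using dirichlet_deriv[OF f that] l T by simp
    show "f 0 = 0" using f by (simp add: dirichlet_def)
  qed (use fl l T in \<open>auto intro!: has_field_derivative_at_within[OF \<phi>1]
       has_field_derivative_at_within[OF \<phi>1_deriv2] \<phi>1_pos continuous_intros\<close>)
  show "0 \<le> form 5 l T f f'" unfolding form_def
  proof (rule jacobi_form_nonneg[where y = "\<lambda>x. - \<phi>1 x" and y' = "\<lambda>x. - (\<omega> * \<phi> x - \<phi> x ^ 5)"])
    show "continuous_on {l..T} f'" using dirichlet_cont(2)[OF f] l T by (auto intro: continuous_on_subset)
    show "((\<lambda>x. - (\<omega> * \<phi> x - \<phi> x ^ 5)) has_real_derivative (\<omega> - 5 * \<phi> x ^ 4) * - \<phi>1 x) (at x within {l..T})" for x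
      using DERIV_minus[OF has_field_derivative_at_within[OF \<phi>1_deriv2]] by simp
    show "(f has_real_derivative f' x) (at x within {l..T})" if "x \<in> {l..T}" for x
      using dirichlet_deriv[OF f that] l by simp
    show "f T = 0" using f by (simp add: dirichlet_def)
    show "((\<lambda>x. - \<phi>1 x) has_real_derivative - (\<omega> * \<phi> x - \<phi> x ^ 5)) (at x within {l..T})" for x
      by (rule DERIV_minus[OF has_field_derivative_at_within[OF \<phi>1]])
  qed (use fl l T \<phi>1_neg in \<open>auto intro!: continuous_intros\<close>)
qed

lemma form_split:
  assumes f: "dirichlet f f'" shows "form \<sigma> 0 T f f' = form \<sigma> 0 l f f' + form \<sigma> l T f f'"
  unfolding form_def
  using form_integrable[OF f f order_refl order_refl, of \<sigma>] l T
  by (intro Henstock_Kurzweil_Integration.integral_combine[symmetric]) (auto simp: power2_eq_square)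

lemma form_5_nonneg_of_node:
  assumes "dirichlet f f'" "f l = 0" shows "0 \<le> form 5 0 T f f'"
  using form_5_nonneg_half[OF assms] form_split[OF assms(1), of 5] by simp

section \<open>The sign of Vakhitov and Kolokolov\<close>

text \<open>Besides \<open>\<phi>'\<close>, the equation \<open>y'' = (\<omega> - 5 \<phi>\<^sup>4) y\<close> has a solution of the form \<open>\<phi>' g + p(\<phi>)\<close> with an odd polynomial \<open>p\<close>
  and \<open>g' = k - 4 \<omega> \<phi>\<^sup>4\<close>. Reduction of order would give \<open>\<phi>' \<integral> \<phi>'\<^sup>-\<^sup>2\<close>, which is singular at \<open>l\<close>; the
  singularity is removed by subtracting a multiple of the derivative of \<open>p(\<phi>) / \<phi>'\<close> from the integrand. The sign of \<open>N = g(l)\<close> comes from two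
  Wronskians: the one with \<open>\<phi>'\<close> is a negative constant, whence \<open>y < 0\<close> on \<open>(0, l)\<close>, and then the one with
  \<open>\<phi>\<close> increases.\<close>

lemma second_solution:
  obtains y y' :: "real \<Rightarrow> real" and N :: real where
    "N < 0" "y 0 = 0" "y T = 2 * N * \<phi>1 T" "y' T = \<phi>1 T * (27 * (\<phi>1 0) ^ 4 / (2 * \<omega>) - 6 * \<omega>\<^sup>2)"
    "N = 9 * (\<phi>1 0) ^ 4 / \<omega> * l - 4 * \<omega> * integral {0..l} (\<lambda>x. \<phi> x ^ 4)"
    "\<And>x. x \<in> {0..T} \<Longrightarrow> (y has_real_derivative y' x) (at x within {0..T})"
    "\<And>x. x \<in> {0..T} \<Longrightarrow> (y' has_real_derivative (\<omega> - 5 * \<phi> x ^ 4) * y x) (at x within {0..T})"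
proof -
  define e where "e = (\<phi>1 0)\<^sup>2"
  (* The values of k and r cancel the coefficients of phi and phi^5 in the residual of the equation. *)
  define k where "k = 9 * e\<^sup>2 / \<omega>"
  define r where "r = k / 2 - 6 * \<omega>\<^sup>2"
  define g where "g = (\<lambda>x. k * x - 4 * \<omega> * integral {0..x} (\<lambda>x. \<phi> x ^ 4))"
  define g' where "g' = (\<lambda>x. k - 4 * \<omega> * \<phi> x ^ 4)"
  define N where "N = g l"
  define y where "y = (\<lambda>x. \<phi>1 x * g x + r * \<phi> x - 3 * e * \<phi> x ^ 3 + 2 * \<omega> * \<phi> x ^ 5)"
  define y' where "y' = (\<lambda>x. (\<omega> * \<phi> x - \<phi> x ^ 5) * g x + \<phi>1 x * (g' x + r - 9 * e * \<phi> x ^ 2 + 10 * \<omega> * \<phi> x ^ 4))"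
  note d\<phi> = has_field_derivative_at_within[OF \<phi>] has_field_derivative_at_within[OF \<phi>1]
  have dg: "(g has_real_derivative g' x) (at x within {0..T})" if "x \<in> {0..T}" for x
  proof -
    have "((\<lambda>x. integral {0..x} (\<lambda>x. \<phi> x ^ 4)) has_real_derivative \<phi> x ^ 4) (at x within {0..T})"
      using that by (intro integral_has_real_derivative continuous_intros) auto
    then show ?thesis unfolding g_def g'_def
      by (auto intro!: derivative_eq_intros)
  qed
  have dy: "(y has_real_derivative y' x) (at x within {0..T})" if "x \<in> {0..T}" for x
    unfolding y_def y'_def
    by (rule derivative_eq_intros d\<phi> dg[OF that] refl)+ (simp add: algebra_simps)
  have dg': "(g' has_real_derivative - 16 * \<omega> * \<phi> x ^ 3 * \<phi>1 x) (at x within {0..T})" for x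
    unfolding g'_def by (rule derivative_eq_intros d\<phi> refl)+ simp
  have dy': "(y' has_real_derivative (\<omega> - 5 * \<phi> x ^ 4) * y x) (at x within {0..T})" if x: "x \<in> {0..T}" for x
  proof -
    define u v G where "u = \<phi> x" and "v = \<phi>1 x" and "G = g x"
    have vv: "v\<^sup>2 = e + \<omega> * u\<^sup>2 - u ^ 6 / 3" using energy[of x] by (simp add: u_def v_def e_def)
    have k: "k * \<omega> = 9 * e\<^sup>2" using \<omega> by (simp add: k_def)
    have "(y' has_real_derivative (\<omega> - 5 * u ^ 4) * v * G + (\<omega> * u - u ^ 5) * g' x
        + (\<omega> * u - u ^ 5) * (g' x + r - 9 * e * u\<^sup>2 + 10 * \<omega> * u ^ 4)
        + v * (- 16 * \<omega> * u ^ 3 * v - 18 * e * u * v + 40 * \<omega> * u ^ 3 * v)) (at x within {0..T})"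
      unfolding y'_def u_def v_def G_def
      by (rule derivative_eq_intros d\<phi> dg[OF x] dg' refl)+ (simp add: algebra_simps)
    moreover have "(\<omega> - 5 * u ^ 4) * v * G + (\<omega> * u - u ^ 5) * g' x
        + (\<omega> * u - u ^ 5) * (g' x + r - 9 * e * u\<^sup>2 + 10 * \<omega> * u ^ 4)
        + v * (- 16 * \<omega> * u ^ 3 * v - 18 * e * u * v + 40 * \<omega> * u ^ 3 * v)
       = (\<omega> - 5 * u ^ 4) * (v * G + r * u - 3 * e * u ^ 3 + 2 * \<omega> * u ^ 5)"
    proof -
      have "(\<omega> * u - u ^ 5) * g' x
        + (\<omega> * u - u ^ 5) * (g' x + r - 9 * e * u\<^sup>2 + 10 * \<omega> * u ^ 4)
        + v * (- 16 * \<omega> * u ^ 3 * v - 18 * e * u * v + 40 * \<omega> * u ^ 3 * v)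
        = (\<omega> * u - u ^ 5) * (2 * (k - 4 * \<omega> * u ^ 4) + r - 9 * e * u\<^sup>2 + 10 * \<omega> * u ^ 4)
        + v\<^sup>2 * (24 * \<omega> * u ^ 3 - 18 * e * u)"
        unfolding g'_def u_def by (simp add: algebra_simps power2_eq_square)
      also have "\<dots> = (\<omega> - 5 * u ^ 4) * (r * u - 3 * e * u ^ 3 + 2 * \<omega> * u ^ 5)
         + 2 * u * (k * \<omega> - 9 * e\<^sup>2) + u ^ 5 * (4 * r + 24 * \<omega>\<^sup>2 - 2 * k)"
        unfolding vv by (simp add: field_simps eval_nat_numeral)
      also have "\<dots> = (\<omega> - 5 * u ^ 4) * (r * u - 3 * e * u ^ 3 + 2 * \<omega> * u ^ 5)"
        unfolding k by (simp add: r_def)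
      finally show ?thesis by (simp add: algebra_simps)
    qed
    ultimately show ?thesis by (simp add: y_def u_def v_def G_def)
  qed
  have y0: "y 0 = 0" by (simp add: y_def \<phi>_0 g_def)
  define A where "A = \<phi> l"
  have A: "0 < A" using \<phi>_pos[of l] l by (simp add: A_def T)
  (* The discriminant of the cubic in the energy, which makes the Wronskian with phi' negative. *)
  have disc: "9 * e\<^sup>2 < 4 * \<omega> ^ 3"
  proof -
    have "3 * e = A\<^sup>2 * (A ^ 4 - 3 * \<omega>)"
      using energy[of l] by (simp add: \<phi>1_l A_def e_def algebra_simps flip: power_add)
    then have "(3 * e)\<^sup>2 = A ^ 4 * (A ^ 4 - 3 * \<omega>)\<^sup>2"
      by (simp add: power_mult_distrib flip: power_mult)
    also have "\<dots> < 4 * \<omega> * \<omega>\<^sup>2"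
      using amp \<omega> by (intro mult_strict_mono power_strict_mono) (auto simp: A_def)
    finally show ?thesis by (simp add: power2_eq_square power3_eq_cube)
  qed
  have e: "e > 0" using \<phi>1_pos[of 0] l by (simp add: e_def)
  have W0: "y' 0 = \<phi>1 0 * (k + r)" by (simp add: y'_def g'_def \<phi>_0 g_def algebra_simps)
  have kr: "k + r < 0" using disc \<omega> by (simp add: k_def r_def field_simps power2_eq_square power3_eq_cube)
  (* Wronskian of y and phi'. *)
  define W where "W = (\<lambda>x. y' x * \<phi>1 x - y x * (\<omega> * \<phi> x - \<phi> x ^ 5))"
  have Wc: "W x = y' 0 * \<phi>1 0" if "x \<in> {0..T}" for x
  proof -
    have d: "(W has_real_derivative 0) (at x within {0..T})" if "x \<in> {0..T}" for x
      unfolding W_def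
      by (rule derivative_eq_intros dy dy' d\<phi> that has_field_derivative_at_within[OF \<phi>1_deriv2] refl)+ (simp add: algebra_simps)
    obtain c where "\<And>t. t \<in> {0..T} \<Longrightarrow> W t = c"
      using has_field_derivative_zero_constant[OF convex_real_interval(5) d] by blast
    then have "W x = W 0" using that T_pos by simp
    then show ?thesis by (simp add: W_def y0)
  qed
  have Wneg: "W x < 0" if "x \<in> {0..T}" for x
  proof -
    have "\<phi>1 0 > 0" using \<phi>1_pos l by simp
    then have "(\<phi>1 0 * \<phi>1 0) * (k + r) < 0" using kr by (intro mult_pos_neg) auto
    then show ?thesis unfolding Wc[OF that] W0 by (simp add: mult_ac)
  qed
  have at: "at x within {0..T} = at x" if "0 < x" "x < T" for x
    using that by (rule at_within_Icc_at)
  (* W is the numerator of the derivative of y / phi'. *)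
  have yneg: "y x < 0" if "0 < x" "x < l" for x
  proof -
    have "y x / \<phi>1 x < y 0 / \<phi>1 0"
    proof (rule DERIV_neg_imp_decreasing_open[OF that(1)])
      fix t assume t: "0 < t" "t < x"
      have p: "\<phi>1 t > 0" using t that \<phi>1_pos by simp
      have "((\<lambda>x. y x / \<phi>1 x) has_real_derivative W t / (\<phi>1 t * \<phi>1 t)) (at t)"
        unfolding W_def using p t that at[of t] dy[of t] T
        by (auto intro!: derivative_eq_intros \<phi>1)
      moreover have "W t / (\<phi>1 t * \<phi>1 t) < 0" using Wneg[of t] t that p T by (intro divide_neg_pos) auto
      ultimately show "\<exists>D. ((\<lambda>x. y x / \<phi>1 x) has_real_derivative D) (at t) \<and> D < 0" by blast
    next
      have "continuous_on {0..T} y" using dy by (rule DERIV_continuous_on)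
      then show "continuous_on {0..x} (\<lambda>x. y x / \<phi>1 x)"
        using that T \<phi>1_pos by (intro continuous_intros) (force intro: continuous_on_subset)+
    qed
    then show ?thesis using y0 \<phi>1_pos[of x] that by (simp add: divide_less_0_iff)
  qed
  have N: "N < 0"
  proof -
    (* Wronskian of y and phi, compared at 0 and at l. *)
    have "y' 0 * \<phi> 0 - y 0 * \<phi>1 0 < y' l * \<phi> l - y l * \<phi>1 l"
    proof (rule DERIV_pos_imp_increasing_open[OF l])
      fix t assume t: "0 < t" "t < l"
      have "((\<lambda>x. y' x * \<phi> x - y x * \<phi>1 x) has_real_derivative - 4 * y t * \<phi> t ^ 5) (at t)"
        using t at[of t] dy[of t] dy'[of t] T
        by (auto intro!: derivative_eq_intros \<phi> \<phi>1 simp: algebra_simps eval_nat_numeral)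
      moreover have "- 4 * y t * \<phi> t ^ 5 > 0"
        using yneg[OF t] \<phi>_pos[of t] t T by (simp add: mult_neg_pos)
      ultimately show "\<exists>D. ((\<lambda>x. y' x * \<phi> x - y x * \<phi>1 x) has_real_derivative D) (at t) \<and> 0 < D" by blast
    next
      have "continuous_on {0..T} y" "continuous_on {0..T} y'"
        using DERIV_continuous_on[OF dy] DERIV_continuous_on[OF dy'] by auto
      then show "continuous_on {0..l} (\<lambda>x. y' x * \<phi> x - y x * \<phi>1 x)"
        using T l by (intro continuous_intros) (auto intro: continuous_on_subset)
    qed
    then have "0 < A * A * (\<omega> - A ^ 4) * N"
      by (simp add: y'_def \<phi>1_l \<phi>_0 y0 N_def A_def algebra_simps eval_nat_numeral)
    moreover have "A * A * (\<omega> - A ^ 4) < 0" using A amp \<omega> by (intro mult_pos_neg) (auto simp: A_def)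
    ultimately show ?thesis by (smt (verit) mult_nonneg_nonpos2 mult.commute)
  qed
  have "integral {0..T} (\<lambda>x. \<phi> x ^ 4) = 2 * integral {0..l} (\<lambda>x. \<phi> x ^ 4)"
  proof -
    have "integral {0..l} (\<lambda>x. \<phi> x ^ 4) + integral {l..T} (\<lambda>x. \<phi> x ^ 4) = integral {0..T} (\<lambda>x. \<phi> x ^ 4)"
      using l T by (intro Henstock_Kurzweil_Integration.integral_combine integrable_continuous_interval continuous_intros) auto
    moreover have "((\<lambda>x. \<phi> x ^ 4) has_integral integral {0..l} (\<lambda>x. \<phi> x ^ 4)) {0..l}"
      by (intro integrable_integral integrable_continuous_interval continuous_intros)
    then have "((\<lambda>x. \<phi> (T - x) ^ 4) has_integral integral {0..l} (\<lambda>x. \<phi> x ^ 4)) {l..T}"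
      using has_integral_affinity[of "\<lambda>x. \<phi> x ^ 4" _ 0 l "-1" T] T by (simp add: image_affinity_atLeastAtMost_diff)
    then have "integral {l..T} (\<lambda>x. \<phi> x ^ 4) = integral {0..l} (\<lambda>x. \<phi> x ^ 4)"
      by (simp add: \<phi>_sym integral_unique)
    ultimately show ?thesis by simp
  qed
  then have gT: "g T = 2 * N" by (simp add: g_def N_def T algebra_simps)
  show ?thesis
  proof (rule that[OF N y0 _ _ _ dy dy'])
    show "y T = 2 * N * \<phi>1 T" by (simp add: y_def \<phi>_T gT)
    show "y' T = \<phi>1 T * (27 * (\<phi>1 0) ^ 4 / (2 * \<omega>) - 6 * \<omega>\<^sup>2)"
      by (simp add: y'_def \<phi>_T g'_def r_def k_def e_def flip: power_mult)
    show "N = 9 * (\<phi>1 0) ^ 4 / \<omega> * l - 4 * \<omega> * integral {0..l} (\<lambda>x. \<phi> x ^ 4)"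
      by (simp add: N_def g_def k_def e_def flip: power_mult)
  qed
qed

text \<open>If \<open>\<phi>\<close> solves the equation for \<open>\<omega>\<close>, then \<open>\<lambda>\<^sup>1\<^sup>/\<^sup>2 \<phi>(\<lambda> x)\<close> solves it for \<open>\<omega> \<lambda>\<^sup>2\<close>. Differentiation in \<open>\<lambda>\<close> gives the
  function \<open>\<Lambda> = \<phi>/2 + x \<phi>'\<close> with \<open>L\<^sub>5 \<Lambda> = - 2 \<omega> \<phi>\<close>. A multiple of the second solution corrects its boundary value
  at \<open>T\<close>. The function \<open>\<eta>\<close> obtained is minus the derivative of the Dirichlet solution with respect to \<open>\<omega>\<close>,
  so the inequality says that its \<open>L\<^sup>2\<close> norm does not decrease with the frequency.\<close>

lemma vakhitov_kolokolov:
  obtains \<eta> \<eta>' where "dirichlet \<eta> \<eta>'"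
    "\<And>x. x \<in> {0..T} \<Longrightarrow> (\<eta>' has_real_derivative (\<omega> - 5 * \<phi> x ^ 4) * \<eta> x - \<phi> x) (at x within {0..T})"
    "integral {0..T} (\<lambda>x. \<phi> x * \<eta> x) \<le> 0"
proof -
  obtain y y' :: "real \<Rightarrow> real" and N :: real where
    N: "N < 0" and y0: "y 0 = 0" and yT: "y T = 2 * N * \<phi>1 T" "y' T = \<phi>1 T * (27 * (\<phi>1 0) ^ 4 / (2 * \<omega>) - 6 * \<omega>\<^sup>2)"
    and Neq: "N = 9 * (\<phi>1 0) ^ 4 / \<omega> * l - 4 * \<omega> * integral {0..l} (\<lambda>x. \<phi> x ^ 4)"
    and dy: "\<And>x. x \<in> {0..T} \<Longrightarrow> (y has_real_derivative y' x) (at x within {0..T})"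
    and dy': "\<And>x. x \<in> {0..T} \<Longrightarrow> (y' has_real_derivative (\<omega> - 5 * \<phi> x ^ 4) * y x) (at x within {0..T})"
    by (rule second_solution) blast
  note d\<phi> = has_field_derivative_at_within[OF \<phi>] has_field_derivative_at_within[OF \<phi>1] has_field_derivative_at_within[OF \<phi>1_deriv2]
  (* This factor normalises the source - 2 omega phi to phi. *)
  define m where "m = - (1 / (2 * \<omega>))"
  define \<Lambda> where "\<Lambda> = (\<lambda>x. \<phi> x / 2 + x * \<phi>1 x)"
  define \<Lambda>' where "\<Lambda>' = (\<lambda>x. 3 / 2 * \<phi>1 x + x * (\<omega> * \<phi> x - \<phi> x ^ 5))"
  define \<eta> where "\<eta> = (\<lambda>x. m * (\<Lambda> x - l / N * y x))"
  define \<eta>' where "\<eta>' = (\<lambda>x. m * (\<Lambda>' x - l / N * y' x))"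
  have m: "2 * \<omega> * m = - 1" using \<omega> by (simp add: m_def)
  have d\<Lambda>: "(\<Lambda> has_real_derivative \<Lambda>' x) (at x within S)" for x S
    unfolding \<Lambda>_def \<Lambda>'_def by (auto intro!: derivative_eq_intros d\<phi>)
  have d\<Lambda>': "(\<Lambda>' has_real_derivative (\<omega> - 5 * \<phi> x ^ 4) * \<Lambda> x + 2 * \<omega> * \<phi> x) (at x within S)" for x S
    unfolding \<Lambda>_def \<Lambda>'_def
    by (rule derivative_eq_intros d\<phi> refl)+ (simp add: algebra_simps eval_nat_numeral)
  have d\<eta>: "(\<eta> has_real_derivative \<eta>' x) (at x within {0..T})" if "x \<in> {0..T}" for x
    unfolding \<eta>_def \<eta>'_def by (intro DERIV_cmult DERIV_diff d\<Lambda> dy that)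
  have d\<eta>': "(\<eta>' has_real_derivative (\<omega> - 5 * \<phi> x ^ 4) * \<eta> x - \<phi> x) (at x within {0..T})" if "x \<in> {0..T}" for x
  proof -
    have "(\<eta>' has_real_derivative m * ((\<omega> - 5 * \<phi> x ^ 4) * \<Lambda> x + 2 * \<omega> * \<phi> x - l / N * ((\<omega> - 5 * \<phi> x ^ 4) * y x))) (at x within {0..T})"
      unfolding \<eta>'_def by (intro DERIV_cmult DERIV_diff d\<Lambda>' dy' that)
    moreover have "m * ((\<omega> - 5 * \<phi> x ^ 4) * \<Lambda> x + 2 * \<omega> * \<phi> x - l / N * ((\<omega> - 5 * \<phi> x ^ 4) * y x))
       = (\<omega> - 5 * \<phi> x ^ 4) * \<eta> x + (2 * \<omega> * m) * \<phi> x"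
      by (simp add: \<eta>_def algebra_simps)
    ultimately show ?thesis by (simp add: m)
  qed
  have \<eta>0: "\<eta> 0 = 0" by (simp add: \<eta>_def \<Lambda>_def y0 \<phi>_0)
  have \<eta>T: "\<eta> T = 0"
  proof -
    have "l / N * (2 * N * p) = 2 * l * p" for p using N by (cases "N = 0") auto
    then show ?thesis unfolding \<eta>_def \<Lambda>_def yT \<phi>_T by (simp add: T)
  qed
  have dir: "dirichlet \<eta> \<eta>'"
    unfolding dirichlet_def using d\<eta> \<eta>0 \<eta>T DERIV_continuous_on[OF d\<eta>'] by auto
  (* Wronskian of eta and Lambda; the last term is an antiderivative of phi Lambda. *)
  have "((\<lambda>x. 2 * \<omega> * (\<phi> x * \<eta> x)) has_integral
      ((\<eta> T * \<Lambda>' T - \<eta>' T * \<Lambda> T - T * (\<phi> T)\<^sup>2 / 2) - (\<eta> 0 * \<Lambda>' 0 - \<eta>' 0 * \<Lambda> 0 - 0 * (\<phi> 0)\<^sup>2 / 2))) {0..T}"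
  proof (rule fundamental_theorem_of_calculus)
    fix x assume "x \<in> {0..T}"
    then have "((\<lambda>x. \<eta> x * \<Lambda>' x - \<eta>' x * \<Lambda> x - x * (\<phi> x)\<^sup>2 / 2) has_real_derivative 2 * \<omega> * (\<phi> x * \<eta> x)) (at x within {0..T})"
      by (auto intro!: derivative_eq_intros d\<eta> d\<eta>' d\<Lambda> d\<Lambda>' \<phi> d\<phi> simp: algebra_simps)
         (simp add: \<Lambda>_def algebra_simps power2_eq_square)
    then show "((\<lambda>x. \<eta> x * \<Lambda>' x - \<eta>' x * \<Lambda> x - x * (\<phi> x)\<^sup>2 / 2) has_vector_derivative 2 * \<omega> * (\<phi> x * \<eta> x)) (at x within {0..T})"
      by (simp add: has_real_derivative_iff_has_vector_derivative)
  qed (use T_pos in simp)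
  then have "2 * \<omega> * integral {0..T} (\<lambda>x. \<phi> x * \<eta> x) = - \<eta>' T * \<Lambda> T"
    by (simp add: \<eta>0 \<eta>T \<phi>_0 \<phi>_T \<Lambda>_def integral_unique flip: integral_mult_right)
  also have "\<dots> = (3 * T * (\<phi>1 T)\<^sup>2 * - m / 2) * (- (1 - l / N * (9 * \<phi>1 0 ^ 4 / \<omega> - 4 * \<omega>\<^sup>2)) * - 1)"
    by (simp add: \<eta>'_def \<Lambda>_def \<Lambda>'_def \<phi>_T yT field_simps power2_eq_square)
  also have "\<dots> \<le> 0"
  proof (rule mult_nonneg_nonpos)
    show "0 \<le> 3 * T * (\<phi>1 T)\<^sup>2 * - m / 2" using \<omega> T_pos by (simp add: m_def)
    define I where "I = integral {0..l} (\<lambda>x. \<phi> x ^ 4)"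
    have "integral {0..l} (\<lambda>x. \<phi> x ^ 4 - \<omega>) = I - \<omega> * l"
      unfolding I_def using l
      by (subst integral_diff) (auto intro!: integrable_continuous_interval continuous_intros)
    then have I: "I - \<omega> * l \<le> 0" using integral_quartic_le by simp
    have "1 - l / N * (9 * \<phi>1 0 ^ 4 / \<omega> - 4 * \<omega>\<^sup>2) = (N - 9 * \<phi>1 0 ^ 4 / \<omega> * l + 4 * \<omega>\<^sup>2 * l) / N"
      using N by (simp add: field_simps)
    also have "N - 9 * \<phi>1 0 ^ 4 / \<omega> * l + 4 * \<omega>\<^sup>2 * l = - (4 * \<omega>) * (I - \<omega> * l)"
      unfolding Neq I_def by (simp add: algebra_simps power2_eq_square)
    also have "\<dots> / N \<le> 0" using I \<omega> N by (intro divide_nonneg_neg mult_nonpos_nonpos) auto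
    finally show "- (1 - l / N * (9 * \<phi>1 0 ^ 4 / \<omega> - 4 * \<omega>\<^sup>2)) * - 1 \<le> 0" by simp
  qed
  finally have "integral {0..T} (\<lambda>x. \<phi> x * \<eta> x) \<le> 0" using \<omega> by (simp add: mult_le_0_iff)
  from that[OF dir d\<eta>' this] show ?thesis .
qed

text \<open>Every \<open>f\<close> can be moved into the cone of functions with a node at \<open>l\<close> by adding a multiple of \<open>\<eta>\<close>. If
  \<open>f\<close> is orthogonal to \<open>\<phi> = L\<^sub>5 \<eta>\<close>, there is no mixed term, and the form of \<open>\<eta>\<close> itself is \<open>\<langle>\<phi>, \<eta>\<rangle> \<le> 0\<close>; so the
  form of \<open>f\<close> is at least that of the shifted function.\<close>

lemma form_5_nonneg_of_orthogonal:
  assumes f: "dirichlet f f'" and orth: "integral {0..T} (\<lambda>x. \<phi> x * f x) = 0"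
  shows "0 \<le> form 5 0 T f f'"
proof -
  obtain \<eta> \<eta>' where \<eta>: "dirichlet \<eta> \<eta>'"
    and \<eta>': "\<And>x. x \<in> {0..T} \<Longrightarrow> (\<eta>' has_real_derivative (\<omega> - 5 * \<phi> x ^ 4) * \<eta> x - \<phi> x) (at x within {0..T})"
    and le: "integral {0..T} (\<lambda>x. \<phi> x * \<eta> x) \<le> 0" by (rule vakhitov_kolokolov) blast
  have B: "integral {0..T} (\<lambda>x. \<eta>' x * g' x + (\<omega> - 5 * \<phi> x ^ 4) * (\<eta> x * g x)) = integral {0..T} (\<lambda>x. \<phi> x * g x)"
    if "dirichlet g g'" for g g'
    using form_by_parts[OF \<eta> that order_refl _ order_refl _ _ \<eta>'] that T_pos
    by (simp add: dirichlet_def integral_unique)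
  have form\<eta>: "form 5 0 T \<eta> \<eta>' \<le> 0" using B[OF \<eta>] le by (simp add: form_def power2_eq_square)
  have node: "\<eta> l \<noteq> 0"
  proof
    assume \<eta>l: "\<eta> l = 0"
    (* If eta had the node, it would be a null vector of a nonnegative form, but this f also has the node
       and positive product with phi = L_5 eta. *)
    define f where "f = (\<lambda>x. \<phi> x * (\<phi>1 x)\<^sup>2)"
    define f' where "f' = (\<lambda>x. \<phi>1 x * (\<phi>1 x)\<^sup>2 + \<phi> x * (2 * \<phi>1 x * (\<omega> * \<phi> x - \<phi> x ^ 5)))"
    have "(f has_real_derivative f' x) (at x)" for x
      unfolding f_def f'_def by (rule derivative_eq_intros \<phi> \<phi>1 refl)+ simp
    then have dir: "dirichlet f f'"
      unfolding dirichlet_def by (auto intro: has_field_derivative_at_within simp: f_def f'_def \<phi>_0 \<phi>_T intro!: continuous_intros)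
    have "0 \<le> 2 * c * integral {0..T} (\<lambda>x. \<phi> x * f x) + c\<^sup>2 * form 5 0 T f f'" for c
    proof -
      have "0 \<le> form 5 0 T (\<lambda>x. \<eta> x + c * f x) (\<lambda>x. \<eta>' x + c * f' x)"
        by (rule form_5_nonneg_of_node[OF dirichlet_add_scaled[OF \<eta> dir]]) (simp add: \<eta>l f_def \<phi>1_l)
      then show ?thesis using form_expand[OF \<eta> dir order_refl order_refl, of 5 c] B[OF dir] form\<eta> by simp
    qed
    then have "integral {0..T} (\<lambda>x. \<phi> x * f x) = 0" by (rule linear_term_zero)
    then have "\<phi> (l / 2) * f (l / 2) = 0"
      by (intro nonneg_integral_zero[where f = "\<lambda>x. \<phi> x * f x" and a = 0 and b = T])
         (use l T in \<open>auto simp: f_def \<phi>_nonneg intro!: continuous_intros\<close>)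
    then show False using \<phi>_pos[of "l / 2"] \<phi>1_pos[of "l / 2"] l T by (simp add: f_def)
  qed
  (* Chosen so that f + c eta vanishes at l. *)
  define c where "c = - f l / \<eta> l"
  have "0 \<le> form 5 0 T (\<lambda>x. \<eta> x * c + f x) (\<lambda>x. \<eta>' x * c + f' x)"
    using form_5_nonneg_of_node[OF dirichlet_add_scaled[OF f \<eta>, of c]] node
    by (simp add: c_def add.commute mult.commute)
  also have "\<dots> = form 5 0 T f f' + c\<^sup>2 * form 5 0 T \<eta> \<eta>'"
    using form_expand[OF f \<eta> order_refl order_refl, of 5 c] B[OF f] orth by (simp add: add.commute mult.commute)
  finally show ?thesis using mult_left_mono[OF form\<eta>, of "c\<^sup>2"] by simp
qed

section \<open>Rigidity of pairs with nonnegative forms\<close>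

text \<open>Here \<open>z = x + i y\<close>, \<open>P = p1 + i p2\<close> and \<open>Q = q1 + i q2\<close>. Testing \<open>L\<^sub>\<tau> Q = z P\<close> with \<open>Q\<close> and \<open>L\<^sub>\<sigma> P = - z Q\<close> with \<open>P\<close>
  shows that \<open>z \<langle>P, Q\<rangle>\<close> and \<open>- z \<langle>Q, P\<rangle>\<close> are real and nonnegative. As \<open>x \<noteq> 0\<close>, both vanish. Then \<open>Q\<close> is a
  null vector of a nonnegative form, so \<open>z P = L\<^sub>\<tau> Q = 0\<close>, and finally \<open>z Q = - L\<^sub>\<sigma> P = 0\<close>.\<close>

lemma pair_rigid:
  fixes x y :: real
  assumes x: "x \<noteq> 0"
    and p1: "dirichlet p1 p1'" and p2: "dirichlet p2 p2'" and q1: "dirichlet q1 q1'" and q2: "dirichlet q2 q2'"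
    and dp1: "\<And>t. t \<in> {0..T} \<Longrightarrow> (p1' has_real_derivative (\<omega> - \<sigma> * \<phi> t ^ 4) * p1 t + (x * q1 t - y * q2 t)) (at t within {0..T})"
    and dp2: "\<And>t. t \<in> {0..T} \<Longrightarrow> (p2' has_real_derivative (\<omega> - \<sigma> * \<phi> t ^ 4) * p2 t + (x * q2 t + y * q1 t)) (at t within {0..T})"
    and dq1: "\<And>t. t \<in> {0..T} \<Longrightarrow> (q1' has_real_derivative (\<omega> - \<tau> * \<phi> t ^ 4) * q1 t - (x * p1 t - y * p2 t)) (at t within {0..T})"
    and dq2: "\<And>t. t \<in> {0..T} \<Longrightarrow> (q2' has_real_derivative (\<omega> - \<tau> * \<phi> t ^ 4) * q2 t - (x * p2 t + y * p1 t)) (at t within {0..T})"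
    and \<tau>: "\<And>f f'. dirichlet f f' \<Longrightarrow> 0 \<le> form \<tau> 0 T f f'"
    and \<sigma>: "0 \<le> form \<sigma> 0 T p1 p1'" "0 \<le> form \<sigma> 0 T p2 p2'"
    and t: "t \<in> {0..T}"
  shows "p1 t = 0 \<and> p2 t = 0 \<and> q1 t = 0 \<and> q2 t = 0"
proof -
  let ?I = "\<lambda>f g. integral {0..T} (\<lambda>t. f t * g t :: real)"
  let ?B = "\<lambda>\<sigma> f f' g g'. integral {0..T} (\<lambda>x. f' x * g' x + (\<omega> - \<sigma> * \<phi> x ^ 4) * (f x * g x))"
  have parts: "?I h g = ?B \<sigma> f f' g g'"
    if "dirichlet f f'" "dirichlet g g'"
      "\<And>t. t \<in> {0..T} \<Longrightarrow> (f' has_real_derivative (\<omega> - \<sigma> * \<phi> t ^ 4) * f t - h t) (at t within {0..T})" for f f' g g' h \<sigma>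
    using form_by_parts[OF that(1,2) order_refl _ order_refl _ _ that(3)] that(2) T_pos
    by (simp add: dirichlet_def integral_unique)
  have sym: "?B \<sigma> f f' g g' = ?B \<sigma> g g' f f'" for f f' g g' \<sigma> by (simp add: mult.commute)
  have fB: "?B \<sigma> f f' f f' = form \<sigma> 0 T f f'" for f f' \<sigma> by (simp add: form_def power2_eq_square)
  have int: "(\<lambda>t. f t * g t) integrable_on {0..T}" if "dirichlet f f'" "dirichlet g g'" for f f' g g'
    using that by (intro integrable_continuous_interval continuous_intros dirichlet_cont)
  have lin: "?I (\<lambda>t. a * f t + b * g t) h = a * ?I f h + b * ?I g h"
    if "dirichlet f f'" "dirichlet g g'" "dirichlet h h'" for a b f f' g g' h h'
  proof -
    have "((\<lambda>t. a * (f t * h t) + b * (g t * h t)) has_integral a * ?I f h + b * ?I g h) {0..T}"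
      using int[OF that(1,3)] int[OF that(2,3)]
      by (intro has_integral_add has_integral_mult_right) (auto simp: has_integral_integral)
    then show ?thesis by (simp add: integral_unique algebra_simps)
  qed
  have dp1': "(p1' has_real_derivative (\<omega> - \<sigma> * \<phi> t ^ 4) * p1 t - (- x * q1 t + y * q2 t)) (at t within {0..T})"
    if "t \<in> {0..T}" for t by (rule DERIV_cong[OF dp1[OF that]]) simp
  have dp2': "(p2' has_real_derivative (\<omega> - \<sigma> * \<phi> t ^ 4) * p2 t - (- x * q2 t + - y * q1 t)) (at t within {0..T})"
    if "t \<in> {0..T}" for t by (rule DERIV_cong[OF dp2[OF that]]) simp
  have eq1: "x * ?I p1 g - y * ?I p2 g = ?B \<tau> q1 q1' g g'" if "dirichlet g g'" for g g'
    using parts[OF q1 that dq1] lin[OF p1 p2 that, of x "- y"] by simp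
  have eq2: "x * ?I p2 g + y * ?I p1 g = ?B \<tau> q2 q2' g g'" if "dirichlet g g'" for g g'
    using parts[OF q2 that dq2] lin[OF p2 p1 that, of x y] by simp
  have eq3: "- x * ?I q1 g + y * ?I q2 g = ?B \<sigma> p1 p1' g g'" if "dirichlet g g'" for g g'
    using parts[OF p1 that dp1'] lin[OF q1 q2 that, of "- x" y] by simp
  have eq4: "- x * ?I q2 g + - y * ?I q1 g = ?B \<sigma> p2 p2' g g'" if "dirichlet g g'" for g g'
    using parts[OF p2 that dp2'] lin[OF q2 q1 that, of "- x" "- y"] by simp
  have Isym: "?I f g = ?I g f" for f g by (simp add: mult.commute)
  (* Real and imaginary part of the product of P with the conjugate of Q. *)
  define m1 m2 where "m1 = ?I p1 q1 + ?I p2 q2" and "m2 = ?I p2 q1 - ?I p1 q2"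
  have "x * m1 - y * m2 = form \<tau> 0 T q1 q1' + form \<tau> 0 T q2 q2'"
    using eq1[OF q1] eq2[OF q2] unfolding fB by (simp add: m1_def m2_def algebra_simps)
  moreover have "- x * m1 - y * m2 = form \<sigma> 0 T p1 p1' + form \<sigma> 0 T p2 p2'"
    using eq3[OF p1] eq4[OF p2] unfolding fB Isym[of q1] Isym[of q2]
    by (simp add: m1_def m2_def algebra_simps)
  moreover have "x * m2 + y * m1 = 0"
    using eq1[OF q2] eq2[OF q1] sym[where \<sigma> = \<tau> and f = q1 and f' = q1' and g = q2 and g' = q2'] by (simp add: m1_def m2_def algebra_simps)
  moreover have "x * m2 - y * m1 = 0"
    using eq3[OF p2] eq4[OF p1] sym[where \<sigma> = \<sigma> and f = p1 and f' = p1' and g = p2 and g' = p2'] unfolding Isym[of q1] Isym[of q2]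
    by (simp add: m1_def m2_def algebra_simps)
  ultimately have "m2 = 0" "form \<tau> 0 T q1 q1' + form \<tau> 0 T q2 q2' \<le> 0"
    using x \<sigma> by (auto simp: algebra_simps)
  then have F0: "form \<tau> 0 T q1 q1' = 0" "form \<tau> 0 T q2 q2' = 0"
    using \<tau>[OF q1] \<tau>[OF q2] by linarith+
  have B0: "?B \<tau> f f' g g' = 0" if "dirichlet f f'" "dirichlet g g'" "form \<tau> 0 T f f' = 0" for f f' g g'
  proof (rule linear_term_zero)
    fix c show "0 \<le> 2 * c * ?B \<tau> f f' g g' + c\<^sup>2 * form \<tau> 0 T g g'"
      using \<tau>[OF dirichlet_add_scaled[OF that(1,2), of c]] form_expand[OF that(1,2) order_refl order_refl, of \<tau> c] that(3) by simp
  qed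
  have zero: "f t = 0" if "dirichlet f f'" "?I f f = 0" "t \<in> {0..T}" for f f' t
    using nonneg_integral_zero[of 0 T "\<lambda>t. f t * f t" t] that T_pos
      continuous_on_mult[OF dirichlet_cont(1)[OF that(1)] dirichlet_cont(1)[OF that(1)]] by auto
  have comb: "dirichlet (\<lambda>t. a * f t + b * g t) (\<lambda>t. a * f' t + b * g' t)" if "dirichlet f f'" "dirichlet g g'" for a b f f' g g'
    using that dirichlet_cont[OF that(1)] dirichlet_cont[OF that(2)] unfolding dirichlet_def
    by (auto intro!: derivative_eq_intros continuous_intros)
  have z1: "x * p1 t + - y * p2 t = 0" if "t \<in> {0..T}" for t
  proof (rule zero[OF comb[OF p1 p2] _ that])
    show "?I (\<lambda>t. x * p1 t + - y * p2 t) (\<lambda>t. x * p1 t + - y * p2 t) = 0"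
      using lin[OF p1 p2 comb[OF p1 p2, of x "- y"], of x "- y"] eq1[OF comb[OF p1 p2, of x "- y"]]
        B0[OF q1 comb[OF p1 p2, of x "- y"] F0(1)] by simp
  qed
  have z2: "x * p2 t + y * p1 t = 0" if "t \<in> {0..T}" for t
  proof (rule zero[OF comb[OF p2 p1] _ that])
    show "?I (\<lambda>t. x * p2 t + y * p1 t) (\<lambda>t. x * p2 t + y * p1 t) = 0"
      using lin[OF p2 p1 comb[OF p2 p1, of x y], of x y] eq2[OF comb[OF p2 p1, of x y]]
        B0[OF q2 comb[OF p2 p1, of x y] F0(2)] by simp
  qed
  have nz: "a = 0 \<and> b = 0" if "x * a + - y * b = 0" "x * b + y * a = 0" for a b
  proof -
    have "(x\<^sup>2 + y\<^sup>2) * a = x * (x * a + - y * b) + y * (x * b + y * a)" "(x\<^sup>2 + y\<^sup>2) * b = x * (x * b + y * a) - y * (x * a + - y * b)"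
      by (simp_all add: algebra_simps power2_eq_square)
    then have "(x\<^sup>2 + y\<^sup>2) * a = 0" "(x\<^sup>2 + y\<^sup>2) * b = 0" unfolding that by simp_all
    moreover have "x\<^sup>2 + y\<^sup>2 > 0" using x by (simp add: add_pos_nonneg)
    ultimately show ?thesis by (metis less_irrefl mult_eq_0_iff)
  qed
  have p0: "p1 t = 0 \<and> p2 t = 0" if "t \<in> {0..T}" for t
    using nz[OF z1[OF that] z2[OF that]] .
  have d0: "D = 0" if "\<And>t. t \<in> {0..T} \<Longrightarrow> f t = 0" "(f has_real_derivative D) (at t within {0..T})" "t \<in> {0..T}" for f D t
    by (rule zero_function_derivative[OF T_pos that(3,1,2)])
  have p0': "p1' t = 0" "p2' t = 0" if "t \<in> {0..T}" for t
    using d0[of p1 "p1' t" t] d0[of p2 "p2' t" t] p0 p1 p2 that by (auto simp: dirichlet_def)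
  have "x * q1 t - y * q2 t = 0" "x * q2 t + y * q1 t = 0"
    using d0[OF p0'(1) dp1[OF t] t] d0[OF p0'(2) dp2[OF t] t] p0[OF t] by auto
  then show ?thesis using nz[of "q1 t" "q2 t"] p0[OF t] by simp
qed

text \<open>As \<open>L\<^sub>1 \<phi> = 0\<close>, testing \<open>L\<^sub>1 Q = z P\<close> with \<open>\<phi>\<close> puts \<open>P\<close> into the orthogonal complement of \<open>\<phi>\<close>.\<close>

lemma pair_rigid_5_1:
  fixes x y :: real
  assumes x: "x \<noteq> 0"
    and p1: "dirichlet p1 p1'" and p2: "dirichlet p2 p2'" and q1: "dirichlet q1 q1'" and q2: "dirichlet q2 q2'"
    and dp1: "\<And>t. t \<in> {0..T} \<Longrightarrow> (p1' has_real_derivative (\<omega> - 5 * \<phi> t ^ 4) * p1 t + (x * q1 t - y * q2 t)) (at t within {0..T})"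
    and dp2: "\<And>t. t \<in> {0..T} \<Longrightarrow> (p2' has_real_derivative (\<omega> - 5 * \<phi> t ^ 4) * p2 t + (x * q2 t + y * q1 t)) (at t within {0..T})"
    and dq1: "\<And>t. t \<in> {0..T} \<Longrightarrow> (q1' has_real_derivative (\<omega> - 1 * \<phi> t ^ 4) * q1 t - (x * p1 t - y * p2 t)) (at t within {0..T})"
    and dq2: "\<And>t. t \<in> {0..T} \<Longrightarrow> (q2' has_real_derivative (\<omega> - 1 * \<phi> t ^ 4) * q2 t - (x * p2 t + y * p1 t)) (at t within {0..T})"
    and t: "t \<in> {0..T}"
  shows "p1 t = 0 \<and> p2 t = 0 \<and> q1 t = 0 \<and> q2 t = 0"
proof -
  let ?I = "\<lambda>f. integral {0..T} (\<lambda>t. \<phi> t * f t :: real)"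
  have orth: "integral {0..T} (\<lambda>t. h t * \<phi> t) = 0"
    if "dirichlet f f'" "\<And>t. t \<in> {0..T} \<Longrightarrow> (f' has_real_derivative (\<omega> - 1 * \<phi> t ^ 4) * f t - h t) (at t within {0..T})" for f f' h
  proof -
    have "(\<phi>1 has_real_derivative (\<omega> - 1 * \<phi> t ^ 4) * \<phi> t - 0) (at t within {0..T})" for t
      using has_field_derivative_at_within[OF \<phi>1[of t]] by (simp add: algebra_simps eval_nat_numeral)
    from form_by_parts[OF \<phi>_dirichlet that(1) order_refl _ order_refl _ _ this]
    have "integral {0..T} (\<lambda>x. \<phi>1 x * f' x + (\<omega> - 1 * \<phi> x ^ 4) * (\<phi> x * f x)) = 0"
      using that(1) T_pos by (simp add: dirichlet_def has_integral_iff)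
    then show ?thesis
      using form_by_parts[OF that(1) \<phi>_dirichlet order_refl _ order_refl _ _ that(2)] T_pos
      by (simp add: \<phi>_0 \<phi>_T has_integral_iff mult.commute)
  qed
  have int: "(\<lambda>t. f t * \<phi> t) integrable_on {0..T}" if "dirichlet f f'" for f f'
    using that by (intro integrable_continuous_interval continuous_intros dirichlet_cont)
  have lin: "integral {0..T} (\<lambda>t. (a * f t + b * g t) * \<phi> t) = a * ?I f + b * ?I g"
    if "dirichlet f f'" "dirichlet g g'" for a b f f' g g'
  proof -
    have "((\<lambda>t. a * (f t * \<phi> t) + b * (g t * \<phi> t)) has_integral a * ?I f + b * ?I g) {0..T}"
      using int[OF that(1)] int[OF that(2)]
      by (intro has_integral_add has_integral_mult_right) (auto simp: has_integral_integral mult.commute)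
    then show ?thesis by (simp add: integral_unique algebra_simps)
  qed
  have "x * ?I p1 + - y * ?I p2 = 0" "x * ?I p2 + y * ?I p1 = 0"
    using orth[OF q1 dq1] orth[OF q2 dq2] lin[OF p1 p2, of x "- y"] lin[OF p2 p1, of x y] by simp_all
  then have "(x\<^sup>2 + y\<^sup>2) * ?I p1 = 0" "(x\<^sup>2 + y\<^sup>2) * ?I p2 = 0"
    by algebra+
  moreover have "x\<^sup>2 + y\<^sup>2 > 0" using x by (simp add: add_pos_nonneg)
  ultimately have "?I p1 = 0" "?I p2 = 0" by (metis less_irrefl mult_eq_0_iff)+
  then show ?thesis
    by (intro pair_rigid[OF x p1 p2 q1 q2 dp1 dp2 dq1 dq2 form_1_nonneg _ _ t] form_5_nonneg_of_orthogonal p1 p2)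
qed

lemma pair_rigid_le_1:
  fixes x y :: real
  assumes x: "x \<noteq> 0" and le: "\<sigma> \<le> 1" "\<tau> \<le> 1"
    and p1: "dirichlet p1 p1'" and p2: "dirichlet p2 p2'" and q1: "dirichlet q1 q1'" and q2: "dirichlet q2 q2'"
    and dp1: "\<And>t. t \<in> {0..T} \<Longrightarrow> (p1' has_real_derivative (\<omega> - \<sigma> * \<phi> t ^ 4) * p1 t + (x * q1 t - y * q2 t)) (at t within {0..T})"
    and dp2: "\<And>t. t \<in> {0..T} \<Longrightarrow> (p2' has_real_derivative (\<omega> - \<sigma> * \<phi> t ^ 4) * p2 t + (x * q2 t + y * q1 t)) (at t within {0..T})"
    and dq1: "\<And>t. t \<in> {0..T} \<Longrightarrow> (q1' has_real_derivative (\<omega> - \<tau> * \<phi> t ^ 4) * q1 t - (x * p1 t - y * p2 t)) (at t within {0..T})"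
    and dq2: "\<And>t. t \<in> {0..T} \<Longrightarrow> (q2' has_real_derivative (\<omega> - \<tau> * \<phi> t ^ 4) * q2 t - (x * p2 t + y * p1 t)) (at t within {0..T})"
    and t: "t \<in> {0..T}"
  shows "p1 t = 0 \<and> p2 t = 0 \<and> q1 t = 0 \<and> q2 t = 0"
proof -
  have nn: "0 \<le> form s 0 T f f'" if "dirichlet f f'" "s \<le> 1" for f f' s
    using form_1_nonneg[OF that(1)] form_mono[OF that(1) order_refl order_refl that(2)] by linarith
  show ?thesis
    by (rule pair_rigid[OF x p1 p2 q1 q2 dp1 dp2 dq1 dq2 _ _ _ t]) (use nn p1 p2 le in auto)
qed

section \<open>A real eigenvalue by shooting\<close>

text \<open>Sturm comparison with \<open>\<phi>\<close>, which is positive on \<open>(0, T)\<close>: up to a zero of \<open>q\<close> the Wronskian would decrease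
  strictly from \<open>0\<close>, but at the zero it is nonnegative.\<close>

lemma sturm_no_zero:
  assumes \<tau>: "\<tau> < 1"
    and q: "\<And>x. x \<in> {0..T} \<Longrightarrow> (q has_real_derivative q' x) (at x within {0..T})"
    and q': "\<And>x. x \<in> {0..T} \<Longrightarrow> (q' has_real_derivative (\<omega> - \<tau> * \<phi> x ^ 4) * q x) (at x within {0..T})"
    and q0: "q 0 = 0" "q' 0 = 1"
  shows "q T > 0"
proof (rule ccontr)
  assume "\<not> q T > 0"
  then obtain c where c: "0 < c" "c \<le> T" "q c = 0" "\<And>x. 0 < x \<Longrightarrow> x < c \<Longrightarrow> q x > 0" "q' c \<le> 0"
    using first_zero[OF T_pos q q0(1)] q0(2) by (metis zero_less_one)
  define w where "w = (\<lambda>x. q x * \<phi>1 x - q' x * \<phi> x)"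
  have "w c < w 0"
  proof (rule DERIV_neg_imp_decreasing_open[OF c(1)])
    fix t assume t: "0 < t" "t < c"
    then have at: "at t within {0..T} = at t" using c by (intro at_within_Icc_at) auto
    have "(w has_real_derivative (\<tau> - 1) * (q t * \<phi> t ^ 5)) (at t)"
      unfolding w_def using t c q[of t] q'[of t] at
      by (auto intro!: derivative_eq_intros \<phi> \<phi>1 simp: algebra_simps eval_nat_numeral)
    moreover have "(\<tau> - 1) * (q t * \<phi> t ^ 5) < 0"
      using c(4)[OF t] \<phi>_pos[of t] t c \<tau> by (intro mult_neg_pos mult_pos_pos) auto
    ultimately show "\<exists>D. (w has_real_derivative D) (at t) \<and> D < 0" by blast
  next
    have "continuous_on {0..T} q" "continuous_on {0..T} q'"
      using DERIV_continuous_on[OF q] DERIV_continuous_on[OF q'] by auto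
    then have "continuous_on {0..T} w" unfolding w_def by (intro continuous_intros)
    then show "continuous_on {0..c} w" by (rule continuous_on_subset) (use c in auto)
  qed
  moreover have "w c \<ge> 0" using c \<phi>_nonneg[of c] by (simp add: w_def mult_nonpos_nonneg)
  moreover have "w 0 = 0" by (simp add: w_def q0 \<phi>_0)
  ultimately show False by simp
qed

text \<open>As \<open>\<sigma> > 1\<close>, comparison with \<open>\<phi>\<close> produces a zero \<open>c\<close> before \<open>T\<close>. As \<open>\<sigma> < 5\<close>, comparison with \<open>\<phi>'\<close> shows that \<open>c\<close>
  lies beyond \<open>l\<close>, and that there is no second zero up to \<open>T\<close>.\<close>

lemma sturm_one_zero:
  assumes \<sigma>: "1 < \<sigma>" "\<sigma> < 5"
    and p: "\<And>x. x \<in> {0..T} \<Longrightarrow> (p has_real_derivative p' x) (at x within {0..T})"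
    and p': "\<And>x. x \<in> {0..T} \<Longrightarrow> (p' has_real_derivative (\<omega> - \<sigma> * \<phi> x ^ 4) * p x) (at x within {0..T})"
    and p0: "p 0 = 0" "p' 0 = 1"
  shows "p T < 0"
proof -
  have at: "at t within {0..T} = at t" if "0 < t" "t < T" for t using that by (rule at_within_Icc_at)
  have cp: "continuous_on {0..T} p" "continuous_on {0..T} p'"
    using DERIV_continuous_on[OF p] DERIV_continuous_on[OF p'] by auto
  (* Wronskians with phi and with phi'. *)
  define w where "w = (\<lambda>x. p x * \<phi>1 x - p' x * \<phi> x)"
  define v where "v = (\<lambda>x. p x * (\<omega> * \<phi> x - \<phi> x ^ 5) - p' x * \<phi>1 x)"
  have cw: "continuous_on {a..b} w" "continuous_on {a..b} v" if "0 \<le> a" "b \<le> T" for a b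
    unfolding w_def v_def
    by (intro continuous_intros; rule continuous_on_subset[OF cp(1)] continuous_on_subset[OF cp(2)]; use that in auto)+
  have dw: "(w has_real_derivative (\<sigma> - 1) * (p t * \<phi> t ^ 5)) (at t)" if "0 < t" "t < T" for t
    unfolding w_def using that p[of t] p'[of t] at[OF that]
    by (auto intro!: derivative_eq_intros \<phi> \<phi>1 simp: algebra_simps eval_nat_numeral)
  have dv: "(v has_real_derivative (\<sigma> - 5) * \<phi> t ^ 4 * (p t * \<phi>1 t)) (at t)" if "0 < t" "t < T" for t
    unfolding v_def using that p[of t] p'[of t] at[OF that]
    by (auto intro!: derivative_eq_intros \<phi> \<phi>1 \<phi>1_deriv2 simp: algebra_simps eval_nat_numeral)
  have w_incr: "0 < w b" if b: "0 < b" "b \<le> T" and pos: "\<And>x. 0 < x \<Longrightarrow> x < b \<Longrightarrow> p x > 0" for b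
  proof -
    have "w 0 < w b"
    proof (rule DERIV_pos_imp_increasing_open[OF b(1)])
      fix t assume t: "0 < t" "t < b"
      have "(\<sigma> - 1) * (p t * \<phi> t ^ 5) > 0"
        using pos[OF t] \<phi>_pos[of t] t b \<sigma> by (intro mult_pos_pos) auto
      then show "\<exists>D. (w has_real_derivative D) (at t) \<and> 0 < D" using dw[of t] t b by auto
    qed (use cw b in auto)
    then show ?thesis by (simp add: w_def p0 \<phi>_0)
  qed
  have "\<exists>x. 0 < x \<and> x < T \<and> \<not> p x > 0"
  proof (rule ccontr)
    assume "\<nexists>x. 0 < x \<and> x < T \<and> \<not> p x > 0"
    then have pos: "\<And>x. 0 < x \<Longrightarrow> x < T \<Longrightarrow> p x > 0" by auto
    have "p T \<ge> 0"
    proof -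
      have "closure {0<..<T} = {0..T}" using T_pos by simp
      moreover have "p ` closure {0<..<T} \<subseteq> {0..}"
        by (rule image_closure_subset) (use T_pos cp pos in \<open>auto intro: less_imp_le\<close>)
      ultimately have "p ` {0..T} \<subseteq> {0..}" by simp
      moreover have "p T \<in> p ` {0..T}" using T_pos by simp
      ultimately have "p T \<in> {0..}" by (rule subsetD)
      then show ?thesis by simp
    qed
    moreover have "\<phi>1 T \<le> 0" using \<phi>1_neg[of T] T l by simp
    ultimately have "w T \<le> 0" unfolding w_def \<phi>_T by (simp add: mult_nonneg_nonpos)
    then show False using w_incr[OF T_pos order_refl pos] by simp
  qed
  then obtain x where x: "0 < x" "x < T" "\<not> p x > 0" by blast
  have sub: "(p has_real_derivative p' t) (at t within {a..b})" if "t \<in> {a..b}" "0 \<le> a" "b \<le> T" for t a b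
    by (rule has_field_derivative_subset[OF p]) (use that in auto)
  obtain c where c: "0 < c" "c \<le> x" "p c = 0" "\<And>x. 0 < x \<Longrightarrow> x < c \<Longrightarrow> p x > 0" "p' c \<le> 0"
  proof (rule first_zero[where f = p and f' = p' and a = 0 and b = x])
    show "(p has_real_derivative p' t) (at t within {0..x})" if "t \<in> {0..x}" for t
      using sub[OF that] x by simp
  qed (use p0 x in auto)
  have cT: "c < T" using c x by simp
  have v_decr: "v b \<le> v a" if ab: "0 \<le> a" "a < b" "b \<le> T" and pos: "\<And>x. a < x \<Longrightarrow> x < b \<Longrightarrow> p x * \<phi>1 x \<ge> 0" for a b
  proof (rule DERIV_nonpos_imp_decreasing_open[where f = v])
    fix t assume t: "a < t" "t < b"
    have "(\<sigma> - 5) * \<phi> t ^ 4 * (p t * \<phi>1 t) \<le> 0"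
      using pos[OF t] \<sigma> by (intro mult_nonpos_nonneg mult_nonpos_nonneg) auto
    then show "\<exists>D. (v has_real_derivative D) (at t) \<and> D \<le> 0" using dv[of t] t ab by auto
  qed (use cw ab in auto)
  have cl: "l < c"
  proof (rule ccontr)
    assume cl: "\<not> l < c"
    then have "v c \<le> v 0"
      using c cT \<phi>1_pos by (intro v_decr) (auto intro!: mult_nonneg_nonneg less_imp_le)
    moreover have "v 0 < 0" using \<phi>1_pos[of 0] l by (simp add: v_def p0)
    moreover have "\<phi>1 c \<ge> 0" using \<phi>1_pos[of c] \<phi>1_l cl c by (cases "c = l") auto
    then have "v c \<ge> 0" using c by (simp add: v_def mult_nonpos_nonneg)
    ultimately show False by simp
  qed
  have pc: "p' c < 0"
  proof -
    have "0 < - p' c * \<phi> c" using w_incr[OF c(1) _ c(4)] cT by (simp add: w_def c)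
    then show ?thesis using \<phi>_pos[OF c(1) cT] by (simp add: mult_less_0_iff)
  qed
  show ?thesis
  proof (rule ccontr)
    assume nT: "\<not> p T < 0"
    obtain d where d: "c < d" "d \<le> T" "- p d = 0" "\<And>x. c < x \<Longrightarrow> x < d \<Longrightarrow> - p x > 0" "- p' d \<le> 0"
    proof (rule first_zero[where f = "\<lambda>x. - p x" and f' = "\<lambda>x. - p' x" and a = c and b = T])
      show "((\<lambda>x. - p x) has_real_derivative - p' t) (at t within {c..T})" if "t \<in> {c..T}" for t
        using sub[OF that] c by (auto intro: DERIV_minus)
    qed (use nT pc c cT in auto)
    have "v d \<le> v c"
      using d cl c \<phi>1_neg by (intro v_decr) (auto intro!: mult_nonpos_nonpos simp: less_imp_le)
    moreover have "v c < 0" using pc \<phi>1_neg[OF cl] cT c by (simp add: v_def mult_neg_neg)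
    moreover have "v d \<ge> 0" using d cl \<phi>1_neg[of d] by (simp add: v_def mult_nonneg_nonpos)
    ultimately show False by simp
  qed
qed

text \<open>A pair of real functions is stored as one complex-valued function. This is only real-linear, and the
  imaginary unit has nothing to do with the complex structure of the spectral problem.\<close>

definition pair_rhs :: "real \<Rightarrow> real \<Rightarrow> real \<Rightarrow> real \<Rightarrow> complex \<Rightarrow> complex" where
  "pair_rhs \<sigma> \<tau> \<rho> t X = Complex ((\<omega> - \<sigma> * \<phi> t ^ 4) * Re X + \<rho> * Im X) ((\<omega> - \<tau> * \<phi> t ^ 4) * Im X - \<rho> * Re X)"

lemma pair_rhs_diff: "pair_rhs \<sigma> \<tau> \<rho> t (X - Y) = pair_rhs \<sigma> \<tau> \<rho> t X - pair_rhs \<sigma> \<tau> \<rho> t Y"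
  by (simp add: pair_rhs_def complex_eq_iff algebra_simps)

lemma pair_rhs_cont: "continuous_on S X \<Longrightarrow> continuous_on S (\<lambda>t. pair_rhs \<sigma> \<tau> \<rho> t (X t))"
  unfolding pair_rhs_def by (intro continuous_intros)

lemma pair_rhs_bound:
  obtains C where "C \<ge> 0" "\<And>\<rho> t X. \<bar>\<rho>\<bar> \<le> \<Lambda> \<Longrightarrow> t \<in> {0..T} \<Longrightarrow> norm (pair_rhs \<sigma> \<tau> \<rho> t X) \<le> C * norm X"
proof -
  have "\<exists>b. \<forall>t\<in>{0..T}. \<bar>\<omega> - s * \<phi> t ^ 4\<bar> \<le> b" for s
  proof -
    have "bounded ((\<lambda>t. \<omega> - s * \<phi> t ^ 4) ` {0..T})"
      by (intro compact_imp_bounded compact_continuous_image continuous_intros) auto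
    then show ?thesis by (auto simp: bounded_iff)
  qed
  then obtain b where b: "\<And>s t. t \<in> {0..T} \<Longrightarrow> \<bar>\<omega> - s * \<phi> t ^ 4\<bar> \<le> b s" by metis
  have "norm (pair_rhs \<sigma> \<tau> \<rho> t X) \<le> (\<bar>b \<sigma>\<bar> + \<bar>b \<tau>\<bar> + 2 * \<bar>\<Lambda>\<bar>) * norm X"
    if "\<bar>\<rho>\<bar> \<le> \<Lambda>" "t \<in> {0..T}" for \<rho> t X
  proof -
    have "norm (pair_rhs \<sigma> \<tau> \<rho> t X) \<le> \<bar>Re (pair_rhs \<sigma> \<tau> \<rho> t X)\<bar> + \<bar>Im (pair_rhs \<sigma> \<tau> \<rho> t X)\<bar>"
      by (rule cmod_le)
    also have "\<bar>Re (pair_rhs \<sigma> \<tau> \<rho> t X)\<bar> \<le> \<bar>b \<sigma>\<bar> * norm X + \<bar>\<Lambda>\<bar> * norm X"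
    proof -
      have "\<bar>Re (pair_rhs \<sigma> \<tau> \<rho> t X)\<bar> \<le> \<bar>\<omega> - \<sigma> * \<phi> t ^ 4\<bar> * \<bar>Re X\<bar> + \<bar>\<rho>\<bar> * \<bar>Im X\<bar>"
        unfolding pair_rhs_def by (simp add: abs_mult[symmetric])
      also have "\<dots> \<le> \<bar>b \<sigma>\<bar> * norm X + \<bar>\<Lambda>\<bar> * norm X"
        using b[OF that(2), of \<sigma>] that(1) abs_Re_le_cmod[of X] abs_Im_le_cmod[of X]
        by (intro add_mono mult_mono) auto
      finally show ?thesis .
    qed
    also have "\<bar>Im (pair_rhs \<sigma> \<tau> \<rho> t X)\<bar> \<le> \<bar>b \<tau>\<bar> * norm X + \<bar>\<Lambda>\<bar> * norm X"
    proof -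
      have "\<bar>Im (pair_rhs \<sigma> \<tau> \<rho> t X)\<bar> \<le> \<bar>\<omega> - \<tau> * \<phi> t ^ 4\<bar> * \<bar>Im X\<bar> + \<bar>\<rho>\<bar> * \<bar>Re X\<bar>"
        unfolding pair_rhs_def by (simp add: abs_mult[symmetric])
      also have "\<dots> \<le> \<bar>b \<tau>\<bar> * norm X + \<bar>\<Lambda>\<bar> * norm X"
        using b[OF that(2), of \<tau>] that(1) abs_Re_le_cmod[of X] abs_Im_le_cmod[of X]
        by (intro add_mono mult_mono) auto
      finally show ?thesis .
    qed
    finally show ?thesis by (simp add: algebra_simps)
  qed
  then show ?thesis by (intro that[of "\<bar>b \<sigma>\<bar> + \<bar>b \<tau>\<bar> + 2 * \<bar>\<Lambda>\<bar>"]) auto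
qed

text \<open>The derivative of \<open>P' Q - P Q'\<close> is \<open>(\<tau> - \<sigma>) \<phi>\<^sup>4 P Q + \<rho> (P\<^sup>2 + Q\<^sup>2)\<close>, a positive definite form in \<open>(P, Q)\<close> once
  \<open>2 \<rho>\<close> exceeds \<open>\<bar>\<tau> - \<sigma>\<bar> \<phi>\<^sup>4\<close>. Its integral between two common zeros of \<open>P\<close> and \<open>Q\<close> vanishes.\<close>

lemma pair_no_conjugate_point:
  assumes M: "\<And>t. t \<in> {0..T} \<Longrightarrow> \<bar>\<tau> - \<sigma>\<bar> * \<phi> t ^ 4 \<le> M" and \<rho>: "M < 2 * \<rho>"
    and x0: "0 < x0" "x0 \<le> T"
    and d: "\<And>t. t \<in> {0..T} \<Longrightarrow> (P has_real_derivative P' t) (at t within {0..T})"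
      "\<And>t. t \<in> {0..T} \<Longrightarrow> (Q has_real_derivative Q' t) (at t within {0..T})"
      "\<And>t. t \<in> {0..T} \<Longrightarrow> (P' has_real_derivative (\<omega> - \<sigma> * \<phi> t ^ 4) * P t + \<rho> * Q t) (at t within {0..T})"
      "\<And>t. t \<in> {0..T} \<Longrightarrow> (Q' has_real_derivative (\<omega> - \<tau> * \<phi> t ^ 4) * Q t - \<rho> * P t) (at t within {0..T})"
    and bc: "P 0 = 0" "Q 0 = 0" "P x0 = 0" "Q x0 = 0"
  shows "P' 0 = 0 \<and> Q' 0 = 0"
proof -
  define g where "g = (\<lambda>t. (\<tau> - \<sigma>) * \<phi> t ^ 4 * (P t * Q t) + \<rho> * ((P t)\<^sup>2 + (Q t)\<^sup>2))"
  note ds = has_field_derivative_subset[OF d(1), of _ "{0..x0}"] has_field_derivative_subset[OF d(2), of _ "{0..x0}"]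
     has_field_derivative_subset[OF d(3), of _ "{0..x0}"] has_field_derivative_subset[OF d(4), of _ "{0..x0}"]
  have cPQ: "continuous_on {0..T} P" "continuous_on {0..T} Q"
    using DERIV_continuous_on[OF d(1)] DERIV_continuous_on[OF d(2)] by auto
  have "(g has_integral (P' x0 * Q x0 - P x0 * Q' x0) - (P' 0 * Q 0 - P 0 * Q' 0)) {0..x0}"
  proof (rule fundamental_theorem_of_calculus)
    fix t assume "t \<in> {0..x0}"
    then have "((\<lambda>t. P' t * Q t - P t * Q' t) has_real_derivative g t) (at t within {0..x0})"
      unfolding g_def using x0
      by (auto intro!: derivative_eq_intros ds simp: algebra_simps power2_eq_square)
    then show "((\<lambda>t. P' t * Q t - P t * Q' t) has_vector_derivative g t) (at t within {0..x0})"
      by (simp add: has_real_derivative_iff_has_vector_derivative)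
  qed (use x0 in simp)
  then have g0: "integral {0..x0} g = 0" by (simp add: bc integral_unique)
  have lower: "(\<rho> - M / 2) * ((P t)\<^sup>2 + (Q t)\<^sup>2) \<le> g t" if "t \<in> {0..x0}" for t
  proof -
    define Y where "Y = (\<tau> - \<sigma>) * \<phi> t ^ 4 * (P t * Q t)"
    have "\<bar>Y\<bar> = (\<bar>\<tau> - \<sigma>\<bar> * \<phi> t ^ 4) * \<bar>P t * Q t\<bar>" by (simp add: Y_def abs_mult)
    also have "\<dots> \<le> M * \<bar>P t * Q t\<bar>" using M[of t] that x0 by (intro mult_right_mono) auto
    also have "\<dots> \<le> M * (((P t)\<^sup>2 + (Q t)\<^sup>2) / 2)"
    proof (rule mult_left_mono)
      have "0 \<le> (\<bar>P t\<bar> - \<bar>Q t\<bar>)\<^sup>2" by simp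
      then show "\<bar>P t * Q t\<bar> \<le> ((P t)\<^sup>2 + (Q t)\<^sup>2) / 2" by (simp add: power2_diff abs_mult)
      have "0 \<le> \<bar>\<tau> - \<sigma>\<bar> * \<phi> t ^ 4" by simp
      also have "\<dots> \<le> M" using that x0 by (intro M) auto
      finally show "0 \<le> M" .
    qed
    finally have "- Y \<le> M * (((P t)\<^sup>2 + (Q t)\<^sup>2) / 2)" by simp
    then show ?thesis unfolding g_def Y_def[symmetric] by (simp add: algebra_simps)
  qed
  have gz: "g t = 0" if "t \<in> {0..x0}" for t
  proof (rule nonneg_integral_zero[OF _ _ g0 that x0(1)])
    show "continuous_on {0..x0} g" unfolding g_def
      by (intro continuous_intros; rule continuous_on_subset[OF cPQ(1)] continuous_on_subset[OF cPQ(2)]; use x0 in auto)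
    show "0 \<le> g t" if "t \<in> {0..x0}" for t
      using \<rho> by (intro order_trans[OF _ lower[OF that]] mult_nonneg_nonneg) auto
  qed
  have z: "P t = 0 \<and> Q t = 0" if "t \<in> {0..x0}" for t
  proof -
    have "(\<rho> - M / 2) * ((P t)\<^sup>2 + (Q t)\<^sup>2) \<le> 0" using lower[OF that] gz[OF that] by simp
    then have "(P t)\<^sup>2 + (Q t)\<^sup>2 \<le> 0" using \<rho> by (simp add: mult_le_0_iff)
    then show ?thesis by (simp add: sum_power2_le_zero_iff)
  qed
  have d0: "D = 0" if "\<And>t. t \<in> {0..x0} \<Longrightarrow> f t = 0" "(f has_real_derivative D) (at 0 within {0..x0})" for f D
    by (rule zero_function_derivative[OF x0(1) _ that]) (use x0 in auto)
  show ?thesis using d0[of P "P' 0"] d0[of Q "Q' 0"] z ds(1,2)[of 0] x0 by auto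
qed

text \<open>Shooting with two parameters \<open>(a, b) = (P'(0), Q'(0))\<close>: an eigenfunction for \<open>\<rho>\<close> exists iff the determinant
  \<open>D \<rho> T\<close> of the linear map from \<open>(a, b)\<close> to \<open>(P(T), Q(T))\<close> vanishes. It is continuous in \<open>\<rho>\<close>, negative at
  \<open>\<rho> = 0\<close> and positive at a large \<open>\<rho> = \<Lambda>\<close>.\<close>

lemma unstable_pair:
  assumes \<sigma>: "1 < \<sigma>" "\<sigma> < 5" and \<tau>: "\<tau> < 1"
  obtains \<rho> P P' Q Q' t where "\<rho> > 0" "dirichlet P P'" "dirichlet Q Q'"
    "\<And>t. t \<in> {0..T} \<Longrightarrow> (P' has_real_derivative (\<omega> - \<sigma> * \<phi> t ^ 4) * P t + \<rho> * Q t) (at t within {0..T})"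
    "\<And>t. t \<in> {0..T} \<Longrightarrow> (Q' has_real_derivative (\<omega> - \<tau> * \<phi> t ^ 4) * Q t - \<rho> * P t) (at t within {0..T})"
    "t \<in> {0..T}" "P t \<noteq> 0 \<or> Q t \<noteq> 0"
proof -
  have "bounded ((\<lambda>t. \<bar>\<tau> - \<sigma>\<bar> * \<phi> t ^ 4) ` {0..T})"
    by (intro compact_imp_bounded compact_continuous_image continuous_intros) auto
  then obtain M where M0: "\<And>t. t \<in> {0..T} \<Longrightarrow> norm (\<bar>\<tau> - \<sigma>\<bar> * \<phi> t ^ 4) \<le> M"
    unfolding bounded_iff by blast
  have M: "\<bar>\<tau> - \<sigma>\<bar> * \<phi> t ^ 4 \<le> M" if "t \<in> {0..T}" for t
    using M0[OF that] unfolding real_norm_def by (rule order_trans[OF abs_ge_self])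
  define \<Lambda> where "\<Lambda> = \<bar>M\<bar> + 1"
  have \<Lambda>: "\<Lambda> > 0" "M < 2 * \<Lambda>" by (auto simp: \<Lambda>_def)
  obtain C where C: "C \<ge> 0" and Cb: "\<And>\<rho> t X. \<bar>\<rho>\<bar> \<le> \<Lambda> \<Longrightarrow> t \<in> {0..T} \<Longrightarrow> norm (pair_rhs \<sigma> \<tau> \<rho> t X) \<le> C * norm X"
    by (rule pair_rhs_bound) blast
  define R where "R = pair_rhs \<sigma> \<tau>"
  define sol where "sol = (\<lambda>\<rho> e X. continuous_on {0..T} X \<and>
     (\<forall>x\<in>{0..T}. X x = x *\<^sub>R e + integral {0..x} (\<lambda>s. (x - s) *\<^sub>R R \<rho> s (X s))))"
  (* X rho e is the solution with initial slope e; the slopes 1 and i form a real basis. *)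
  define X where "X = (\<lambda>\<rho> e. SOME X. sol \<rho> e X)"
  have sol: "sol \<rho> e (X \<rho> e)" if \<rho>: "\<bar>\<rho>\<bar> \<le> \<Lambda>" for \<rho> e
  proof -
    obtain U where "continuous_on {0..T} U" "\<And>x. x \<in> {0..T} \<Longrightarrow> U x = x *\<^sub>R e + integral {0..x} (\<lambda>s. (x - s) *\<^sub>R R \<rho> s (U s))"
    proof (rule volterra_exists[OF T_pos C, where M = "R \<rho>" and H = "\<lambda>x. x *\<^sub>R e"])
      show "norm (R \<rho> s v) \<le> C * norm v" if "s \<in> {0..T}" for s v
        unfolding R_def by (rule Cb[OF \<rho> that])
      show "R \<rho> s (u - v) = R \<rho> s u - R \<rho> s v" for s u v
        unfolding R_def by (rule pair_rhs_diff)
      show "continuous_on {0..T} (\<lambda>s. R \<rho> s (U s))" if "continuous_on {0..T} U" for U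
        unfolding R_def by (rule pair_rhs_cont[OF that])
    qed (auto intro!: continuous_intros)
    then have "sol \<rho> e U" unfolding sol_def by blast
    then show ?thesis by (simp add: X_def someI[of "sol \<rho> e"])
  qed
  have cX: "continuous_on {0..T} (X \<rho> e)" if "\<bar>\<rho>\<bar> \<le> \<Lambda>" for \<rho> e
    using sol[OF that] unfolding sol_def by blast
  have X: "X \<rho> e x = x *\<^sub>R e + integral {0..x} (\<lambda>s. (x - s) *\<^sub>R R \<rho> s (X \<rho> e s))"
    if "\<bar>\<rho>\<bar> \<le> \<Lambda>" "x \<in> {0..T}" for \<rho> e x
    using sol[OF that(1)] that(2) unfolding sol_def by blast
  define X' where "X' = (\<lambda>\<rho> e x. e + integral {0..x} (\<lambda>s. R \<rho> s (X \<rho> e s)))"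
  have cR: "continuous_on {0..T} (\<lambda>s. R \<rho> s (Y s))" if "continuous_on {0..T} Y" for Y \<rho>
    unfolding R_def by (rule pair_rhs_cont[OF that])
  have dX: "(X \<rho> e has_vector_derivative X' \<rho> e x) (at x within {0..T})" if "\<bar>\<rho>\<bar> \<le> \<Lambda>" "x \<in> {0..T}" for \<rho> e x
  proof -
    have "((\<lambda>x. x *\<^sub>R e + integral {0..x} (\<lambda>s. (x - s) *\<^sub>R R \<rho> s (X \<rho> e s))) has_vector_derivative X' \<rho> e x) (at x within {0..T})"
      unfolding X'_def
      by (intro has_vector_derivative_add volterra_integral_deriv cR cX that)
         (auto intro!: derivative_eq_intros)
    then show ?thesis
      by (rule has_vector_derivative_transform[OF that(2), rotated]) (use X that in auto)
  qed
  have dX': "(X' \<rho> e has_vector_derivative R \<rho> x (X \<rho> e x)) (at x within {0..T})" if "\<bar>\<rho>\<bar> \<le> \<Lambda>" "x \<in> {0..T}" for \<rho> e x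
    unfolding X'_def
    using has_vector_derivative_add[OF has_vector_derivative_const integral_has_vector_derivative[OF cR[OF cX[OF that(1)]] that(2)]]
    by simp
  have X0: "X \<rho> e 0 = 0" if "\<bar>\<rho>\<bar> \<le> \<Lambda>" for \<rho> e using X[OF that, of 0 e] T_pos by simp
  have X'0: "X' \<rho> e 0 = e" for \<rho> e by (simp add: X'_def)
  have dRe: "((\<lambda>x. Re (f x)) has_real_derivative Re D) F" "((\<lambda>x. Im (f x)) has_real_derivative Im D) F"
    if "(f has_vector_derivative D) F" for f D F
    using bounded_linear.has_vector_derivative[OF bounded_linear_Re that]
      bounded_linear.has_vector_derivative[OF bounded_linear_Im that]
    by (simp_all add: has_real_derivative_iff_has_vector_derivative)
  define P where "P = (\<lambda>\<rho> a b t. a * Re (X \<rho> 1 t) + b * Re (X \<rho> \<i> t))"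
  define P' where "P' = (\<lambda>\<rho> a b t. a * Re (X' \<rho> 1 t) + b * Re (X' \<rho> \<i> t))"
  define Q where "Q = (\<lambda>\<rho> a b t. a * Im (X \<rho> 1 t) + b * Im (X \<rho> \<i> t))"
  define Q' where "Q' = (\<lambda>\<rho> a b t. a * Im (X' \<rho> 1 t) + b * Im (X' \<rho> \<i> t))"
  have dP: "(P \<rho> a b has_real_derivative P' \<rho> a b t) (at t within {0..T})"
    and dQ: "(Q \<rho> a b has_real_derivative Q' \<rho> a b t) (at t within {0..T})"
    if "\<bar>\<rho>\<bar> \<le> \<Lambda>" "t \<in> {0..T}" for \<rho> a b t
    unfolding P_def P'_def Q_def Q'_def by (intro DERIV_add DERIV_cmult dRe dX that)+
  have dP': "(P' \<rho> a b has_real_derivative (\<omega> - \<sigma> * \<phi> t ^ 4) * P \<rho> a b t + \<rho> * Q \<rho> a b t) (at t within {0..T})"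
    and dQ': "(Q' \<rho> a b has_real_derivative (\<omega> - \<tau> * \<phi> t ^ 4) * Q \<rho> a b t - \<rho> * P \<rho> a b t) (at t within {0..T})"
    if "\<bar>\<rho>\<bar> \<le> \<Lambda>" "t \<in> {0..T}" for \<rho> a b t
  proof -
    have "(P' \<rho> a b has_real_derivative a * Re (R \<rho> t (X \<rho> 1 t)) + b * Re (R \<rho> t (X \<rho> \<i> t))) (at t within {0..T})"
      unfolding P'_def by (intro DERIV_add DERIV_cmult dRe dX' that)
    then show "(P' \<rho> a b has_real_derivative (\<omega> - \<sigma> * \<phi> t ^ 4) * P \<rho> a b t + \<rho> * Q \<rho> a b t) (at t within {0..T})"
      by (rule DERIV_cong) (simp add: R_def pair_rhs_def P_def Q_def algebra_simps)
    have "(Q' \<rho> a b has_real_derivative a * Im (R \<rho> t (X \<rho> 1 t)) + b * Im (R \<rho> t (X \<rho> \<i> t))) (at t within {0..T})"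
      unfolding Q'_def by (intro DERIV_add DERIV_cmult dRe dX' that)
    then show "(Q' \<rho> a b has_real_derivative (\<omega> - \<tau> * \<phi> t ^ 4) * Q \<rho> a b t - \<rho> * P \<rho> a b t) (at t within {0..T})"
      by (rule DERIV_cong) (simp add: R_def pair_rhs_def P_def Q_def algebra_simps)
  qed
  have PQ0: "P \<rho> a b 0 = 0" "Q \<rho> a b 0 = 0" if "\<bar>\<rho>\<bar> \<le> \<Lambda>" for \<rho> a b
    by (simp_all add: P_def Q_def X0[OF that])
  have PQ'0: "P' \<rho> a b 0 = a" "Q' \<rho> a b 0 = b" for \<rho> a b
    by (simp_all add: P'_def Q'_def X'0)
  define D where "D = (\<lambda>\<rho> x. Re (X \<rho> 1 x) * Im (X \<rho> \<i> x) - Re (X \<rho> \<i> x) * Im (X \<rho> 1 x))"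
  have kernel: "\<exists>a b. (a \<noteq> 0 \<or> b \<noteq> 0) \<and> P \<rho> a b x = 0 \<and> Q \<rho> a b x = 0" if "D \<rho> x = 0" for \<rho> x
    using singular_2x2_kernel[OF that[unfolded D_def]] unfolding P_def Q_def by metis
  have D_\<Lambda>: "D \<Lambda> x \<noteq> 0" if "0 < x" "x \<le> T" for x
  proof
    assume "D \<Lambda> x = 0"
    then obtain a b where ab: "a \<noteq> 0 \<or> b \<noteq> 0" "P \<Lambda> a b x = 0" "Q \<Lambda> a b x = 0" using kernel by blast
    have L: "\<bar>\<Lambda>\<bar> \<le> \<Lambda>" using \<Lambda> by simp
    have "P' \<Lambda> a b 0 = 0 \<and> Q' \<Lambda> a b 0 = 0"
      by (rule pair_no_conjugate_point[OF M \<Lambda>(2) that dP[OF L] dQ[OF L] dP'[OF L] dQ'[OF L]])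
         (use ab PQ0[OF L] in auto)
    then show False using ab by (simp add: PQ'0)
  qed
  (* Near 0 the determinant behaves like x^2, and it has no zero up to T. *)
  have D_pos: "D \<Lambda> T > 0"
  proof (rule ccontr)
    assume neg: "\<not> D \<Lambda> T > 0"
    have L: "\<bar>\<Lambda>\<bar> \<le> \<Lambda>" using \<Lambda> by simp
    have lim: "((\<lambda>x. Re (X \<Lambda> e x) / x) \<longlongrightarrow> Re e) (at_right 0)" "((\<lambda>x. Im (X \<Lambda> e x) / x) \<longlongrightarrow> Im e) (at_right 0)" for e
      using dRe[OF dX[OF L, of 0 e]] T_pos X0[OF L]
      by (simp_all add: has_field_derivative_iff X'0 at_within_Icc_at_right)
    have "((\<lambda>x. (Re (X \<Lambda> 1 x) / x) * (Im (X \<Lambda> \<i> x) / x) - (Re (X \<Lambda> \<i> x) / x) * (Im (X \<Lambda> 1 x) / x)) \<longlongrightarrow>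
        Re 1 * Im \<i> - Re \<i> * Im 1) (at_right 0)"
      by (intro tendsto_intros lim)
    then have "eventually (\<lambda>x. (Re (X \<Lambda> 1 x) / x) * (Im (X \<Lambda> \<i> x) / x) - (Re (X \<Lambda> \<i> x) / x) * (Im (X \<Lambda> 1 x) / x) > 0) (at_right 0)"
      by (rule order_tendstoD(1)) simp
    moreover have "eventually (\<lambda>x. x \<in> {0<..<T}) (at_right 0)"
      using eventually_at_right_real[OF T_pos] .
    ultimately have "eventually (\<lambda>x. x \<in> {0<..<T} \<and> D \<Lambda> x > 0) (at_right 0)"
    proof eventually_elim
      case (elim x)
      have "D \<Lambda> x = x\<^sup>2 * ((Re (X \<Lambda> 1 x) / x) * (Im (X \<Lambda> \<i> x) / x) - (Re (X \<Lambda> \<i> x) / x) * (Im (X \<Lambda> 1 x) / x))"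
        using elim by (simp add: D_def field_simps power2_eq_square)
      then show ?case using elim by (simp add: zero_less_mult_iff)
    qed
    then obtain x where x: "0 < x" "x < T" "D \<Lambda> x > 0"
      using eventually_happens'[OF trivial_limit_at_right_real] by auto
    have "continuous_on {x..T} (D \<Lambda>)"
      unfolding D_def by (intro continuous_intros continuous_on_subset[OF cX[OF L]]) (use x in auto)
    then obtain y where "x \<le> y" "y \<le> T" "D \<Lambda> y = 0"
      using IVT2'[of "D \<Lambda>" T 0 x] neg x by auto
    then show False using D_\<Lambda>[of y] x by auto
  qed
  (* At 0 the pair decouples: the determinant is a product of two scalar solutions. *)
  have D_neg: "D 0 T < 0"
  proof -
    have L: "\<bar>0\<bar> \<le> \<Lambda>" using \<Lambda> by simp
    (* The second component with vanishing initial data solves a homogeneous Volterra equation. *)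
    have Im0: "Im (X 0 1 x) = 0" if x: "x \<in> {0..T}" for x
    proof -
      have "norm (Im (X 0 1 x)) \<le> 2 * exp ((2 * C * T + 1) * T) * 0"
      proof (rule volterra_bound[OF T_pos C, where U = "\<lambda>x. Im (X 0 1 x)" and M = "\<lambda>s v. (\<omega> - \<tau> * \<phi> s ^ 4) * v" and H = "\<lambda>_. 0"])
        show "norm ((\<omega> - \<tau> * \<phi> s ^ 4) * v) \<le> C * norm v" if "s \<in> {0..T}" for s v
          using Cb[OF L that, of "Complex 0 v"] by (simp add: pair_rhs_def complex_norm abs_mult)
        show "continuous_on {0..T} (\<lambda>x. Im (X 0 1 x))"
          "continuous_on {0..T} (\<lambda>s. (\<omega> - \<tau> * \<phi> s ^ 4) * Im (X 0 1 s))"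
          by (intro continuous_intros cX L)+
        show "Im (X 0 1 x) = 0 + integral {0..x} (\<lambda>s. (x - s) *\<^sub>R ((\<omega> - \<tau> * \<phi> s ^ 4) * Im (X 0 1 s)))" if x: "x \<in> {0..T}" for x
        proof -
          have "(\<lambda>s. (x - s) *\<^sub>R R 0 s (X 0 1 s)) integrable_on {0..x}"
            using x by (intro integrable_continuous_interval continuous_intros continuous_on_subset[OF cR[OF cX[OF L]]]) auto
          from integral_linear[OF this bounded_linear_Im]
          have "integral {0..x} (\<lambda>s. Im ((x - s) *\<^sub>R R 0 s (X 0 1 s))) = Im (integral {0..x} (\<lambda>s. (x - s) *\<^sub>R R 0 s (X 0 1 s)))"
            by (simp add: o_def)
          then show ?thesis by (subst X[OF L x]) (simp add: R_def pair_rhs_def)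
        qed
      qed (use x in auto)
      then show ?thesis by simp
    qed
    have "P 0 1 0 T < 0"
      by (rule sturm_one_zero[OF \<sigma> dP[OF L]]) (use dP'[OF L, of _ 1 0] PQ0[OF L] PQ'0 in auto)
    moreover have "Q 0 0 1 T > 0"
      by (rule sturm_no_zero[OF \<tau> dQ[OF L]]) (use dQ'[OF L, of _ 0 1] PQ0[OF L] PQ'0 in auto)
    moreover have "D 0 T = P 0 1 0 T * Q 0 0 1 T"
      using Im0[of T] T_pos by (simp add: D_def P_def Q_def)
    ultimately show ?thesis by (simp add: mult_neg_pos)
  qed
  (* Lipschitz dependence on rho, from the Volterra bound for the difference of two solutions. *)
  have cont: "continuous_on {0..\<Lambda>} (\<lambda>\<rho>. X \<rho> e T)" for e
  proof -
    define E where "E = 2 * exp ((2 * C * T + 1) * T)"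
    define B where "B = E * (T * norm e)"
    have E: "E > 0" by (simp add: E_def)
    have B: "B \<ge> 0" unfolding B_def using E T_pos by simp
    have Xb: "norm (X \<rho> e x) \<le> B" if "\<bar>\<rho>\<bar> \<le> \<Lambda>" "x \<in> {0..T}" for \<rho> x
      unfolding B_def E_def
      by (rule volterra_bound[OF T_pos C, where U = "X \<rho> e" and M = "R \<rho>" and H = "\<lambda>x. x *\<^sub>R e"])
         (use that X cX cR Cb in \<open>auto simp: R_def intro!: mult_right_mono\<close>)
    have "(E * (T * B * T))-lipschitz_on {0..\<Lambda>} (\<lambda>\<rho>. X \<rho> e T)"
    proof (rule lipschitz_onI)
      show "0 \<le> E * (T * B * T)" using E B T_pos by simp
      fix \<rho> \<mu> assume "\<rho> \<in> {0..\<Lambda>}" "\<mu> \<in> {0..\<Lambda>}"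
      then have \<rho>: "\<bar>\<rho>\<bar> \<le> \<Lambda>" and \<mu>: "\<bar>\<mu>\<bar> \<le> \<Lambda>" by auto
      define V where "V = (\<lambda>x. X \<rho> e x - X \<mu> e x)"
      define G where "G = (\<lambda>s. R \<rho> s (X \<mu> e s) - R \<mu> s (X \<mu> e s))"
      have "norm (V T) \<le> 2 * exp ((2 * C * T + 1) * T) * (\<bar>\<rho> - \<mu>\<bar> * (T * B * T))"
      proof (rule volterra_bound[OF T_pos C, where U = V and M = "R \<rho>" and H = "\<lambda>x. integral {0..x} (\<lambda>s. (x - s) *\<^sub>R G s)"])
        show "norm (R \<rho> s v) \<le> C * norm v" if "s \<in> {0..T}" for s v
          unfolding R_def by (rule Cb[OF \<rho> that])
        show cV: "continuous_on {0..T} V" unfolding V_def by (intro continuous_intros cX \<rho> \<mu>)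
        then show "continuous_on {0..T} (\<lambda>s. R \<rho> s (V s))" by (rule cR)
        have cG: "continuous_on {0..T} G" unfolding G_def by (intro continuous_intros cR cX \<mu>)
        show "V x = integral {0..x} (\<lambda>s. (x - s) *\<^sub>R G s) + integral {0..x} (\<lambda>s. (x - s) *\<^sub>R R \<rho> s (V s))"
          if x: "x \<in> {0..T}" for x
        proof -
          have int: "(\<lambda>s. (x - s) *\<^sub>R f s) integrable_on {0..x}" if "continuous_on {0..T} f" for f :: "real \<Rightarrow> complex"
            using x by (intro integrable_continuous_interval continuous_intros continuous_on_subset[OF that]) auto
          have "V x = integral {0..x} (\<lambda>s. (x - s) *\<^sub>R R \<rho> s (X \<rho> e s)) - integral {0..x} (\<lambda>s. (x - s) *\<^sub>R R \<mu> s (X \<mu> e s))"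
            unfolding V_def by (subst X[OF \<rho> x], subst X[OF \<mu> x]) simp
          also have "\<dots> = integral {0..x} (\<lambda>s. (x - s) *\<^sub>R R \<rho> s (X \<rho> e s) - (x - s) *\<^sub>R R \<mu> s (X \<mu> e s))"
            by (intro integral_diff[symmetric] int cR cX \<rho> \<mu>)
          also have "\<dots> = integral {0..x} (\<lambda>s. (x - s) *\<^sub>R G s + (x - s) *\<^sub>R R \<rho> s (V s))"
            by (simp add: G_def V_def R_def pair_rhs_diff algebra_simps)
          also have "\<dots> = integral {0..x} (\<lambda>s. (x - s) *\<^sub>R G s) + integral {0..x} (\<lambda>s. (x - s) *\<^sub>R R \<rho> s (V s))"
            by (intro integral_add int cR cV cG)
          finally show ?thesis .
        qed
        show "norm (integral {0..x} (\<lambda>s. (x - s) *\<^sub>R G s)) \<le> \<bar>\<rho> - \<mu>\<bar> * (T * B * T)" if x: "x \<in> {0..T}" for x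
        proof -
          have "norm (integral {0..x} (\<lambda>s. (x - s) *\<^sub>R G s)) \<le> (T * (\<bar>\<rho> - \<mu>\<bar> * B)) * (x - 0)"
          proof (rule integral_bound)
            show "continuous_on {0..x} (\<lambda>s. (x - s) *\<^sub>R G s)"
              using x by (intro continuous_intros continuous_on_subset[OF cG]) auto
            show "norm ((x - s) *\<^sub>R G s) \<le> T * (\<bar>\<rho> - \<mu>\<bar> * B)" if s: "s \<in> {0..x}" for s
            proof -
              have "G s = of_real (\<rho> - \<mu>) * (- \<i> * X \<mu> e s)"
                by (simp add: G_def R_def pair_rhs_def complex_eq_iff algebra_simps)
              then have "norm (G s) \<le> \<bar>\<rho> - \<mu>\<bar> * B"
                using Xb[OF \<mu>, of s] s x by (auto simp: norm_mult intro!: mult_left_mono simp flip: of_real_diff)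
              then show ?thesis using s x T_pos B by (auto intro!: mult_mono)
            qed
          qed (use x in auto)
          also have "\<dots> \<le> (T * (\<bar>\<rho> - \<mu>\<bar> * B)) * T" using x T_pos B by (intro mult_left_mono) auto
          finally show ?thesis by (simp add: mult_ac)
        qed
      qed (use T_pos in auto)
      then show "dist (X \<rho> e T) (X \<mu> e T) \<le> E * (T * B * T) * dist \<rho> \<mu>"
        by (simp add: V_def E_def dist_norm dist_real_def mult_ac)
    qed
    then show ?thesis by (rule lipschitz_on_continuous_on)
  qed
  have "continuous_on {0..\<Lambda>} (\<lambda>\<rho>. D \<rho> T)" unfolding D_def by (intro continuous_intros cont)
  then obtain \<rho> where \<rho>: "0 \<le> \<rho>" "\<rho> \<le> \<Lambda>" "D \<rho> T = 0"
    using IVT'[of "\<lambda>\<rho>. D \<rho> T" 0 0 \<Lambda>] D_neg D_pos \<Lambda> by auto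
  then have \<rho>0: "\<rho> > 0" using D_neg by (cases "\<rho> = 0") auto
  have L: "\<bar>\<rho>\<bar> \<le> \<Lambda>" using \<rho> by simp
  obtain a b where ab: "a \<noteq> 0 \<or> b \<noteq> 0" "P \<rho> a b T = 0" "Q \<rho> a b T = 0" using kernel[OF \<rho>(3)] by blast
  have d1: "dirichlet (P \<rho> a b) (P' \<rho> a b)" "dirichlet (Q \<rho> a b) (Q' \<rho> a b)"
    unfolding dirichlet_def
    using dP[OF L] dQ[OF L] PQ0[OF L] ab DERIV_continuous_on[OF dP'[OF L]] DERIV_continuous_on[OF dQ'[OF L]] by auto
  have "\<exists>t\<in>{0..T}. P \<rho> a b t \<noteq> 0 \<or> Q \<rho> a b t \<noteq> 0"
  proof (rule ccontr)
    assume neg: "\<not> ?thesis"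
    have d0: "E = 0" if "\<And>t. t \<in> {0..T} \<Longrightarrow> f t = 0" "(f has_real_derivative E) (at 0 within {0..T})" for f E
      by (rule zero_function_derivative[OF T_pos _ that]) (use T_pos in auto)
    have "P' \<rho> a b 0 = 0" by (rule d0[OF _ dP[OF L]]) (use neg T_pos in auto)
    moreover have "Q' \<rho> a b 0 = 0" by (rule d0[OF _ dQ[OF L]]) (use neg T_pos in auto)
    ultimately show False using ab by (simp add: PQ'0)
  qed
  then show ?thesis using that[OF \<rho>0 d1 dP'[OF L] dQ'[OF L]] by blast
qed

end

section \<open>The snoidal profile\<close>

lemma ellipF_deriv:
  assumes k: "0 < k" "k < 1"
  shows "((\<lambda>\<phi>. ellipF \<phi> k) has_real_derivative 1 / sqrt (1 - k\<^sup>2 * (sin \<phi>)\<^sup>2)) (at \<phi>)"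
proof -
  define f where "f = (\<lambda>t. 1 / sqrt (1 - k\<^sup>2 * (sin t)\<^sup>2))"
  have pos: "1 - k\<^sup>2 * (sin t)\<^sup>2 > 0" for t
  proof -
    have "k\<^sup>2 < 1" using k by (simp add: abs_square_less_1)
    moreover have "k\<^sup>2 * (sin t)\<^sup>2 \<le> k\<^sup>2 * 1" by (intro mult_left_mono) (auto simp: abs_square_le_1)
    ultimately show ?thesis by simp
  qed
  define a b where "a = min 0 \<phi> - 1" and "b = max 0 \<phi> + 1"
  have ab: "a \<le> 0" "0 \<le> b" "a < \<phi>" "\<phi> < b" by (auto simp: a_def b_def)
  have "((\<lambda>u. LBINT y=ereal 0..ereal u. f y) has_vector_derivative f \<phi>) (at \<phi> within {a..b})"
  proof (rule interval_integral_FTC2)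
    have "sqrt (1 - k\<^sup>2 * (sin t)\<^sup>2) \<noteq> 0" for t using pos[of t] by simp
    then show "continuous_on {a..b} f" unfolding f_def by (intro continuous_intros) blast
  qed (use ab in auto)
  then have "((\<lambda>\<phi>. ellipF \<phi> k) has_vector_derivative f \<phi>) (at \<phi>)"
    using ab by (simp add: ellipF_def f_def at_within_Icc_at)
  then show ?thesis by (simp add: f_def has_real_derivative_iff_has_vector_derivative)
qed

lemma ellipF_0: "ellipF 0 k = 0"
  by (simp add: ellipF_def)

text \<open>The integrand is at least \<open>1\<close>. This gives both injectivity and, since \<open>ellipF\<close> then leaves every bounded set,
  surjectivity.\<close>

lemma ellipF_diff_ge:
  assumes k: "0 < k" "k < 1" and xy: "x \<le> y"
  shows "y - x \<le> ellipF y k - ellipF x k"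
proof -
  have "ellipF x k - x \<le> ellipF y k - y"
  proof (rule DERIV_nonneg_imp_nondecreasing[OF xy])
    fix t
    have "0 < 1 - k\<^sup>2 * (sin t)\<^sup>2"
    proof -
      have "k\<^sup>2 < 1" using k by (simp add: abs_square_less_1)
      moreover have "k\<^sup>2 * (sin t)\<^sup>2 \<le> k\<^sup>2 * 1" by (intro mult_left_mono) (auto simp: abs_square_le_1)
      ultimately show ?thesis by simp
    qed
    then have "1 / sqrt (1 - k\<^sup>2 * (sin t)\<^sup>2) \<ge> 1" by simp
    moreover have "((\<lambda>x. ellipF x k - x) has_real_derivative 1 / sqrt (1 - k\<^sup>2 * (sin t)\<^sup>2) - 1) (at t)"
      by (intro derivative_intros ellipF_deriv k)
    ultimately show "\<exists>D. ((\<lambda>x. ellipF x k - x) has_real_derivative D) (at t) \<and> 0 \<le> D"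
      by (intro exI conjI) auto
  qed
  then show ?thesis by simp
qed

lemma ellipF_strict_mono: "0 < k \<Longrightarrow> k < 1 \<Longrightarrow> x < y \<Longrightarrow> ellipF x k < ellipF y k"
  using ellipF_diff_ge[of k x y] by simp

lemma ellipF_surj:
  assumes k: "0 < k" "k < 1"
  obtains \<theta> where "ellipF \<theta> k = u"
proof -
  have c: "isCont (\<lambda>\<phi>. ellipF \<phi> k) x" for x
    by (rule DERIV_isCont[OF ellipF_deriv[OF k]])
  define m where "m = min u 0"
  define M where "M = max u 0"
  have "ellipF m k \<le> u"
    using ellipF_diff_ge[OF k, of u 0] by (cases "u \<le> 0") (auto simp: m_def ellipF_0)
  moreover have "u \<le> ellipF M k"
    using ellipF_diff_ge[OF k, of 0 u] by (cases "0 \<le> u") (auto simp: M_def ellipF_0)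
  moreover have "m \<le> M" by (simp add: m_def M_def)
  ultimately have "\<exists>x. m \<le> x \<and> x \<le> M \<and> ellipF x k = u"
    using IVT[of "\<lambda>\<phi>. ellipF \<phi> k" m u M] c by blast
  then show ?thesis using that by blast
qed

text \<open>Symmetry of the integrand about \<open>\<pi>/2\<close>, the reason for the symmetry of the profile about a quarter period.\<close>

lemma ellipF_reflect:
  assumes k: "0 < k" "k < 1" shows "ellipF (pi - \<theta>) k = 2 * ellipK k - ellipF \<theta> k"
proof -
  have "((\<lambda>\<theta>. ellipF (pi - \<theta>) k + ellipF \<theta> k) has_real_derivative 0) (at x)" for x
  proof -
    have "((\<lambda>\<theta>. ellipF (pi - \<theta>) k) has_real_derivative 1 / sqrt (1 - k\<^sup>2 * (sin (pi - x))\<^sup>2) * (- 1)) (at x)"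
      by (rule DERIV_chain2[OF ellipF_deriv[OF k]]) (auto intro!: derivative_eq_intros)
    from DERIV_add[OF this ellipF_deriv[OF k, of x]] show ?thesis by simp
  qed
  then have "ellipF (pi - \<theta>) k + ellipF \<theta> k = ellipF (pi - pi / 2) k + ellipF (pi / 2) k"
    by (rule DERIV_isconst_all[rule_format])
  then show ?thesis by (simp add: ellipK_def)
qed

lemma jacobi_am_ellipF: "0 < k \<Longrightarrow> k < 1 \<Longrightarrow> jacobi_am (ellipF \<theta> k) k = \<theta>"
  unfolding jacobi_am_def
  by (rule the_equality, rule refl) (metis ellipF_strict_mono less_irrefl linorder_neqE_linordered_idom)

lemma jacobi_sn_ellipF: "0 < k \<Longrightarrow> k < 1 \<Longrightarrow> jacobi_sn (ellipF \<theta> k) k = sin \<theta>"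
  by (simp add: jacobi_sn_def jacobi_am_ellipF)

lemma ellipK_pos: "0 < k \<Longrightarrow> k < 1 \<Longrightarrow> 0 < ellipK k"
  using ellipF_strict_mono[of k 0 "pi / 2"] by (simp add: ellipK_def ellipF_0)

lemma jacobi_sn_reflect:
  assumes k: "0 < k" "k < 1" shows "jacobi_sn (2 * ellipK k - u) k = jacobi_sn u k"
proof -
  obtain \<theta> where "ellipF \<theta> k = u" by (rule ellipF_surj[OF k])
  then show ?thesis using jacobi_sn_ellipF[OF k, of "pi - \<theta>"] jacobi_sn_ellipF[OF k, of \<theta>]
    by (simp add: ellipF_reflect[OF k])
qed

lemma jacobi_sn_0: "0 < k \<Longrightarrow> k < 1 \<Longrightarrow> jacobi_sn 0 k = 0"
  using jacobi_sn_ellipF[of k 0] by (simp add: ellipF_0)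

lemma jacobi_sn_K: "0 < k \<Longrightarrow> k < 1 \<Longrightarrow> jacobi_sn (ellipK k) k = 1"
  using jacobi_sn_ellipF[of k "pi / 2"] by (simp add: ellipK_def)

lemma jacobi_sn_strict_mono:
  assumes k: "0 < k" "k < 1" and uv: "0 \<le> u" "u < v" "v \<le> ellipK k"
  shows "jacobi_sn u k < jacobi_sn v k"
proof -
  obtain \<alpha> where \<alpha>: "ellipF \<alpha> k = u" by (rule ellipF_surj[OF k])
  obtain \<beta> where \<beta>: "ellipF \<beta> k = v" by (rule ellipF_surj[OF k])
  have le: "x \<le> y" if "ellipF x k \<le> ellipF y k" for x y
    using ellipF_strict_mono[OF k, of y x] that by (cases "y < x") auto
  have "0 \<le> \<alpha>" using le[of 0 \<alpha>] uv \<alpha> by (simp add: ellipF_0)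
  moreover have "\<alpha> < \<beta>" using ellipF_diff_ge[OF k, of \<beta> \<alpha>] uv \<alpha> \<beta> by linarith
  moreover have "\<beta> \<le> pi / 2" using le[of \<beta> "pi / 2"] uv \<beta> by (simp add: ellipK_def)
  ultimately  have "sin \<alpha> < sin \<beta>" by (intro sin_monotone_2pi) auto
  then show ?thesis using jacobi_sn_ellipF[OF k, of \<alpha>] jacobi_sn_ellipF[OF k, of \<beta>] \<alpha> \<beta> by simp
qed

text \<open>The elliptic sine rises strictly from \<open>0\<close> to \<open>1\<close> on \<open>[0, K]\<close> and is symmetric about \<open>K\<close>, which gives the shape of the
  arch. Everything else comes from the profile equation and the value at the top: there \<open>\<phi>\<close> equals
  the parameter \<open>a\<close>, and with \<open>s = sqrt (k\<^sup>4 - k\<^sup>2 + 1)\<close> one has \<open>\<omega> = m s\<close> and \<open>a\<^sup>4 = m (2 - k\<^sup>2 + 2 s)\<close> for the same factor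
  \<open>m\<close>, so the bounds \<open>s < 2 - k\<^sup>2 < 2 s\<close> are exactly the required range of the amplitude.\<close>

lemma snoidal_quintic_wave:
  assumes L: "L > 0" and c: "\<kappa> + \<gamma> * B ^ 3 > 0"
    and sno: "has_snoidal_profile L \<kappa> \<gamma> B \<omega> \<psi>" and sol: "solves_profile_eq \<kappa> \<gamma> B \<omega> \<psi>"
  obtains \<phi> \<phi>1 where "quintic_wave \<phi> \<phi>1 \<omega> (L / 4) (L / 2)" "\<And>x. \<phi> x ^ 4 = (\<kappa> + \<gamma> * B ^ 3) * \<psi> x ^ 4"
proof -
  obtain k where k: "0 < k" "k < 1" and \<omega>: "\<omega> = snoidal_freq L k" and \<psi>: "\<psi> = snoidal_profile L \<kappa> \<gamma> B k"
    using sno unfolding has_snoidal_profile_def by blast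
  obtain \<psi>' \<psi>'' where d: "\<And>x. (\<psi> has_real_derivative \<psi>' x) (at x)" "\<And>x. (\<psi>' has_real_derivative \<psi>'' x) (at x)"
    and eq: "\<And>x. - \<psi>'' x + \<omega> * \<psi> x - (\<kappa> + \<gamma> * B ^ 3) * \<psi> x ^ 5 = 0"
    using sol unfolding solves_profile_eq_def by metis
  define r where "r = root 4 (\<kappa> + \<gamma> * B ^ 3)"
  have r: "r > 0" "r ^ 4 = \<kappa> + \<gamma> * B ^ 3" using c by (simp_all add: r_def)
  (* The parameter a-tilde of the profile is negative; the sign makes the first arch positive. *)
  define \<phi> where "\<phi> = (\<lambda>x. - r * \<psi> x)"
  define \<phi>1 where "\<phi>1 = (\<lambda>x. - r * \<psi>' x)"
  have \<phi>4: "\<phi> x ^ 4 = (\<kappa> + \<gamma> * B ^ 3) * \<psi> x ^ 4" for x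
    by (simp add: \<phi>_def power_mult_distrib r)
  have d\<phi>: "(\<phi> has_real_derivative \<phi>1 x) (at x)" for x
    unfolding \<phi>_def \<phi>1_def by (intro DERIV_cmult d)
  have d\<phi>1: "(\<phi>1 has_real_derivative \<omega> * \<phi> x - \<phi> x ^ 5) (at x)" for x
  proof -
    have "(\<phi>1 has_real_derivative - r * \<psi>'' x) (at x)" unfolding \<phi>1_def by (intro DERIV_cmult d)
    moreover have "\<psi>'' x = \<omega> * \<psi> x - r ^ 4 * \<psi> x ^ 5" using eq[of x] r by simp
    then have "- r * \<psi>'' x = \<omega> * \<phi> x - \<phi> x ^ 5"
      unfolding \<phi>_def by (simp only: ) (simp add: algebra_simps eval_nat_numeral)
    ultimately show ?thesis by simp
  qed
  define K where "K = ellipK k"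
  have K: "K > 0" using ellipK_pos[OF k] by (simp add: K_def)
  define R where "R = k ^ 4 - k\<^sup>2 + 1"
  define q qt a where "q = snoidal_q k" and "qt = snoidal_qt k" and "a = snoidal_a L k"
  have k2: "0 < k\<^sup>2" "k\<^sup>2 < 1" using k by (simp_all add: abs_square_less_1)
  have R: "R = (1 - k\<^sup>2)\<^sup>2 + k\<^sup>2" by (simp add: R_def power2_eq_square algebra_simps eval_nat_numeral)
  have R0: "R > 0" unfolding R using k2 by (intro add_nonneg_pos) auto
  define s where "s = sqrt R"
  have s: "s > 0" "s\<^sup>2 = R" using R0 by (simp_all add: s_def)
  have s1: "s < 2 - k\<^sup>2"
  proof (rule power2_less_imp_less)
    show "s\<^sup>2 < (2 - k\<^sup>2)\<^sup>2" unfolding s R using k2 by (simp add: power2_eq_square algebra_simps)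
  qed (use k2 in auto)
  have s2: "2 - k\<^sup>2 < 2 * s"
  proof (rule power2_less_imp_less)
    have "0 < k\<^sup>2 * k\<^sup>2" using k2 by simp
    then show "(2 - k\<^sup>2)\<^sup>2 < (2 * s)\<^sup>2" unfolding power_mult_distrib s R by (simp add: power2_eq_square algebra_simps)
  qed (use s in auto)
  have q: "q = - 1 + k\<^sup>2 - s" by (simp add: q_def snoidal_q_def s_def R_def)
  have q1: "1 - q > 0" using q s k2 by simp
  have qt: "1 - qt = (1 - k\<^sup>2) / (1 - q)"
    using q1 by (simp add: qt_def snoidal_qt_def q_def[symmetric] field_simps)
  have qt01: "0 < qt" "0 < 1 - qt"
  proof -
    show "0 < 1 - qt" unfolding qt using k2 q1 by simp
    have "k\<^sup>2 - q > 0" using q s by simp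
    then show "0 < qt" using q1 by (simp add: qt_def snoidal_qt_def q_def[symmetric])
  qed
  have a4: "a ^ 4 = 16 * K\<^sup>2 / L\<^sup>2 * (2 - k\<^sup>2 + 2 * s)" "a > 0"
  proof -
    define Y where "Y = (2 - k\<^sup>2 + 2 * s) * L\<^sup>2 * K\<^sup>2"
    have Y: "Y > 0" unfolding Y_def using k2 s L K by (intro mult_pos_pos) auto
    have aY: "a = 2 / L * root 4 Y"
      by (simp only: a_def snoidal_a_def Y_def s_def R_def K_def)
    have "a ^ 4 = (2 / L) ^ 4 * Y" unfolding aY power_mult_distrib using Y by simp
    also have "\<dots> = 16 * K\<^sup>2 / L\<^sup>2 * (2 - k\<^sup>2 + 2 * s)"
      using L by (simp add: Y_def power_divide divide_simps eval_nat_numeral)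
    finally show "a ^ 4 = 16 * K\<^sup>2 / L\<^sup>2 * (2 - k\<^sup>2 + 2 * s)" .
    show "a > 0" unfolding aY using L Y by simp
  qed
  have \<omega>s: "\<omega> = 16 * K\<^sup>2 / L\<^sup>2 * s" by (simp add: \<omega> snoidal_freq_def K_def s_def R_def)
  define m where "m = 16 * K\<^sup>2 / L\<^sup>2"
  have m: "m > 0" using K L by (simp add: m_def)
  have \<omega>0: "\<omega> > 0" using m s by (simp add: \<omega>s m_def[symmetric])
  have a\<omega>: "3 * \<omega> < a ^ 4" "a ^ 4 < 4 * \<omega>"
  proof -
    have "m * (3 * s) < m * (2 - k\<^sup>2 + 2 * s)" "m * (2 - k\<^sup>2 + 2 * s) < m * (4 * s)"
      using m s1 s2 by (auto intro!: mult_strict_left_mono)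
    then show "3 * \<omega> < a ^ 4" "a ^ 4 < 4 * \<omega>" unfolding a4 \<omega>s m_def[symmetric] by simp_all
  qed
  define sn where "sn = (\<lambda>x. jacobi_sn (4 * K / L * x) k)"
  define A where "A = a * sqrt (1 - k\<^sup>2) / sqrt (1 - q)"
  have A: "A > 0" using a4 k2 q1 by (simp add: A_def)
  define h where "h = (\<lambda>y. y / sqrt (1 - qt * y\<^sup>2))"
  have \<phi>h: "\<phi> x = A * h (sn x)" for x
  proof -
    have "\<psi> x = 1 / r * (- A * sn x / sqrt (1 - qt * (sn x)\<^sup>2))"
      by (simp add: \<psi> snoidal_profile_def r_def snoidal_at_def A_def a_def q_def qt_def sn_def K_def)
    then show ?thesis using r by (simp add: \<phi>_def h_def)
  qed
  have h_mono: "h x < h y" if "0 \<le> x" "x < y" "y \<le> 1" for x y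
  proof -
    have xy: "x\<^sup>2 \<le> y\<^sup>2" "y\<^sup>2 \<le> 1" using that by (auto intro: power_mono power_le_one)
    have "qt * y\<^sup>2 \<le> qt * 1" using xy qt01 by (intro mult_left_mono) auto
    then have 1: "0 < 1 - qt * y\<^sup>2" using qt01 by linarith
    have "qt * x\<^sup>2 \<le> qt * y\<^sup>2" using xy qt01 by (intro mult_left_mono) auto
    then have 2: "sqrt (1 - qt * y\<^sup>2) \<le> sqrt (1 - qt * x\<^sup>2)" by (intro real_sqrt_le_mono) linarith
    have "h x \<le> x / sqrt (1 - qt * y\<^sup>2)" unfolding h_def using that 1 2 by (intro divide_left_mono) auto
    also have "\<dots> < h y" unfolding h_def using that 1 by (intro divide_strict_right_mono) auto
    finally show ?thesis .
  qed
  have sn0: "sn 0 = 0" using jacobi_sn_0[OF k] by (simp add: sn_def)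
  have snl: "sn (L / 4) = 1" using jacobi_sn_K[OF k] L by (simp add: sn_def K_def)
  have sn_mono: "sn x < sn y" if "0 \<le> x" "x < y" "y \<le> L / 4" for x y
  proof -
    have "4 * K / L * x < 4 * K / L * y" using that K L by (intro mult_strict_left_mono) auto
    moreover have "4 * K / L * y \<le> K" using that K L by (simp add: field_simps)
    ultimately show ?thesis unfolding sn_def using that K L k by (intro jacobi_sn_strict_mono) (auto simp: K_def)
  qed
  have \<phi>_mono: "\<phi> x < \<phi> y" if "0 \<le> x" "x < y" "y \<le> L / 4" for x y
  proof -
    have "0 \<le> sn x" using sn_mono[of 0 x] sn0 that by (cases "x = 0") auto
    moreover have "sn y \<le> 1" using sn_mono[of y "L / 4"] snl that by (cases "y = L / 4") auto
    ultimately show ?thesis unfolding \<phi>h using h_mono[of "sn x" "sn y"] sn_mono[OF that] A by simp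
  qed
  have \<phi>_0: "\<phi> 0 = 0" by (simp add: \<phi>h sn0 h_def)
  have \<phi>_sym: "\<phi> (L / 2 - x) = \<phi> x" for x
  proof -
    have "4 * K / L * (L / 2 - x) = 2 * K - 4 * K / L * x" using L by (simp add: field_simps)
    then have "sn (L / 2 - x) = sn x" using jacobi_sn_reflect[OF k] by (simp add: sn_def K_def)
    then show ?thesis by (simp add: \<phi>h)
  qed
  have \<phi>l: "\<phi> (L / 4) = a"
  proof -
    have "\<phi> (L / 4) = A / sqrt (1 - qt)" by (simp add: \<phi>h snl h_def)
    also have "\<dots> = a" unfolding qt A_def using k2 q1 by (simp add: real_sqrt_divide)
    finally show ?thesis .
  qed
  have \<phi>1_l: "\<phi>1 (L / 4) = 0"
  proof -
    have "((\<lambda>x. \<phi> (L / 2 - x)) has_real_derivative \<phi>1 (L / 2 - L / 4) * (- 1)) (at (L / 4))"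
      by (rule DERIV_chain2[OF d\<phi>]) (auto intro!: derivative_eq_intros)
    then have "(\<phi> has_real_derivative - \<phi>1 (L / 4)) (at (L / 4))" by (simp add: \<phi>_sym)
    from DERIV_unique[OF this d\<phi>] show ?thesis by simp
  qed
  (* Monotonicity only gives a nonnegative derivative; the energy excludes zeros before the top. *)
  have \<phi>1_pos: "\<phi>1 x > 0" if x: "0 \<le> x" "x < L / 4" for x
  proof -
    have "((\<lambda>x. (\<phi>1 x)\<^sup>2 - \<omega> * (\<phi> x)\<^sup>2 + (1/3) * \<phi> x ^ 6) has_real_derivative 0) (at x)" for x
      by (rule derivative_eq_intros d\<phi> d\<phi>1 refl)+ (simp add: algebra_simps eval_nat_numeral)
    then have "(\<phi>1 x)\<^sup>2 - \<omega> * (\<phi> x)\<^sup>2 + (1/3) * \<phi> x ^ 6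
        = (\<phi>1 (L / 4))\<^sup>2 - \<omega> * (\<phi> (L / 4))\<^sup>2 + (1/3) * \<phi> (L / 4) ^ 6"
      by (rule DERIV_isconst_all[rule_format])
    then have e: "(\<phi>1 x)\<^sup>2 = (a\<^sup>2 - (\<phi> x)\<^sup>2) * (((\<phi> x) ^ 4 + (\<phi> x)\<^sup>2 * a\<^sup>2 + a ^ 4) / 3 - \<omega>)"
      unfolding \<phi>l \<phi>1_l by (simp add: field_simps eval_nat_numeral)
    have "0 \<le> \<phi> x" using \<phi>_mono[of 0 x] \<phi>_0 x by (cases "x = 0") auto
    moreover have "\<phi> x < a" using \<phi>_mono[of x "L / 4"] x \<phi>l by simp
    ultimately have "(\<phi> x)\<^sup>2 < a\<^sup>2" by (intro power_strict_mono) auto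
    moreover have "((\<phi> x) ^ 4 + (\<phi> x)\<^sup>2 * a\<^sup>2 + a ^ 4) / 3 - \<omega> > 0"
    proof -
      have "0 + 0 + 3 * \<omega> < (\<phi> x) ^ 4 + (\<phi> x)\<^sup>2 * a\<^sup>2 + a ^ 4"
        using a\<omega>(1) by (intro add_le_less_mono add_mono) auto
      then show ?thesis by simp
    qed
    ultimately have "(\<phi>1 x)\<^sup>2 > 0" unfolding e by (intro mult_pos_pos) auto
    then have nz: "\<phi>1 x \<noteq> 0" by auto
    show ?thesis
    proof (rule ccontr)
      assume "\<not> \<phi>1 x > 0"
      then have "\<phi>1 x < 0" using nz by simp
      then obtain \<delta> where \<delta>: "\<delta> > 0" "\<And>h. 0 < h \<Longrightarrow> h < \<delta> \<Longrightarrow> \<phi> (x + h) < \<phi> x"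
        using DERIV_neg_dec_right[OF d\<phi>] by blast
      define h where "h = min \<delta> (L / 4 - x) / 2"
      have "0 < h" "h < \<delta>" "x + h \<le> L / 4" using \<delta>(1) x by (auto simp: h_def min_def field_simps)
      then show False using \<delta>(2)[of h] \<phi>_mono[of x "x + h"] x by simp
    qed
  qed
  have "quintic_wave \<phi> \<phi>1 \<omega> (L / 4) (L / 2)"
    by unfold_locales (use L \<omega>0 d\<phi> d\<phi>1 \<phi>_0 \<phi>_sym \<phi>1_pos a\<omega> \<phi>l in auto)
  then show ?thesis using \<phi>4 by (rule that)
qed

section \<open>Completeness of the sines\<close>

lemma set_integrable_cont_mult:
  fixes g :: "real \<Rightarrow> complex" and e :: "real \<Rightarrow> real"
  assumes g: "set_integrable lborel {0..T} g" and e: "continuous_on UNIV e"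
  shows "set_integrable lborel {0..T} (\<lambda>x. e x *\<^sub>R g x)"
proof -
  define h where "h = (\<lambda>s. indicat_real {0..T} s *\<^sub>R g s)"
  have h: "integrable lborel h" using g by (simp add: set_integrable_def h_def)
  then have hm [measurable]: "h \<in> borel_measurable borel" by auto
  have em [measurable]: "e \<in> borel_measurable borel" using e by (rule borel_measurable_continuous_onI)
  have "bounded (e ` {0..T})"
    by (intro compact_imp_bounded compact_continuous_image continuous_on_subset[OF e]) auto
  then obtain B where "\<forall>y\<in>e ` {0..T}. norm y \<le> B" unfolding bounded_iff by blast
  then have B: "\<bar>e x\<bar> \<le> B" if "x \<in> {0..T}" for x using that by simp
  have "integrable lborel (\<lambda>s. e s *\<^sub>R h s)"
  proof (rule Bochner_Integration.integrable_bound[of lborel "\<lambda>s. B *\<^sub>R norm (h s)"])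
    show "integrable lborel (\<lambda>s. B *\<^sub>R norm (h s))"
      by (intro integrable_scaleR_right integrable_norm h)
    have "norm (e s *\<^sub>R h s) \<le> norm (B *\<^sub>R norm (h s))" for s
      using B[of s] by (auto simp: h_def indicator_def abs_mult intro!: mult_right_mono)
    then show "AE s in lborel. norm (e s *\<^sub>R h s) \<le> norm (B *\<^sub>R norm (h s))" by auto
  qed measurable
  then show ?thesis by (simp add: set_integrable_def h_def mult.commute)
qed

text \<open>Exchange of the order of integration over the triangle \<open>s \<le> x\<close>. It replaces integration by parts where
  \<open>g\<close> is merely integrable.\<close>

lemma fubini_triangle:
  fixes g :: "real \<Rightarrow> complex" and e :: "real \<Rightarrow> real"
  assumes g: "set_integrable lborel {0..T} g" and e: "continuous_on UNIV e" and T: "T \<ge> 0"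
  shows "integral {0..T} (\<lambda>x. e x *\<^sub>R integral {0..x} g) = integral {0..T} (\<lambda>s. integral {s..T} e *\<^sub>R g s)"
proof -
  define h where "h = (\<lambda>s. indicat_real {0..T} s *\<^sub>R g s)"
  have h: "integrable lborel h" using g by (simp add: set_integrable_def h_def)
  then have hm [measurable]: "h \<in> borel_measurable borel" by auto
  have em [measurable]: "e \<in> borel_measurable borel" using e by (rule borel_measurable_continuous_onI)
  define F where "F = (\<lambda>x s. if 0 \<le> x \<and> x \<le> T \<and> s \<le> x then e x *\<^sub>R h s else 0)"
  obtain B where B: "\<And>x. x \<in> {0..T} \<Longrightarrow> \<bar>e x\<bar> \<le> B"
  proof -
    have "bounded (e ` {0..T})"
      by (intro compact_imp_bounded compact_continuous_image continuous_on_subset[OF e]) auto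
    then obtain B where "\<forall>y\<in>e ` {0..T}. norm y \<le> B" unfolding bounded_iff by blast
    then show ?thesis by (intro that[of B]) simp
  qed
  have Fm: "case_prod F \<in> borel_measurable (lborel \<Otimes>\<^sub>M lborel)"
    unfolding F_def by measurable
  have Fx: "integrable lborel (F x)" for x
  proof (rule Bochner_Integration.integrable_bound[of lborel "\<lambda>s. B *\<^sub>R norm (h s)"])
    show "integrable lborel (\<lambda>s. B *\<^sub>R norm (h s))" using h by auto
    show "F x \<in> borel_measurable lborel" unfolding F_def by measurable
    have "norm (F x s) \<le> norm (B *\<^sub>R norm (h s))" for s
    proof (cases "0 \<le> x \<and> x \<le> T \<and> s \<le> x")
      case True
      then have "\<bar>e x\<bar> \<le> \<bar>B\<bar>" using B[of x] by auto
      then show ?thesis using True by (auto simp: F_def abs_mult intro!: mult_right_mono)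
    qed (auto simp: F_def)
    then show "AE s in lborel. norm (F x s) \<le> norm (B *\<^sub>R norm (h s))" by auto
  qed
  have "integrable (lborel \<Otimes>\<^sub>M lborel) (case_prod F)"
  proof (rule lborel_pair.Fubini_integrable[OF Fm])
    show "AE x in lborel. integrable lborel (\<lambda>y. case_prod F (x, y))" using Fx by simp
    show "integrable lborel (\<lambda>x. LINT y|lborel. norm (case_prod F (x, y)))"
    proof (rule Bochner_Integration.integrable_bound[of lborel "\<lambda>x. indicat_real {0..T} x *\<^sub>R (\<bar>B\<bar> * (LINT y|lborel. norm (h y)))"])
      show "integrable lborel (\<lambda>x. indicat_real {0..T} x *\<^sub>R (\<bar>B\<bar> * (LINT y|lborel. norm (h y))))"
        by (intro integrable_scaleR_left integrable_real_indicator) (auto simp: T)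
      show "(\<lambda>x. LINT y|lborel. norm (case_prod F (x, y))) \<in> borel_measurable lborel"
        using Fm by measurable
      have "norm (LINT y|lborel. norm (F x y)) \<le> norm (indicat_real {0..T} x *\<^sub>R (\<bar>B\<bar> * (LINT y|lborel. norm (h y))))" for x
      proof (cases "0 \<le> x \<and> x \<le> T")
        case True
        have "(LINT y|lborel. norm (F x y)) \<le> (LINT y|lborel. \<bar>B\<bar> * norm (h y))"
        proof (rule integral_mono)
          fix y
          have "\<bar>e x\<bar> \<le> \<bar>B\<bar>" using B[of x] True by auto
          then show "norm (F x y) \<le> \<bar>B\<bar> * norm (h y)"
            by (auto simp: F_def intro!: mult_right_mono)
        qed (use Fx h in auto)
        moreover have "0 \<le> (LINT y|lborel. norm (F x y))" "0 \<le> (LINT y|lborel. norm (h y))" by simp_all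
        ultimately show ?thesis using True by simp
      next
        case False
        then have "F x y = 0" for y by (auto simp: F_def)
        then show ?thesis by simp
      qed
      then show "AE x in lborel. norm (LINT y|lborel. norm (case_prod F (x, y)))
          \<le> norm (indicat_real {0..T} x *\<^sub>R (\<bar>B\<bar> * (LINT y|lborel. norm (h y))))" by simp
    qed
  qed
  then have swap: "(LINT y|lborel. LINT x|lborel. F x y) = (LINT x|lborel. LINT y|lborel. F x y)"
    by (rule lborel_pair.Fubini_integral)
  have gx: "set_integrable lborel {0..x} g" if "x \<in> {0..T}" for x
    using g by (rule set_integrable_subset) (use that in auto)
  have inner1: "(LINT y|lborel. F x y) = indicat_real {0..T} x *\<^sub>R (e x *\<^sub>R integral {0..x} g)" for x
  proof (cases "x \<in> {0..T}")
    case True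
    have "F x = (\<lambda>y. e x *\<^sub>R (indicat_real {0..x} y *\<^sub>R g y))"
      using True by (auto simp: F_def h_def indicator_def)
    then have "(LINT y|lborel. F x y) = e x *\<^sub>R (LINT y|lborel. indicat_real {0..x} y *\<^sub>R g y)"
      by (simp only: integral_scaleR_right)
    then show ?thesis using True set_borel_integral_eq_integral(2)[OF gx[OF True]]
      by (simp add: set_lebesgue_integral_def)
  next
    case False
    then have "F x y = 0" for y by (auto simp: F_def)
    then show ?thesis using False by simp
  qed
  have inner2: "(LINT x|lborel. F x y) = indicat_real {0..T} y *\<^sub>R (integral {y..T} e *\<^sub>R g y)" for y
  proof (cases "y \<in> {0..T}")
    case True
    have ie: "set_integrable lborel {y..T} e"
      by (rule borel_integrable_atLeastAtMost') (rule continuous_on_subset[OF e], simp)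
    have "F x y = (indicat_real {y..T} x *\<^sub>R e x) *\<^sub>R g y" for x
      using True by (cases "y \<le> x \<and> x \<le> T") (auto simp: F_def h_def)
    then have "(\<lambda>x. F x y) = (\<lambda>x. (indicat_real {y..T} x *\<^sub>R e x) *\<^sub>R g y)" by (rule ext)
    then show ?thesis using True set_borel_integral_eq_integral(2)[OF ie] ie
      by (simp add: set_lebesgue_integral_def set_integrable_def)
  next
    case False
    then have "F x y = 0" for x by (auto simp: F_def h_def)
    then show ?thesis using False by simp
  qed
  have cI: "continuous_on {0..T} (\<lambda>x. integral {0..x} g)"
    by (rule indefinite_integral_continuous_1) (rule set_borel_integral_eq_integral(1)[OF g])
  have "set_integrable lborel {0..T} (\<lambda>x. e x *\<^sub>R integral {0..x} g)"
    by (rule borel_integrable_atLeastAtMost') (intro continuous_intros cI continuous_on_subset[OF e], simp)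
  from set_borel_integral_eq_integral(2)[OF this]
  have 1: "(LINT x|lborel. LINT y|lborel. F x y) = integral {0..T} (\<lambda>x. e x *\<^sub>R integral {0..x} g)"
    by (simp add: inner1 set_lebesgue_integral_def)
  have "set_integrable lborel {0..T} (\<lambda>s. integral {s..T} e *\<^sub>R g s)"
  proof -
    have "integrable lborel (\<lambda>y. LINT x|lborel. F x y)"
      using lborel_pair.integrable_snd[OF \<open>integrable (lborel \<Otimes>\<^sub>M lborel) (case_prod F)\<close>] by simp
    then show ?thesis by (simp add: inner2 set_integrable_def)
  qed
  from set_borel_integral_eq_integral(2)[OF this]
  have 2: "(LINT y|lborel. LINT x|lborel. F x y) = integral {0..T} (\<lambda>s. integral {s..T} e *\<^sub>R g s)"
    by (simp add: inner2 set_lebesgue_integral_def)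
  show ?thesis using swap 1 2 by simp
qed

lemma integral_cos_linear:
  fixes a :: real assumes "s \<le> t"
  shows "integral {s..t} (\<lambda>x. a * cos (a * x)) = sin (a * t) - sin (a * s)"
  using assms
  by (intro integral_unique fundamental_theorem_of_calculus)
    (auto intro!: derivative_eq_intros simp flip: has_real_derivative_iff_has_vector_derivative)

lemma cos_multiple_step:
  "cos (t::real) * cos (real (Suc n) * t) = (cos (real (Suc (Suc n)) * t) + cos (real n * t)) / 2"
proof -
  have "real (Suc (Suc n)) * t = real (Suc n) * t + t" "real n * t = real (Suc n) * t - t"
    by (simp_all add: algebra_simps)
  then show ?thesis by (simp add: cos_add cos_diff)
qed

text \<open>Powers of \<open>cos \<theta>\<close> are linear combinations of the functions \<open>cos (n \<theta>)\<close>, so \<open>k\<close> is orthogonal to all polynomials in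
  \<open>cos \<theta>\<close>. As \<open>cos\<close> is injective on \<open>[0, \<pi>]\<close>, Weierstrass approximation in the variable \<open>cos \<theta>\<close> shows that \<open>k\<close> is
  orthogonal to itself.\<close>

lemma cosine_complete_continuous:
  fixes k :: "real \<Rightarrow> real"
  assumes T: "T > 0" and k: "continuous_on {0..T} k"
    and orth: "\<And>n::nat. integral {0..T} (\<lambda>x. cos (real n * (pi * x / T)) * k x) = 0"
    and x: "x \<in> {0..T}"
  shows "k x = 0"
proof -
  define \<theta> where "\<theta> = (\<lambda>x. pi * x / T)"
  have \<theta>c: "continuous_on S \<theta>" for S unfolding \<theta>_def using T by (intro continuous_intros) auto
  have \<theta>: "0 \<le> \<theta> x \<and> \<theta> x \<le> pi" if "x \<in> {0..T}" for x
    using that T by (auto simp: \<theta>_def field_simps)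
  have int: "(\<lambda>x. f x * k x) integrable_on {0..T}" if "continuous_on {0..T} f" for f
    using that k by (intro integrable_continuous_interval continuous_intros)
  have pow: "integral {0..T} (\<lambda>x. cos (\<theta> x) ^ m * cos (real n * \<theta> x) * k x) = 0" for m n
  proof (induction m arbitrary: n)
    case 0
    then show ?case using orth by (simp add: \<theta>_def)
  next
    case (Suc m)
    show ?case
    proof (cases n)
      case 0
      have "(\<lambda>x. cos (\<theta> x) ^ Suc m * cos (real n * \<theta> x) * k x) = (\<lambda>x. cos (\<theta> x) ^ m * cos (real 1 * \<theta> x) * k x)"
        using 0 by (auto simp: mult_ac)
      then show ?thesis using Suc.IH[of 1] by simp
    next
      case (Suc j)
      let ?f = "\<lambda>j x. cos (\<theta> x) ^ m * cos (real j * \<theta> x) * k x"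
      have "(\<lambda>x. cos (\<theta> x) ^ Suc m * cos (real n * \<theta> x) * k x) = (\<lambda>x. (?f (Suc (Suc j)) x + ?f j x) / 2)"
      proof
        fix x
        have "cos (\<theta> x) ^ Suc m * cos (real n * \<theta> x) * k x = cos (\<theta> x) ^ m * (cos (\<theta> x) * cos (real (Suc j) * \<theta> x)) * k x"
          using Suc by (simp add: mult_ac)
        then show "cos (\<theta> x) ^ Suc m * cos (real n * \<theta> x) * k x = (?f (Suc (Suc j)) x + ?f j x) / 2"
          unfolding cos_multiple_step by (simp add: algebra_simps)
      qed
      moreover have "(?f i has_integral 0) {0..T}" for i
      proof -
        have "?f i integrable_on {0..T}" by (rule int) (intro continuous_intros \<theta>c)
        then show ?thesis using Suc.IH[of i] by (metis integrable_integral)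
      qed
      then have "((\<lambda>x. (?f (Suc (Suc j)) x + ?f j x) / 2) has_integral ((0 + 0) / 2)) {0..T}"
        by (intro has_integral_divide has_integral_add)
      then have "integral {0..T} (\<lambda>x. (?f (Suc (Suc j)) x + ?f j x) / 2) = (0 + 0) / 2" by (rule integral_unique)
      ultimately show ?thesis by (simp only:) simp
    qed
  qed
  have poly: "integral {0..T} (\<lambda>x. p (cos (\<theta> x)) * k x) = 0" if rp: "real_polynomial_function p" for p
  proof -
    obtain a n where p: "p = (\<lambda>x. \<Sum>i\<le>n. a i * x ^ i)"
      using real_polynomial_function_imp_sum[OF rp] by blast
    have "((\<lambda>x. a i * (cos (\<theta> x) ^ i * k x)) has_integral a i * 0) {0..T}" for i
    proof (rule has_integral_mult_right)
      have "(\<lambda>x. cos (\<theta> x) ^ i * k x) integrable_on {0..T}" by (rule int) (intro continuous_intros \<theta>c)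
      then show "((\<lambda>x. cos (\<theta> x) ^ i * k x) has_integral 0) {0..T}"
        using pow[of i 0] by (metis (no_types, lifting) cos_zero has_integral_integral mult.right_neutral mult_zero_left of_nat_0 integral_cong)
    qed
    then have "((\<lambda>x. \<Sum>i\<le>n. a i * (cos (\<theta> x) ^ i * k x)) has_integral (\<Sum>i\<le>n. a i * 0)) {0..T}"
      by (intro has_integral_sum) auto
    then show ?thesis by (simp add: p sum_distrib_right mult.assoc integral_unique)
  qed
  (* k as a function of cos theta. *)
  define K where "K = (\<lambda>y. k (T * arccos y / pi))"
  have Kc: "continuous_on {-1..1} K"
    unfolding K_def
  proof (rule continuous_on_compose2[OF k])
    show "continuous_on {-1..1} (\<lambda>y. T * arccos y / pi)" by (intro continuous_intros continuous_on_arccos') auto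
    show "(\<lambda>y. T * arccos y / pi) ` {-1..1} \<subseteq> {0..T}"
      using T arccos_lbound arccos_ubound by (auto simp: field_simps)
  qed
  have kK: "k x = K (cos (\<theta> x))" if "x \<in> {0..T}" for x
    using \<theta>[OF that] T by (simp add: K_def arccos_cos) (simp add: \<theta>_def)
  have "integral {0..T} (\<lambda>x. k x * k x) \<le> 0"
  proof (rule field_le_epsilon)
    fix \<epsilon> :: real assume \<epsilon>: "\<epsilon> > 0"
    define I where "I = integral {0..T} (\<lambda>x. \<bar>k x\<bar>)"
    have I: "I \<ge> 0" unfolding I_def by (intro integral_nonneg integrable_continuous_interval continuous_intros k) auto
    define d where "d = \<epsilon> / (I + 1)"
    have d: "d > 0" using I \<epsilon> by (simp add: d_def)
    obtain p where p: "real_polynomial_function p" "\<And>y. y \<in> {-1..1} \<Longrightarrow> \<bar>K y - p y\<bar> < d"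
      using Stone_Weierstrass_real_polynomial_function[OF _ Kc d] by auto
    have pc: "continuous_on S p" for S
      using p(1) continuous_on_polymonial_function real_polynomial_function_eq by blast
    have pcc: "continuous_on {0..T} (\<lambda>x. p (cos (\<theta> x)))"
      by (rule continuous_on_compose2[OF pc[of UNIV]]) (intro continuous_intros \<theta>c, auto)
    have "integral {0..T} (\<lambda>x. k x * k x) = integral {0..T} (\<lambda>x. k x * k x) - integral {0..T} (\<lambda>x. p (cos (\<theta> x)) * k x)"
      using poly[OF p(1)] by simp
    also have "\<dots> = integral {0..T} (\<lambda>x. k x * k x - p (cos (\<theta> x)) * k x)"
      by (intro integral_diff[symmetric] int k pcc)
    also have "\<dots> \<le> integral {0..T} (\<lambda>x. d * \<bar>k x\<bar>)"
    proof (rule integral_le)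
      fix x assume x: "x \<in> {0..T}"
      have "k x * k x - p (cos (\<theta> x)) * k x = (K (cos (\<theta> x)) - p (cos (\<theta> x))) * k x"
        using kK[OF x] by (simp add: algebra_simps)
      also have "\<dots> \<le> \<bar>K (cos (\<theta> x)) - p (cos (\<theta> x))\<bar> * \<bar>k x\<bar>" by (metis abs_ge_self abs_mult)
      also have "\<dots> \<le> d * \<bar>k x\<bar>" using p(2)[of "cos (\<theta> x)"] by (intro mult_right_mono) auto
      finally show "k x * k x - p (cos (\<theta> x)) * k x \<le> d * \<bar>k x\<bar>" .
    qed (intro integrable_continuous_interval continuous_intros k pcc)+
    also have "\<dots> = d * I" by (simp add: I_def)
    also have "\<dots> \<le> 0 + \<epsilon>" using I \<epsilon> by (simp add: d_def field_simps)
    finally show "integral {0..T} (\<lambda>x. k x * k x) \<le> 0 + \<epsilon>" .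
  qed
  moreover have "0 \<le> integral {0..T} (\<lambda>x. k x * k x)"
    by (intro integral_nonneg int k) auto
  ultimately have "((\<lambda>x. k x * k x) has_integral 0) (cbox 0 T)"
    using int[OF k] by (metis antisym box_real(2) integrable_integral)
  then have "k x * k x = 0"
    using x T by (intro has_integral_0_cbox_imp_0[of 0 T "\<lambda>x. k x * k x"]) (auto intro!: continuous_intros k)
  then show ?thesis by simp
qed

text \<open>Lebesgue differentiation: almost everywhere, \<open>h\<close> is the derivative of its indefinite integral.\<close>

lemma AE_zero_of_integral_zero:
  fixes h :: "real \<Rightarrow> complex"
  assumes h: "h integrable_on {0..T}" and z: "\<And>x. x \<in> {0..T} \<Longrightarrow> integral {0..x} h = 0"
  shows "AE x in lborel. x \<in> {0..T} \<longrightarrow> h x = 0"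
proof -
  define f where "f = (\<lambda>x. if x \<in> {0..T} then h x else 0)"
  have fU: "f integrable_on UNIV" unfolding f_def integrable_restrict_UNIV by (rule h)
  have "f integrable_on cbox a b" for a b
    by (rule integrable_on_subcbox[OF fU]) simp
  then obtain N where N: "negligible N"
    "\<And>x e. x \<notin> N \<Longrightarrow> 0 < e \<Longrightarrow> \<exists>d>0. \<forall>h. 0 < h \<and> h < d \<longrightarrow>
        norm (integral (cbox x (x + h *\<^sub>R One)) f /\<^sub>R h ^ DIM(real) - f x) < e"
    using integrable_ccontinuous_explicit[of f] by blast
  have zero: "h x = 0" if x: "x \<in> {0..<T}" "x \<notin> N" for x
  proof (rule ccontr)
    assume "h x \<noteq> 0"
    then obtain d where d: "d > 0" "\<And>t. 0 < t \<Longrightarrow> t < d \<Longrightarrow> norm (integral (cbox x (x + t *\<^sub>R One)) f /\<^sub>R t ^ DIM(real) - f x) < norm (h x)"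
      using N(2)[OF x(2), of "norm (h x)"] by auto
    define t where "t = min d (T - x) / 2"
    have t: "0 < t" "t < d" "x + t \<le> T" using d x by (auto simp: t_def min_def field_simps)
    have "integral {x..x + t} f = integral {x..x + t} h"
      using x t by (intro integral_cong) (auto simp: f_def)
    also have "\<dots> = integral {0..x + t} h - integral {0..x} h"
    proof -
      have "h integrable_on {0..x + t}" by (rule integrable_on_subinterval[OF h]) (use x t in auto)
      then have "integral {0..x} h + integral {x..x + t} h = integral {0..x + t} h"
        using x t by (intro Henstock_Kurzweil_Integration.integral_combine) auto
      then show ?thesis by (simp add: algebra_simps)
    qed
    also have "\<dots> = 0" using z x t by simp
    finally show False using d(2)[OF t(1,2)] x by (simp add: f_def)
  qed
  have "negligible (insert T N)" using N(1) by simp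
  then have "insert T N \<in> null_sets lebesgue" by (simp add: negligible_iff_null_sets)
  then have "AE x in lebesgue. x \<notin> insert T N" by (rule AE_not_in)
  then have "AE x in lebesgue. x \<in> {0..T} \<longrightarrow> h x = 0"
    by eventually_elim (use zero in force)
  then show ?thesis by (simp add: AE_completion_iff)
qed

text \<open>Integration by parts turns sine moments of \<open>h\<close> into cosine moments of its indefinite integral \<open>H\<close>. This loses
  the zeroth moment, so it is \<open>H\<close> minus its mean that is orthogonal to all cosines and vanishes; since \<open>H(0) = 0\<close>, the mean is
  zero as well.\<close>

lemma sine_complete_real:
  fixes h :: "real \<Rightarrow> real"
  assumes T: "T > 0" and h: "set_integrable lborel {0..T} h"
    and orth: "\<And>n::nat. integral {0..T} (\<lambda>x. sin (real n * (pi * x / T)) * h x) = 0"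
  shows "x \<in> {0..T} \<Longrightarrow> integral {0..x} h = 0"
proof -
  define H where "H = (\<lambda>x. integral {0..x} h)"
  have hi: "h integrable_on {0..T}" by (rule set_borel_integral_eq_integral(1)[OF h])
  have Hc: "continuous_on {0..T} H" unfolding H_def by (rule indefinite_integral_continuous_1[OF hi])
  define m where "m = integral {0..T} H / T"
  define k where "k = (\<lambda>x. H x - m)"
  have kc: "continuous_on {0..T} k" unfolding k_def by (intro continuous_intros Hc)
  have hC: "set_integrable lborel {0..T} (\<lambda>x. complex_of_real (h x))"
  proof -
    have "integrable lborel (\<lambda>x. complex_of_real (indicat_real {0..T} x *\<^sub>R h x))"
      using h unfolding set_integrable_def by (rule integrable_of_real)
    then show ?thesis unfolding set_integrable_def by (simp add: scaleR_conv_of_real)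
  qed
  (* The exchange of integrals for real functions, obtained from the complex version. *)
  have fub: "integral {0..T} (\<lambda>x. e x * H x) = integral {0..T} (\<lambda>s. integral {s..T} e * h s)"
    if e: "continuous_on UNIV e" for e
  proof -
    have Hx: "integral {0..x} (\<lambda>x. complex_of_real (h x)) = of_real (H x)" if "x \<in> {0..T}" for x
    proof -
      have "h integrable_on {0..x}" by (rule integrable_on_subinterval[OF hi]) (use that in auto)
      from integral_linear[OF this bounded_linear_of_real[where 'a = complex]] show ?thesis by (simp add: o_def H_def)
    qed
    have eH: "(\<lambda>x. e x * H x) integrable_on {0..T}"
      by (intro integrable_continuous_interval continuous_intros Hc continuous_on_subset[OF e]) auto
    have "set_integrable lborel {0..T} (\<lambda>s. (integral {0..T} e - integral {0..s} e) * h s)"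
    proof -
      have c: "continuous_on UNIV (\<lambda>s. integral {0..T} e - integral {0..max 0 (min T s)} e)"
      proof -
        have "continuous_on {0..T} (\<lambda>s. integral {0..s} e)"
          by (intro indefinite_integral_continuous_1 integrable_continuous_interval continuous_on_subset[OF e]) auto
        then have "continuous_on UNIV (\<lambda>s. integral {0..max 0 (min T s)} e)"
          by (rule continuous_on_compose2) (use T in \<open>auto intro!: continuous_intros\<close>)
        then show ?thesis by (intro continuous_intros)
      qed
      have "integrable lborel (\<lambda>x. Re (indicat_real {0..T} x *\<^sub>R ((integral {0..T} e - integral {0..max 0 (min T x)} e) *\<^sub>R complex_of_real (h x))))"
        by (rule integrable_Re) (use set_integrable_cont_mult[OF hC c] in \<open>simp only: set_integrable_def\<close>)
      then have *: "set_integrable lborel {0..T} (\<lambda>x. (integral {0..T} e - integral {0..max 0 (min T x)} e) * h x)"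
        by (simp add: set_integrable_def mult.assoc)
      have "indicat_real {0..T} x *\<^sub>R ((integral {0..T} e - integral {0..max 0 (min T x)} e) * h x)
          = indicat_real {0..T} x *\<^sub>R ((integral {0..T} e - integral {0..x} e) * h x)" for x
        by (cases "x \<in> {0..T}") (auto simp: max_def min_def)
      with * show ?thesis by (simp only: set_integrable_def)
    qed
    from set_borel_integral_eq_integral(1)[OF this]
    have 1: "(\<lambda>s. (integral {0..T} e - integral {0..s} e) * h s) integrable_on {0..T}" .
    have eI: "integral {s..T} e = integral {0..T} e - integral {0..s} e" if "s \<in> {0..T}" for s
    proof -
      have "integral {0..s} e + integral {s..T} e = integral {0..T} e"
        using that by (intro Henstock_Kurzweil_Integration.integral_combine integrable_continuous_interval continuous_on_subset[OF e]) auto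
      then show ?thesis by simp
    qed
    have eh: "(\<lambda>s. integral {s..T} e * h s) integrable_on {0..T}"
      by (rule integrable_eq[OF 1], subst eI) auto
    have "of_real (integral {0..T} (\<lambda>x. e x * H x)) = integral {0..T} (\<lambda>x. complex_of_real (e x * H x))"
      using integral_linear[OF eH bounded_linear_of_real[where 'a = complex]] by (simp add: o_def)
    also have "\<dots> = integral {0..T} (\<lambda>x. e x *\<^sub>R integral {0..x} (\<lambda>x. complex_of_real (h x)))"
      by (intro integral_cong) (simp add: Hx scaleR_conv_of_real)
    also have "\<dots> = integral {0..T} (\<lambda>s. integral {s..T} e *\<^sub>R complex_of_real (h s))"
      using T by (intro fubini_triangle[OF hC e]) simp
    also have "\<dots> = integral {0..T} (\<lambda>s. complex_of_real (integral {s..T} e * h s))"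
      by (simp add: scaleR_conv_of_real)
    also have "\<dots> = of_real (integral {0..T} (\<lambda>s. integral {s..T} e * h s))"
      using integral_linear[OF eh bounded_linear_of_real[where 'a = complex]] by (simp add: o_def)
    finally show ?thesis by simp
  qed
  have cosk: "integral {0..T} (\<lambda>x. cos (real n * (pi * x / T)) * k x) = 0" for n
  proof (cases "n = 0")
    case True
    have "integral {0..T} (\<lambda>x. H x - m) = integral {0..T} H - integral {0..T} (\<lambda>x. m)"
      by (intro integral_diff integrable_continuous_interval Hc continuous_intros)
    then show ?thesis using True T by (simp add: k_def m_def)
  next
    case False
    define a where "a = real n * pi / T"
    have a: "a > 0" using False T by (simp add: a_def)
    have aT: "sin (a * T) = 0" using T by (simp add: a_def sin_npi mult.commute)
    have e: "integral {s..T} (\<lambda>x. a * cos (a * x)) = - sin (a * s)" if "s \<le> T" for s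
      using integral_cos_linear[OF that, of a] aT by simp
    have "integral {0..T} (\<lambda>x. (a * cos (a * x)) * H x) = integral {0..T} (\<lambda>s. - sin (a * s) * h s)"
    proof -
      have "integral {0..T} (\<lambda>x. (a * cos (a * x)) * H x) = integral {0..T} (\<lambda>s. integral {s..T} (\<lambda>x. a * cos (a * x)) * h s)"
        by (rule fub) (intro continuous_intros)
      also have "\<dots> = integral {0..T} (\<lambda>s. - sin (a * s) * h s)" by (rule integral_cong) (subst e, auto)
      finally show ?thesis .
    qed
    also have "\<dots> = - integral {0..T} (\<lambda>s. sin (real n * (pi * s / T)) * h s)"
    proof -
      have "a * s = real n * (pi * s / T)" for s by (simp add: a_def)
      then show ?thesis by (simp only: mult_minus_left integral_neg)
    qed
    also have "\<dots> = 0" by (simp only: orth minus_zero)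
    finally have 1: "integral {0..T} (\<lambda>x. (a * cos (a * x)) * H x) = 0" .
    have "((\<lambda>x. (a * cos (a * x)) * H x - m * (a * cos (a * x))) has_integral 0 - m * 0) {0..T}"
    proof (intro has_integral_diff has_integral_mult_right)
      have "(\<lambda>x. (a * cos (a * x)) * H x) integrable_on {0..T}"
        by (intro integrable_continuous_interval continuous_intros Hc)
      from integrable_integral[OF this] show "((\<lambda>x. (a * cos (a * x)) * H x) has_integral 0) {0..T}"
        unfolding 1 .
      have "(\<lambda>x. a * cos (a * x)) integrable_on {0..T}" by (intro integrable_continuous_interval continuous_intros)
      moreover have "integral {0..T} (\<lambda>x. a * cos (a * x)) = 0" using T by (subst e) auto
      ultimately show "((\<lambda>x. a * cos (a * x)) has_integral 0) {0..T}"
        using integrable_integral by metis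
    qed
    then have "((\<lambda>x. a * (cos (real n * (pi * x / T)) * k x)) has_integral 0) {0..T}"
      by (simp add: k_def a_def algebra_simps)
    then have "integral {0..T} (\<lambda>x. a * (cos (real n * (pi * x / T)) * k x)) = 0" by (rule integral_unique)
    then show ?thesis using a by simp
  qed
  have k0: "k x = 0" if "x \<in> {0..T}" for x
    by (rule cosine_complete_continuous[OF T kc cosk that])
  have "m = 0" using k0[of 0] T by (simp add: k_def H_def)
  then show "integral {0..x} h = 0" if "x \<in> {0..T}" using k0[OF that] by (simp add: k_def H_def)
qed

lemma sine_complete:
  fixes h :: "real \<Rightarrow> complex"
  assumes T: "T > 0" and h: "set_integrable lborel {0..T} h"
    and orth: "\<And>n::nat. integral {0..T} (\<lambda>x. sin (real n * (pi * x / T)) *\<^sub>R h x) = 0"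
  shows "AE x in lborel. x \<in> {0..T} \<longrightarrow> h x = 0"
proof -
  have hi: "h integrable_on {0..T}" by (rule set_borel_integral_eq_integral(1)[OF h])
  have sub: "h integrable_on {0..x}" if "x \<in> {0..T}" for x
    by (rule integrable_on_subinterval[OF hi]) (use that in auto)
  have hI: "integrable lborel (\<lambda>x. indicat_real {0..T} x *\<^sub>R h x)" using h by (simp only: set_integrable_def)
  have ReIm: "set_integrable lborel {0..T} (\<lambda>x. Re (h x))" "set_integrable lborel {0..T} (\<lambda>x. Im (h x))"
    using integrable_Re[OF hI] integrable_Im[OF hI] by (simp_all only: set_integrable_def scaleR_complex.sel real_scaleR_def)
  have si: "(\<lambda>x. sin (real n * (pi * x / T)) *\<^sub>R h x) integrable_on {0..T}" for n
    by (rule set_borel_integral_eq_integral(1), rule set_integrable_cont_mult[OF h])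
      (use T in \<open>auto intro!: continuous_intros\<close>)
  have "integral {0..x} h = 0" if x: "x \<in> {0..T}" for x
  proof (rule complex_eqI)
    have "integral {0..x} (\<lambda>x. Re (h x)) = 0"
    proof (rule sine_complete_real[OF T ReIm(1) _ x])
      show "integral {0..T} (\<lambda>x. sin (real n * (pi * x / T)) * Re (h x)) = 0" for n
        using integral_linear[OF si[of n] bounded_linear_Re] by (simp only: o_def orth scaleR_complex.sel(1) zero_complex.sel(1))
    qed
    then show "Re (integral {0..x} h) = Re 0"
      using integral_linear[OF sub[OF x] bounded_linear_Re] by (simp only: o_def zero_complex.sel)
    have "integral {0..x} (\<lambda>x. Im (h x)) = 0"
    proof (rule sine_complete_real[OF T ReIm(2) _ x])
      show "integral {0..T} (\<lambda>x. sin (real n * (pi * x / T)) * Im (h x)) = 0" for n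
        using integral_linear[OF si[of n] bounded_linear_Im] by (simp only: o_def orth scaleR_complex.sel(2) zero_complex.sel(2))
    qed
    then show "Im (integral {0..x} h) = Im 0"
      using integral_linear[OF sub[OF x] bounded_linear_Im] by (simp only: o_def zero_complex.sel)
  qed
  then show ?thesis by (rule AE_zero_of_integral_zero[OF hi])
qed

section \<open>Second derivatives through sine coefficients\<close>

definition sine_coeff :: "real \<Rightarrow> (real \<Rightarrow> complex) \<Rightarrow> int \<Rightarrow> complex" where
  "sine_coeff T f n = integral {0..T} (\<lambda>x. sin (of_int n * (pi * x / T)) *\<^sub>R f x)"

text \<open>The solution of \<open>f'' = g\<close> with \<open>f(0) = f'(0) = 0\<close>.\<close>

definition green :: "(real \<Rightarrow> complex) \<Rightarrow> real \<Rightarrow> complex" where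
  "green g x = integral {0..x} (\<lambda>s. (x - s) *\<^sub>R g s)"

lemma green_deriv:
  assumes T: "T > 0" and g: "set_integrable lborel {0..T} g" and x: "x \<in> {0..T}"
  shows "(green g has_vector_derivative integral {0..x} g) (at x within {0..T})"
proof -
  have gi: "g integrable_on {0..T}" by (rule set_borel_integral_eq_integral(1)[OF g])
  have c: "continuous_on {0..T} (\<lambda>x. integral {0..x} g)" by (rule indefinite_integral_continuous_1[OF gi])
  have eq: "green g x = integral {0..x} (\<lambda>y. integral {0..y} g)" if x: "x \<in> {0..T}" for x
  proof -
    have "set_integrable lborel {0..x} g" by (rule set_integrable_subset[OF g]) (use x in auto)
    then have "integral {0..x} (\<lambda>y. 1 *\<^sub>R integral {0..y} g) = integral {0..x} (\<lambda>s. integral {s..x} (\<lambda>_. 1) *\<^sub>R g s)"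
      using x by (intro fubini_triangle continuous_intros) auto
    also have "\<dots> = green g x" unfolding green_def by (intro integral_cong) auto
    finally show ?thesis by simp
  qed
  have "((\<lambda>x. integral {0..x} (\<lambda>y. integral {0..y} g)) has_vector_derivative integral {0..x} g) (at x within {0..T})"
    by (rule integral_has_vector_derivative[OF c x])
  then show ?thesis by (rule has_vector_derivative_transform[OF x, rotated]) (simp add: eq)
qed

text \<open>Two integrations by parts. The boundary terms vanish because the sines and \<open>f\<close> vanish at both ends.\<close>

lemma sine_coeff_green:
  assumes T: "T > 0" and g: "set_integrable lborel {0..T} g"
    and f: "\<And>x. x \<in> {0..T} \<Longrightarrow> f x = x *\<^sub>R p + green g x" and fT: "f T = 0"
  shows "sine_coeff T g n = - ((of_int n * pi / T)\<^sup>2 *\<^sub>R sine_coeff T f n)"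
proof -
  define a where "a = of_int n * pi / T"
  define G where "G = (\<lambda>x. p + integral {0..x} g)"
  have gi: "g integrable_on {0..T}" by (rule set_borel_integral_eq_integral(1)[OF g])
  have cI: "continuous_on {0..T} (\<lambda>x. integral {0..x} g)" by (rule indefinite_integral_continuous_1[OF gi])
  have cG: "continuous_on {0..T} G" unfolding G_def by (intro continuous_intros cI)
  have df: "(f has_vector_derivative G x) (at x within {0..T})" if x: "x \<in> {0..T}" for x
  proof -
    have "((\<lambda>x. x *\<^sub>R p + green g x) has_vector_derivative G x) (at x within {0..T})"
      unfolding G_def by (intro has_vector_derivative_add green_deriv[OF T g x]) (auto intro!: derivative_eq_intros)
    then show ?thesis by (rule has_vector_derivative_transform[OF x, rotated]) (simp add: f)
  qed
  have cf: "continuous_on {0..T} f" by (rule continuous_on_vector_derivative[OF df])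
  have f0: "f 0 = 0" using f[of 0] T by (simp add: green_def)
  have aT: "sin (a * T) = 0" using T by (simp add: a_def sin_zero_iff_int2 mult.commute)
  have sa: "of_int n * (pi * x / T) = a * x" for x by (simp add: a_def)
  have e: "integral {s..T} (\<lambda>x. a * cos (a * x)) = - sin (a * s)" if "s \<le> T" for s
    using integral_cos_linear[OF that, of a] aT by simp
  have "integral {0..T} (\<lambda>x. (a * cos (a * x)) *\<^sub>R integral {0..x} g) = integral {0..T} (\<lambda>s. integral {s..T} (\<lambda>x. a * cos (a * x)) *\<^sub>R g s)"
    using T by (intro fubini_triangle[OF g] continuous_intros) auto
  also have "\<dots> = integral {0..T} (\<lambda>s. - (sin (a * s) *\<^sub>R g s))"
    by (rule integral_cong) (subst e, auto)
  also have "\<dots> = - sine_coeff T g n" by (simp only: sine_coeff_def sa integral_neg)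
  finally have 1: "integral {0..T} (\<lambda>x. (a * cos (a * x)) *\<^sub>R integral {0..x} g) = - sine_coeff T g n" .
  have "((\<lambda>x. (a * cos (a * x)) *\<^sub>R integral {0..x} g + (a * cos (a * x)) *\<^sub>R p) has_integral - sine_coeff T g n + 0) {0..T}"
  proof (rule has_integral_add)
    have "(\<lambda>x. (a * cos (a * x)) *\<^sub>R integral {0..x} g) integrable_on {0..T}"
      by (intro integrable_continuous_interval continuous_intros cI)
    from integrable_integral[OF this]
    show "((\<lambda>x. (a * cos (a * x)) *\<^sub>R integral {0..x} g) has_integral - sine_coeff T g n) {0..T}"
      unfolding 1 .
    have "((\<lambda>x. (a * cos (a * x)) *\<^sub>R p) has_integral (sin (a * T) *\<^sub>R p - sin (a * 0) *\<^sub>R p)) {0..T}"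
      using T by (intro fundamental_theorem_of_calculus) (auto intro!: derivative_eq_intros)
    then show "((\<lambda>x. (a * cos (a * x)) *\<^sub>R p) has_integral 0) {0..T}" using aT by simp
  qed
  then have 2: "((\<lambda>x. a *\<^sub>R (cos (a * x) *\<^sub>R G x)) has_integral - sine_coeff T g n) {0..T}"
    by (simp add: G_def scaleR_add_right add.commute)
  have 3: "((\<lambda>x. cos (a * x) *\<^sub>R G x + (- a * sin (a * x)) *\<^sub>R f x) has_integral (cos (a * T) *\<^sub>R f T - cos (a * 0) *\<^sub>R f 0)) {0..T}"
    using T by (intro fundamental_theorem_of_calculus has_vector_derivative_scaleR df) (auto intro!: derivative_eq_intros)
  have 4: "((\<lambda>x. (a * a) *\<^sub>R (sin (a * x) *\<^sub>R f x)) has_integral (a * a) *\<^sub>R sine_coeff T f n) {0..T}"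
    unfolding sine_coeff_def sa
    by (intro has_integral_cmul integrable_integral integrable_continuous_interval continuous_intros cf)
  have "((\<lambda>x. a *\<^sub>R (cos (a * x) *\<^sub>R G x + (- a * sin (a * x)) *\<^sub>R f x) + (a * a) *\<^sub>R (sin (a * x) *\<^sub>R f x))
      has_integral (a *\<^sub>R (cos (a * T) *\<^sub>R f T - cos (a * 0) *\<^sub>R f 0) + (a * a) *\<^sub>R sine_coeff T f n)) {0..T}"
    by (intro has_integral_add has_integral_cmul 3 4)
  then have "((\<lambda>x. a *\<^sub>R (cos (a * x) *\<^sub>R G x)) has_integral ((a * a) *\<^sub>R sine_coeff T f n)) {0..T}"
    by (simp add: f0 fT algebra_simps)
  from has_integral_unique[OF this 2] show ?thesis by (simp add: a_def power2_eq_square)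
qed

text \<open>If the sine coefficients of \<open>g\<close> are those of a second derivative of \<open>f\<close>, then \<open>f\<close> has the same sine coefficients as
  the solution \<open>h\<close> of \<open>h'' = g\<close> with Dirichlet conditions; by completeness they agree. In particular the boundary
  condition at \<open>T\<close> comes for free.\<close>

lemma green_representation:
  assumes T: "T > 0" and f: "set_integrable lborel {0..T} f" and g: "set_integrable lborel {0..T} g"
    and rel: "\<And>n::int. sine_coeff T g n = - ((of_int n * pi / T)\<^sup>2 *\<^sub>R sine_coeff T f n)"
  obtains p where "AE x in lborel. x \<in> {0..T} \<longrightarrow> f x = x *\<^sub>R p + green g x" "T *\<^sub>R p + green g T = 0"
proof -
  define p where "p = - (1 / T) *\<^sub>R green g T"
  define h where "h = (\<lambda>x. x *\<^sub>R p + green g x)"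
  have hT: "h T = 0" using T by (simp add: h_def p_def)
  have ch: "continuous_on {0..T} h"
    unfolding h_def using continuous_on_vector_derivative[OF green_deriv[OF T g]] by (intro continuous_intros)
  have hi: "set_integrable lborel {0..T} h" by (rule borel_integrable_atLeastAtMost'[OF ch])
  have "sine_coeff T f (int n) = sine_coeff T h (int n)" if "n \<noteq> 0" for n :: nat
  proof -
    have "sine_coeff T g (int n) = - ((of_int (int n) * pi / T)\<^sup>2 *\<^sub>R sine_coeff T h (int n))"
      by (rule sine_coeff_green[where f = h and p = p, OF T g _ hT]) (simp add: h_def)
    with rel[of "int n"] show ?thesis using that T by simp
  qed
  moreover have "sine_coeff T f 0 = sine_coeff T h 0" by (simp add: sine_coeff_def)
  ultimately have eq: "sine_coeff T f (int n) = sine_coeff T h (int n)" for n :: nat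
    by (cases "n = 0") auto
  have cs: "continuous_on UNIV (\<lambda>x. sin (real n * (pi * x / T)))" for n using T by (intro continuous_intros) auto
  have "AE x in lborel. x \<in> {0..T} \<longrightarrow> f x - h x = 0"
  proof (rule sine_complete[OF T set_integral_diff(1)[OF f hi]])
    fix n :: nat
    have "integral {0..T} (\<lambda>x. sin (real n * (pi * x / T)) *\<^sub>R (f x - h x))
        = sine_coeff T f (int n) - sine_coeff T h (int n)"
      unfolding sine_coeff_def scaleR_diff_right of_int_of_nat_eq
      by (intro integral_diff set_borel_integral_eq_integral(1) set_integrable_cont_mult f hi cs)
    then show "integral {0..T} (\<lambda>x. sin (real n * (pi * x / T)) *\<^sub>R (f x - h x)) = 0" using eq by simp
  qed
  then show ?thesis using that[of p] hT by (auto simp: h_def)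
qed

section \<open>Square-integrable periodic functions\<close>

lemma integral_AE_cong:
  fixes f g :: "real \<Rightarrow> 'a::euclidean_space"
  assumes "AE x in lborel. x \<in> S \<longrightarrow> f x = g x"
  shows "integral S f = integral S g"
proof -
  have "AE x in lebesgue. x \<in> S \<longrightarrow> f x = g x" using assms by (rule AE_completion)
  then have "{x. \<not> (x \<in> S \<longrightarrow> f x = g x)} \<in> null_sets lebesgue"
    by (simp add: completion.AE_iff_null_sets)
  then have "negligible {x. \<not> (x \<in> S \<longrightarrow> f x = g x)}" by (simp add: negligible_iff_null_sets)
  then show ?thesis by (rule integral_spike) auto
qed

lemma L2_per_mult:
  assumes f: "f \<in> L2_per L" and b: "b \<in> borel_measurable borel" "\<And>x. b (x + L) = b x" "\<And>x. norm (b x) \<le> C"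
  shows "(\<lambda>x. b x * f x) \<in> L2_per L"
proof -
  have fm [measurable]: "f \<in> borel_measurable borel" and fi: "set_integrable lborel {0..L} (\<lambda>x. (cmod (f x))\<^sup>2)"
    and fp: "\<And>x. f (x + L) = f x" using f by (auto simp: L2_per_def)
  have bm [measurable]: "b \<in> borel_measurable borel" by (rule b)
  have "set_integrable lborel {0..L} (\<lambda>x. (cmod (b x * f x))\<^sup>2)"
    unfolding set_integrable_def
  proof (rule Bochner_Integration.integrable_bound)
    show "integrable lborel (\<lambda>x. C\<^sup>2 *\<^sub>R (indicat_real {0..L} x *\<^sub>R (cmod (f x))\<^sup>2))"
      using fi unfolding set_integrable_def by (rule integrable_scaleR_right)
    have "norm (indicat_real {0..L} x *\<^sub>R (cmod (b x * f x))\<^sup>2) \<le> norm (C\<^sup>2 *\<^sub>R (indicat_real {0..L} x *\<^sub>R (cmod (f x))\<^sup>2))" for x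
    proof -
      have "(cmod (b x))\<^sup>2 \<le> C\<^sup>2" using b(3) by (intro power_mono) auto
      then show ?thesis by (auto simp: indicator_def norm_mult power_mult_distrib intro!: mult_right_mono)
    qed
    then show "AE x in lborel. norm (indicat_real {0..L} x *\<^sub>R (cmod (b x * f x))\<^sup>2) \<le> norm (C\<^sup>2 *\<^sub>R (indicat_real {0..L} x *\<^sub>R (cmod (f x))\<^sup>2))" by simp
  qed measurable
  then show ?thesis using b(2) fp by (simp add: L2_per_def)
qed

lemma L2_per_add:
  assumes f: "f \<in> L2_per L" and g: "g \<in> L2_per L"
  shows "(\<lambda>x. f x + g x) \<in> L2_per L"
proof -
  have fm [measurable]: "f \<in> borel_measurable borel" and fi: "set_integrable lborel {0..L} (\<lambda>x. (cmod (f x))\<^sup>2)"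
    and fp: "\<And>x. f (x + L) = f x" using f by (auto simp: L2_per_def)
  have gm [measurable]: "g \<in> borel_measurable borel" and gi: "set_integrable lborel {0..L} (\<lambda>x. (cmod (g x))\<^sup>2)"
    and gp: "\<And>x. g (x + L) = g x" using g by (auto simp: L2_per_def)
  have "set_integrable lborel {0..L} (\<lambda>x. (cmod (f x + g x))\<^sup>2)"
    unfolding set_integrable_def
  proof (rule Bochner_Integration.integrable_bound)
    show "integrable lborel (\<lambda>x. 2 *\<^sub>R (indicat_real {0..L} x *\<^sub>R (cmod (f x))\<^sup>2) + 2 *\<^sub>R (indicat_real {0..L} x *\<^sub>R (cmod (g x))\<^sup>2))"
      using fi gi unfolding set_integrable_def by (intro Bochner_Integration.integrable_add integrable_scaleR_right)
    have "norm (indicat_real {0..L} x *\<^sub>R (cmod (f x + g x))\<^sup>2) \<le> norm (2 *\<^sub>R (indicat_real {0..L} x *\<^sub>R (cmod (f x))\<^sup>2) + 2 *\<^sub>R (indicat_real {0..L} x *\<^sub>R (cmod (g x))\<^sup>2))" for x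
    proof -
      have "(cmod (f x + g x))\<^sup>2 \<le> (cmod (f x) + cmod (g x))\<^sup>2" by (intro power_mono norm_triangle_ineq) auto
      also have "\<dots> \<le> 2 * (cmod (f x))\<^sup>2 + 2 * (cmod (g x))\<^sup>2"
        using sum_squares_bound[of "cmod (f x)" "cmod (g x)"] by (simp add: power2_sum)
      finally show ?thesis by (auto simp: indicator_def)
    qed
    then show "AE x in lborel. norm (indicat_real {0..L} x *\<^sub>R (cmod (f x + g x))\<^sup>2) \<le> norm (2 *\<^sub>R (indicat_real {0..L} x *\<^sub>R (cmod (f x))\<^sup>2) + 2 *\<^sub>R (indicat_real {0..L} x *\<^sub>R (cmod (g x))\<^sup>2))" by simp
  qed measurable
  then show ?thesis using fp gp by (simp add: L2_per_def)
qed

lemma L2_per_const_mult: "f \<in> L2_per L \<Longrightarrow> (\<lambda>x. c * f x) \<in> L2_per L"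
  by (rule L2_per_mult[where C = "norm c"]) auto

lemma L2_per_diff: "f \<in> L2_per L \<Longrightarrow> g \<in> L2_per L \<Longrightarrow> (\<lambda>x. f x - g x) \<in> L2_per L"
  using L2_per_add[of f L "\<lambda>x. (-1) * g x"] L2_per_const_mult[of g L "-1"] by simp

lemma L2_per_sum: "(\<And>i. i \<in> I \<Longrightarrow> f i \<in> L2_per L) \<Longrightarrow> (\<lambda>x. \<Sum>i\<in>I. f i x) \<in> L2_per L"
proof (induction I rule: infinite_finite_induct)
  case (insert i I)
  then show ?case by (simp add: L2_per_add)
qed (simp_all add: L2_per_def set_integrable_def)

lemma L2_per_integrable:
  assumes f: "f \<in> L2_per L" shows "set_integrable lborel {0..L} f"
proof -
  have fm [measurable]: "f \<in> borel_measurable borel" and fi: "set_integrable lborel {0..L} (\<lambda>x. (cmod (f x))\<^sup>2)"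
    using f by (auto simp: L2_per_def)
  show ?thesis unfolding set_integrable_def
  proof (rule Bochner_Integration.integrable_bound)
    show "integrable lborel (\<lambda>x. indicat_real {0..L} x + indicat_real {0..L} x *\<^sub>R (cmod (f x))\<^sup>2)"
      using fi unfolding set_integrable_def by (intro Bochner_Integration.integrable_add integrable_real_indicator) (simp_all add: emeasure_lborel_Icc_eq)
    have "norm (indicat_real {0..L} x *\<^sub>R f x) \<le> norm (indicat_real {0..L} x + indicat_real {0..L} x *\<^sub>R (cmod (f x))\<^sup>2)" for x
    proof -
      have "0 \<le> (cmod (f x) - 1)\<^sup>2" by simp
      then have "2 * cmod (f x) \<le> 1 + (cmod (f x))\<^sup>2" by (simp add: power2_diff)
      moreover have "cmod (f x) \<ge> 0" by simp
      ultimately have "cmod (f x) \<le> 1 + (cmod (f x))\<^sup>2" by linarith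
      then show ?thesis by (auto simp: indicator_def)
    qed
    then show "AE x in lborel. norm (indicat_real {0..L} x *\<^sub>R f x) \<le> norm (indicat_real {0..L} x + indicat_real {0..L} x *\<^sub>R (cmod (f x))\<^sup>2)" by simp
  qed measurable
qed

text \<open>The exponential in \<open>fourier_coeff\<close>, written so that its modulus is visible.\<close>

definition fmode :: "real \<Rightarrow> int \<Rightarrow> real \<Rightarrow> complex" where
  "fmode L n x = cis (- (2 * pi * of_int n * x / L))"

lemma fmode_eq: "exp (- (2 * complex_of_real pi * \<i> * of_int n * complex_of_real x / complex_of_real L)) = fmode L n x"
  by (simp add: fmode_def cis_conv_exp mult_ac)

lemma fmode_continuous: "continuous_on S (fmode L n)"
proof -
  have "fmode L n = (\<lambda>x. cis (- (2 * pi * of_int n / L) * x))" by (auto simp: fmode_def)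
  then show ?thesis by (simp only:) (intro continuous_intros)
qed

lemma norm_fmode [simp]: "cmod (fmode L n x) = 1"
  by (simp add: fmode_def)

lemma fourier_coeff_has_integral:
  assumes L: "L > 0" and f: "f \<in> L2_per L"
  shows "((\<lambda>x. f x * fmode L n x) has_integral of_real L * fourier_coeff L f n) {0..L}"
proof -
  have fm [measurable]: "f \<in> borel_measurable borel" using f by (auto simp: L2_per_def)
  have em [measurable]: "fmode L n \<in> borel_measurable borel"
    by (rule borel_measurable_continuous_onI[OF fmode_continuous])
  have i: "set_integrable lborel {0..L} (\<lambda>x. f x * fmode L n x)"
    unfolding set_integrable_def
    by (rule Bochner_Integration.integrable_bound[OF L2_per_integrable[OF f, unfolded set_integrable_def]])
       (auto simp: norm_mult)
  have "fourier_coeff L f n = 1 / of_real L * (LINT x:{0..L}|lborel. f x * fmode L n x)"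
    by (simp add: fourier_coeff_def fmode_eq)
  then have "integral {0..L} (\<lambda>x. f x * fmode L n x) = of_real L * fourier_coeff L f n"
    using L set_borel_integral_eq_integral(2)[OF i] by simp
  then show ?thesis using set_borel_integral_eq_integral(1)[OF i] by (metis integrable_integral)
qed

lemma fourier_coeff_AE_cong:
  assumes "f \<in> borel_measurable borel" "g \<in> borel_measurable borel" "AE x in lborel. f x = g x"
  shows "fourier_coeff L f n = fourier_coeff L g n"
proof -
  have [measurable]: "f \<in> borel_measurable borel" "g \<in> borel_measurable borel" by (fact assms)+
  have em [measurable]: "fmode L n \<in> borel_measurable borel"
    by (rule borel_measurable_continuous_onI[OF fmode_continuous])
  have "(LINT x:{0..L}|lborel. f x * fmode L n x) = (LINT x:{0..L}|lborel. g x * fmode L n x)"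
    unfolding set_lebesgue_integral_def
    by (rule integral_cong_AE) (use assms(3) in \<open>auto elim: eventually_mono\<close>)
  then show ?thesis by (simp add: fourier_coeff_def fmode_eq)
qed

lemma has_integral_reflect_interval:
  fixes g :: "real \<Rightarrow> 'a::euclidean_space"
  assumes "(g has_integral I) {a..b}" "a \<le> b"
  shows "((\<lambda>x. g (c - x)) has_integral I) {c - b..c - a}"
  using has_integral_affinity[of g I a b "-1" c] assms by (simp add: image_affinity_atLeastAtMost_diff)

lemma fmode_reflect: "L > 0 \<Longrightarrow> fmode L n (L - x) = cnj (fmode L n x)"
proof -
  assume L: "L > 0"
  have "- (2 * pi * of_int n * (L - x) / L) = 2 * pi * of_int n * x / L - 2 * pi * of_int n"
    using L by (simp add: field_simps)
  then have "fmode L n (L - x) = cis (2 * pi * of_int n * x / L) / cis (2 * pi * of_int n)"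
    by (simp only: fmode_def cis_divide)
  also have "cis (2 * pi * of_int n) = 1"
    by (metis cis_multiple_2pi Ints_of_int)
  finally show ?thesis by (simp add: fmode_def cis_cnj)
qed

text \<open>Adding the integral to its reflection under \<open>x \<mapsto> L - x\<close> leaves only the sine part, whose integrand is symmetric
  about \<open>L/2\<close>. With \<open>T = L/2\<close> these are exactly the sines adapted to the Dirichlet problem on \<open>[0, T]\<close>.\<close>

lemma odd_fourier_coeff:
  assumes L: "L > 0" and f: "f \<in> L2_per L" and odd: "\<And>x. f (- x) = - f x"
  shows "of_real L * fourier_coeff L f n
    = - 2 * \<i> * integral {0..L / 2} (\<lambda>x. sin (of_int n * (pi * x / (L / 2))) *\<^sub>R f x)"
proof -
  define c where "c = of_real L * fourier_coeff L f n"
  define s where "s = (\<lambda>x. sin (of_int n * (pi * x / (L / 2))))"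
  have per: "f (x + L) = f x" for x using f by (auto simp: L2_per_def)
  have refl: "f (L - x) = - f x" for x using odd[of x] per[of "- x"] by simp
  note 1 = fourier_coeff_has_integral[OF L f, of n, folded c_def]
  have 2: "((\<lambda>x. f (L - x) * fmode L n (L - x)) has_integral c) {0..L}"
    using has_integral_reflect_interval[OF 1, of L] L by simp
  have "((\<lambda>x. f x * fmode L n x + f (L - x) * fmode L n (L - x)) has_integral c + c) {0..L}"
    by (rule has_integral_add[OF 1 2])
  moreover have "f x * fmode L n x + f (L - x) * fmode L n (L - x) = (- 2 * \<i>) * (s x *\<^sub>R f x)" for x
  proof -
    have "fmode L n x - cnj (fmode L n x) = - 2 * \<i> * of_real (s x)"
      by (simp add: fmode_def s_def complex_eq_iff mult_ac)
    then have "f x * (fmode L n x - cnj (fmode L n x)) = f x * (- 2 * \<i> * of_real (s x))" by simp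
    then show ?thesis unfolding fmode_reflect[OF L] refl by (simp add: scaleR_conv_of_real algebra_simps)
  qed
  ultimately have 3: "((\<lambda>x. (- 2 * \<i>) * (s x *\<^sub>R f x)) has_integral 2 * c) {0..L}" by simp
  define h where "h = (\<lambda>x. (- 2 * \<i>) * (s x *\<^sub>R f x))"
  have hsym: "h (L - x) = h x" for x
  proof -
    have "of_int n * (pi * (L - x) / (L / 2)) = 2 * pi * of_int n - of_int n * (pi * x / (L / 2))"
      using L by (simp add: field_simps)
    then have "s (L - x) = sin (2 * pi * of_int n - of_int n * (pi * x / (L / 2)))" by (simp only: s_def)
    also have "\<dots> = - s x" unfolding s_def sin_diff
      by (metis add.left_neutral diff_0 mult.commute mult.left_neutral mult_zero_left sin_int_2pin cos_int_2pin)
    finally show ?thesis by (simp add: h_def refl)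
  qed
  have hi: "h integrable_on {0..L}" using 3 by (auto simp: h_def)
  have h1: "h integrable_on {0..L / 2}" by (rule integrable_on_subinterval[OF hi]) (use L in auto)
  then have "(h has_integral integral {0..L / 2} h) {0..L / 2}" by (rule integrable_integral)
  from has_integral_reflect_interval[OF this, of L]
  have "((\<lambda>x. h (L - x)) has_integral integral {0..L / 2} h) {L / 2..L}" using L by simp
  then have "integral {L / 2..L} h = integral {0..L / 2} h" by (simp add: hsym integral_unique)
  moreover have "integral {0..L / 2} h + integral {L / 2..L} h = integral {0..L} h"
    by (rule Henstock_Kurzweil_Integration.integral_combine) (use L hi in auto)
  moreover have "integral {0..L} h = 2 * c" using 3 unfolding h_def[symmetric] by (rule integral_unique)
  ultimately have "c = integral {0..L / 2} h" by simp
  then show ?thesis by (simp only: c_def h_def integral_mult_right s_def)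
qed

lemma fmode_orthogonal:
  assumes L: "L > 0"
  shows "((\<lambda>x. cnj (fmode L n x) * fmode L m x) has_integral (if n = m then of_real L else 0)) {0..L}"
proof (cases "n = m")
  case True
  have "cnj (fmode L n x) * fmode L n x = 1" for x
    by (simp add: fmode_def cis_cnj cis_mult)
  then show ?thesis using True has_integral_const_real[of "1::complex" 0 L] L by (simp add: scaleR_conv_of_real)
next
  case False
  define a where "a = 2 * pi * of_int (n - m) / L"
  have a: "a \<noteq> 0" using False L by (simp add: a_def)
  have e: "cnj (fmode L n x) * fmode L m x = cis (a * x)" for x
  proof -
    have "cnj (fmode L n x) * fmode L m x = cis (2 * pi * of_int n * x / L) * cis (- (2 * pi * of_int m * x / L))"
      by (simp add: fmode_def cis_cnj)
    also have "\<dots> = cis (2 * pi * of_int n * x / L + - (2 * pi * of_int m * x / L))" by (simp only: cis_mult)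
    also have "2 * pi * of_int n * x / L + - (2 * pi * of_int m * x / L) = a * x"
      using L by (simp add: a_def field_simps)
    finally show ?thesis .
  qed
  have "((\<lambda>x. cis (a * x)) has_integral (cis (a * L) / (\<i> * a) - cis (a * 0) / (\<i> * a))) {0..L}"
  proof (rule fundamental_theorem_of_calculus)
    fix x
    have ii: "\<i> * (E * \<i>) = - E" for E by (simp add: complex_eq_iff)
    have "((\<lambda>x. cis (a * x) / (\<i> * a)) has_vector_derivative ((a *\<^sub>R (\<i> * cis (a * x))) / (\<i> * a))) (at x within {0..L})"
      unfolding cis_conv_exp
      by (auto intro!: derivative_eq_intros has_vector_derivative_real_field simp: scaleR_conv_of_real ii)
    then show "((\<lambda>x. cis (a * x) / (\<i> * a)) has_vector_derivative cis (a * x)) (at x within {0..L})"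
      using a by (simp add: scaleR_conv_of_real ii)
  qed (use L in simp)
  moreover have "cis (a * L) = 1"
  proof -
    have "a * L = 2 * pi * of_int (n - m)" using L by (simp add: a_def)
    then show ?thesis by (metis cis_multiple_2pi Ints_of_int)
  qed
  ultimately show ?thesis using False by (simp add: e)
qed

lemma bessel:
  assumes L: "L > 0" and f: "f \<in> L2_per L"
  shows "(\<lambda>n. (cmod (fourier_coeff L f n))\<^sup>2) summable_on UNIV"
proof (rule nonneg_bdd_above_summable_on)
  define I where "I = integral {0..L} (\<lambda>x. (cmod (f x))\<^sup>2)"
  define c where "c = fourier_coeff L f"
  have fi: "((\<lambda>x. (cmod (f x))\<^sup>2) has_integral I) {0..L}"
    unfolding I_def using f by (intro integrable_integral set_borel_integral_eq_integral(1)) (auto simp: L2_per_def)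
  show "bdd_above (sum (\<lambda>n. (cmod (fourier_coeff L f n))\<^sup>2) ` {F. F \<subseteq> UNIV \<and> finite F})"
  proof (rule bdd_aboveI2)
    fix F :: "int set" assume "F \<in> {F. F \<subseteq> UNIV \<and> finite F}"
    then have F: "finite F" by simp
    define N where "N = (\<Sum>n\<in>F. (cmod (c n))\<^sup>2)"
    (* Partial Fourier sum; the distance of f to it is nonnegative. *)
    define S where "S = (\<lambda>x. \<Sum>n\<in>F. c n * cnj (fmode L n x))"
    have "((\<lambda>x. \<Sum>n\<in>F. cnj (c n) * (f x * fmode L n x)) has_integral (\<Sum>n\<in>F. cnj (c n) * (of_real L * c n))) {0..L}"
      unfolding c_def by (intro has_integral_sum F has_integral_mult_right fourier_coeff_has_integral L f)
    moreover have "(\<Sum>n\<in>F. cnj (c n) * (of_real L * c n)) = of_real (L * N)"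
      unfolding N_def of_real_mult of_real_sum sum_distrib_left complex_norm_square by (simp add: mult_ac)
    moreover have "(\<Sum>n\<in>F. cnj (c n) * (f x * fmode L n x)) = f x * cnj (S x)" for x
      unfolding S_def cnj_sum sum_distrib_left by (simp add: mult_ac)
    ultimately have 1: "((\<lambda>x. f x * cnj (S x)) has_integral of_real (L * N)) {0..L}" by simp
    have "((\<lambda>x. \<Sum>n\<in>F. \<Sum>m\<in>F. (c n * cnj (c m)) * (cnj (fmode L n x) * fmode L m x)) has_integral
        (\<Sum>n\<in>F. \<Sum>m\<in>F. (c n * cnj (c m)) * (if n = m then of_real L else 0))) {0..L}"
      by (intro has_integral_sum F has_integral_mult_right fmode_orthogonal L)
    moreover have "(\<Sum>n\<in>F. \<Sum>m\<in>F. (c n * cnj (c m)) * (if n = m then of_real L else 0)) = complex_of_real (L * N)"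
      unfolding N_def of_real_mult of_real_sum sum_distrib_left complex_norm_square using F
      by (simp add: if_distrib[of "\<lambda>x. _ * x"] sum.delta cong: if_cong) (simp add: mult_ac)
    moreover have "(\<Sum>n\<in>F. \<Sum>m\<in>F. (c n * cnj (c m)) * (cnj (fmode L n x) * fmode L m x)) = S x * cnj (S x)" for x
      unfolding S_def cnj_sum sum_product by (simp add: mult_ac)
    ultimately have 2: "((\<lambda>x. S x * cnj (S x)) has_integral of_real (L * N)) {0..L}" by simp
    have r1: "((\<lambda>x. Re (f x * cnj (S x))) has_integral Re (of_real (L * N))) {0..L}"
      using has_integral_linear[OF 1 bounded_linear_Re] by (simp only: o_def)
    have r2: "((\<lambda>x. Re (S x * cnj (S x))) has_integral Re (of_real (L * N))) {0..L}"
      using has_integral_linear[OF 2 bounded_linear_Re] by (simp only: o_def)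
    have "((\<lambda>x. (cmod (f x))\<^sup>2 - 2 * Re (f x * cnj (S x)) + Re (S x * cnj (S x))) has_integral I - 2 * Re (of_real (L * N)) + Re (of_real (L * N))) {0..L}"
      by (intro has_integral_add has_integral_diff fi has_integral_mult_right r1 r2)
    moreover have "(cmod (f x))\<^sup>2 - 2 * Re (f x * cnj (S x)) + Re (S x * cnj (S x)) = (cmod (f x - S x))\<^sup>2" for x
      unfolding cmod_power2 by (simp add: power2_eq_square algebra_simps)
    ultimately have "((\<lambda>x. (cmod (f x - S x))\<^sup>2) has_integral I - L * N) {0..L}" by simp
    then have "0 \<le> I - L * N" by (rule has_integral_nonneg) simp
    then show "(\<Sum>n\<in>F. (cmod (fourier_coeff L f n))\<^sup>2) \<le> I / L"
      using L by (simp add: N_def c_def field_simps)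
  qed
qed auto

section \<open>Odd periodic extension\<close>

text \<open>The line is covered by countably many translated and reflected copies of the half period.\<close>

lemma AE_odd_periodic_extend:
  fixes L :: real and P :: "real \<Rightarrow> bool"
  assumes L: "L > 0" and Pm: "Measurable.pred borel P"
    and per: "\<And>x. P (x + L) = P x" and refl: "\<And>x. P (- x) = P x"
    and half: "AE x in lborel. x \<in> {0..L / 2} \<longrightarrow> P x"
  shows "AE x in lborel. P x"
proof -
  define Q where "Q = (\<lambda>x. x \<in> {0..L / 2} \<longrightarrow> P x)"
  note Pm [measurable]
  have Qm: "Measurable.pred borel Q" unfolding Q_def by measurable
  have QAE: "AE x in lborel. Q x" using half by (simp add: Q_def)
  have pern: "P (x + of_int n * L) = P x" for n x
  proof (induction n rule: int_induct[of _ 0])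
    case (step1 i)
    then show ?case using per[of "x + of_int i * L"] by (simp add: algebra_simps)
  next
    case (step2 i)
    then show ?case using per[of "x + of_int (i - 1) * L"] by (simp add: algebra_simps)
  qed simp
  have "AE x in lborel. Q (of_int n * L + 1 * x) \<and> Q (of_int n * L + (- 1) * x)" for n :: int
    using AE_borel_affine[OF _ Qm QAE, of 1 "of_int n * L"] AE_borel_affine[OF _ Qm QAE, of "-1" "of_int n * L"] by simp
  then have "AE x in lborel. \<forall>n::int. Q (of_int n * L + 1 * x) \<and> Q (of_int n * L + (- 1) * x)"
    by (simp add: AE_all_countable)
  then show ?thesis
  proof eventually_elim
    case (elim x)
    define n where "n = \<lfloor>x / L\<rfloor>"
    define y where "y = x - of_int n * L"
    have "of_int n \<le> x / L" "x / L < of_int n + 1" unfolding n_def by linarith+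
    then have y: "0 \<le> y" "y < L" using L by (simp_all add: y_def field_simps)
    have Py: "P y = P x" using pern[of y n] by (simp add: y_def)
    show ?case
    proof (cases "y \<le> L / 2")
      case True
      have "Q y" using elim[rule_format, of "- n"] by (simp add: y_def)
      then show ?thesis using True y Py by (simp add: Q_def)
    next
      case False
      have "Q (L - y)" using elim[rule_format, of "n + 1"] by (simp add: y_def algebra_simps)
      then have "P (L - y)" using False y by (simp add: Q_def)
      moreover have "P (L - y) = P y" using per[of "- y"] refl[of y] by simp
      ultimately show ?thesis using Py by simp
    qed
  qed
qed

text \<open>The argument is reduced to \<open>[- L/2, L/2)\<close>. The point \<open>L/2\<close> is thus represented by \<open>- L/2\<close>, and the values are
  consistent there only if \<open>f(L/2) = 0\<close>.\<close>

definition oddext :: "real \<Rightarrow> (real \<Rightarrow> complex) \<Rightarrow> real \<Rightarrow> complex" where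
  "oddext L f x = (let y = x - L * of_int \<lfloor>x / L + 1 / 2\<rfloor> in if 0 \<le> y then f y else - f (- y))"

lemma oddext_argument:
  assumes L: "L > 0"
  shows "- (L / 2) \<le> x - L * of_int \<lfloor>x / L + 1 / 2\<rfloor>" "x - L * of_int \<lfloor>x / L + 1 / 2\<rfloor> < L / 2"
proof -
  define n where "n = \<lfloor>x / L + 1 / 2\<rfloor>"
  have "of_int n \<le> x / L + 1 / 2" "x / L + 1 / 2 < of_int n + 1" unfolding n_def by linarith+
  then show "- (L / 2) \<le> x - L * of_int \<lfloor>x / L + 1 / 2\<rfloor>" "x - L * of_int \<lfloor>x / L + 1 / 2\<rfloor> < L / 2"
    unfolding n_def[symmetric] using L by (simp_all add: field_simps)
qed

lemma oddext_eq:
  assumes L: "L > 0" and f: "f (L / 2) = 0" and x: "x \<in> {0..L / 2}" shows "oddext L f x = f x"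
proof (cases "x = L / 2")
  case True
  then have "x / L + 1 / 2 = of_int 1" using L by (simp add: field_simps)
  then have F: "\<lfloor>x / L + 1 / 2\<rfloor> = 1" by (simp only: floor_of_int)
  have "oddext L f (L / 2) = - f (L / 2)" unfolding oddext_def Let_def F[unfolded True] using L by (simp add: field_simps)
  then show ?thesis using f unfolding True by simp
next
  case False
  then have "0 \<le> x / L" "x / L < 1 / 2" using x L by (auto simp: field_simps)
  then have "\<lfloor>x / L + 1 / 2\<rfloor> = 0" by linarith
  then show ?thesis using x by (simp add: oddext_def)
qed

lemma oddext_periodic:
  assumes L: "L > 0" shows "oddext L f (x + L) = oddext L f x"
proof -
  have "(x + L) / L + 1 / 2 = (x / L + 1 / 2) + of_int 1" using L by (simp add: field_simps)
  then have "\<lfloor>(x + L) / L + 1 / 2\<rfloor> = \<lfloor>x / L + 1 / 2\<rfloor> + 1" by (simp only: floor_add_int)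
  then have "x + L - L * of_int \<lfloor>(x + L) / L + 1 / 2\<rfloor> = x - L * of_int \<lfloor>x / L + 1 / 2\<rfloor>"
    by (simp add: algebra_simps)
  then show ?thesis unfolding oddext_def by presburger
qed

lemma oddext_odd:
  assumes L: "L > 0" and f: "f 0 = 0" "f (L / 2) = 0" shows "oddext L f (- x) = - oddext L f x"
proof -
  define n where "n = \<lfloor>x / L + 1 / 2\<rfloor>"
  define y where "y = x - L * of_int n"
  have "of_int n \<le> x / L + 1 / 2" "x / L + 1 / 2 < of_int n + 1" unfolding n_def by linarith+
  then have y: "- (L / 2) \<le> y" "y < L / 2" using L by (simp_all add: y_def field_simps)
  have ex: "oddext L f x = (if 0 \<le> y then f y else - f (- y))" by (simp add: oddext_def n_def[symmetric] y_def)
  show ?thesis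
  proof (cases "y = - (L / 2)")
    case True
    then have "x / L = of_int n - 1 / 2" using L by (simp add: y_def field_simps)
    then have "- x / L + 1 / 2 = of_int (1 - n)" by simp
    then have "\<lfloor>- x / L + 1 / 2\<rfloor> = 1 - n" by (metis floor_of_int)
    moreover have "- x - L * of_int (1 - n) = - (L / 2)" using True by (simp add: y_def algebra_simps)
    ultimately show ?thesis using L f True by (simp add: ex) (simp add: oddext_def Let_def)
  next
    case False
    then have "x / L > of_int n - 1 / 2" "x / L < of_int n + 1 / 2" using y L by (simp_all add: y_def field_simps)
    then have "\<lfloor>- x / L + 1 / 2\<rfloor> = - n" by (simp add: floor_eq_iff)
    moreover have "- x - L * of_int (- n) = - y" by (simp add: y_def)
    ultimately have "oddext L f (- x) = (if 0 \<le> - y then f (- y) else - f (- (- y)))"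
      by (simp only: oddext_def Let_def)
    then show ?thesis using f by (auto simp: ex)
  qed
qed

lemma oddext_measurable:
  assumes L: "L > 0" and f: "continuous_on {0..L / 2} f"
  shows "oddext L f \<in> borel_measurable borel"
proof -
  (* A continuous function on the whole line with the same odd extension. *)
  define g where "g = (\<lambda>x. f (max 0 (min (L / 2) x)))"
  have "continuous_on UNIV g" unfolding g_def
    by (rule continuous_on_compose2[OF f]) (use L in \<open>auto intro!: continuous_intros\<close>)
  then have gm [measurable]: "g \<in> borel_measurable borel" by (rule borel_measurable_continuous_onI)
  have "oddext L f = (\<lambda>x. let y = x - L * of_int \<lfloor>x / L + 1 / 2\<rfloor> in if 0 \<le> y then g y else - g (- y))"
  proof
    fix x
    define y where "y = x - L * of_int \<lfloor>x / L + 1 / 2\<rfloor>"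
    have y: "- (L / 2) \<le> y" "y < L / 2" unfolding y_def using oddext_argument[OF L] by auto
    have "(if 0 \<le> y then f y else - f (- y)) = (if 0 \<le> y then g y else - g (- y))"
      using y by (auto simp: g_def max_def min_def intro!: arg_cong[of _ _ f])
    then show "oddext L f x = (let y = x - L * of_int \<lfloor>x / L + 1 / 2\<rfloor> in if 0 \<le> y then g y else - g (- y))"
      by (simp only: oddext_def y_def[symmetric] Let_def)
  qed
  also have "\<dots> \<in> borel_measurable borel" unfolding Let_def by measurable
  finally show ?thesis .
qed

lemma oddext_L2_per:
  assumes L: "L > 0" and f: "continuous_on {0..L / 2} f"
  shows "oddext L f \<in> L2_per L"
proof -
  have m [measurable]: "oddext L f \<in> borel_measurable borel" by (rule oddext_measurable[OF assms])
  have "bounded (f ` {0..L / 2})" by (intro compact_imp_bounded compact_continuous_image f) auto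
  then obtain C where "\<forall>y\<in>f ` {0..L / 2}. norm y \<le> C" unfolding bounded_iff by blast
  then have C: "norm (f x) \<le> C" if "x \<in> {0..L / 2}" for x using that by simp
  have b: "norm (oddext L f x) \<le> C" for x
  proof -
    define y where "y = x - L * of_int \<lfloor>x / L + 1 / 2\<rfloor>"
    have y: "- (L / 2) \<le> y" "y < L / 2" unfolding y_def using oddext_argument[OF L] by auto
    show ?thesis using y C[of y] C[of "- y"] by (auto simp: oddext_def y_def[symmetric])
  qed
  have "(\<lambda>x. 1) \<in> L2_per L" by (auto simp: L2_per_def set_integrable_def emeasure_lborel_Icc_eq)
  from L2_per_mult[OF this m oddext_periodic[OF L] b] show ?thesis by simp
qed

section \<open>Vector-valued functions\<close>

lemma linear_matrix_vector: "linear (\<lambda>v. (A::complex^4^4) *v v)"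
  by (rule linearI) (simp_all add: vec_eq_iff matrix_vector_mult_def sum.distrib scaleR_sum_right algebra_simps)

lemma bounded_linear_matrix_vector: "bounded_linear (\<lambda>v. (A::complex^4^4) *v v)"
  using linear_matrix_vector by (simp add: linear_conv_bounded_linear)

lemma linear_vector_smult: "linear (\<lambda>v. z *s (v::complex^4))"
  by (rule linearI) (simp_all add: vec_eq_iff algebra_simps)

lemma matrix_vector_nth: "((A::complex^4^4) *v v) $ j = (\<Sum>i\<in>UNIV. A $ j $ i * v $ i)"
  by (simp add: matrix_vector_mult_def)

lemma mat_J_nth [simp]:
  "(mat_J *v v) $ 1 = v $ 3" "(mat_J *v v) $ 2 = v $ 4" "(mat_J *v v) $ 3 = - v $ 1" "(mat_J *v v) $ 4 = - v $ 2"
  by (simp_all add: matrix_vector_nth sum_4 mat_J_def vector_def)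

lemma mat_J_J: "mat_J *v (mat_J *v v) = - v"
  by (simp add: vec_eq_iff forall_4)

lemma norm_mat_J: "norm (mat_J *v v) = norm v"
  by (simp add: norm_vec_def L2_set_def sum_4 add_ac)

lemma mat_S_nth:
  "(mat_S \<kappa> \<gamma> B *v v) $ 1 = of_real (5 * \<kappa> + 2 * \<gamma> * B ^ 3) * v $ 1 + of_real (3 * \<gamma> * B\<^sup>2) * v $ 2"
  "(mat_S \<kappa> \<gamma> B *v v) $ 2 = of_real (3 * \<gamma> * B\<^sup>2) * v $ 1 + of_real (5 * \<kappa> * B ^ 4 + 2 * \<gamma> * B) * v $ 2"
  "(mat_S \<kappa> \<gamma> B *v v) $ 3 = of_real (\<kappa> - 2 * \<gamma> * B ^ 3) * v $ 3 + of_real (3 * \<gamma> * B\<^sup>2) * v $ 4"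
  "(mat_S \<kappa> \<gamma> B *v v) $ 4 = of_real (3 * \<gamma> * B\<^sup>2) * v $ 3 + of_real (\<kappa> * B ^ 4 - 2 * \<gamma> * B) * v $ 4"
  unfolding matrix_vector_nth sum_4 mat_S_def vector_def by simp_all

lemma integral_nth:
  fixes f :: "real \<Rightarrow> complex^4"
  assumes "f integrable_on S" shows "integral S f $ j = integral S (\<lambda>x. f x $ j)"
  using integral_linear[OF assms bounded_linear_vec_nth[of j]] by (simp add: o_def)

lemma integrable_vec:
  fixes f :: "real \<Rightarrow> complex^4"
  assumes "\<And>j. (\<lambda>x. f x $ j) integrable_on S" shows "f integrable_on S"
proof (subst integrable_componentwise_iff, rule ballI)
  fix b :: "complex^4" assume "b \<in> Basis"
  then obtain j k where "b = axis j k" "k \<in> Basis" by (auto simp: Basis_vec_def)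
  then show "(\<lambda>x. f x \<bullet> b) integrable_on S"
    using integrable_component[OF assms[of j], of k] by (simp add: inner_axis)
qed

lemma norm_square_vec: "(norm (v::complex^4))\<^sup>2 = (\<Sum>j\<in>UNIV. (cmod (v $ j))\<^sup>2)"
  by (simp add: norm_vec_def L2_set_def sum_nonneg)

lemma norm_square_integrable:
  assumes "\<And>j. (\<lambda>x. F x $ j) \<in> L2_per L"
  shows "set_integrable lborel {0..L} (\<lambda>x. (norm (F x :: complex^4))\<^sup>2)"
proof -
  have "set_integrable lborel {0..L} (\<lambda>x. (cmod (F x $ j))\<^sup>2)" for j using assms[of j] by (simp add: L2_per_def)
  then have "integrable lborel (\<lambda>x. \<Sum>j\<in>UNIV. indicat_real {0..L} x *\<^sub>R (cmod (F x $ j))\<^sup>2)"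
    unfolding set_integrable_def by (intro Bochner_Integration.integrable_sum)
  then show ?thesis by (simp add: set_integrable_def norm_square_vec sum_distrib_left)
qed

lemma norm_measurable:
  assumes "\<And>j. (\<lambda>x. F x $ j) \<in> L2_per L"
  shows "(\<lambda>x. norm (F x :: complex^4)) \<in> borel_measurable borel"
proof -
  have [measurable]: "(\<lambda>x. F x $ j) \<in> borel_measurable borel" for j using assms[of j] by (simp add: L2_per_def)
  have "(\<lambda>x. sqrt (\<Sum>j\<in>UNIV. (cmod (F x $ j))\<^sup>2)) \<in> borel_measurable borel" by measurable
  then show ?thesis by (simp add: norm_vec_def L2_set_def)
qed

lemma L2_matrix: "(\<And>j. (\<lambda>x. U x $ j) \<in> L2_per L) \<Longrightarrow> (\<lambda>x. ((A::complex^4^4) *v U x) $ j) \<in> L2_per L"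
  unfolding matrix_vector_nth by (intro L2_per_sum L2_per_const_mult)

section \<open>The resolvent equation as a two-point problem\<close>

locale odd_linearization =
  fixes L \<kappa> \<gamma> B \<omega> :: real and \<psi> :: "real \<Rightarrow> real"
  assumes L: "0 < L" and \<psi>_cont: "continuous_on UNIV \<psi>"
    and \<psi>_odd: "\<And>x. \<psi> (- x) = - \<psi> x" and \<psi>_per: "\<And>x. \<psi> (x + L) = \<psi> x"
begin

text \<open>The equation \<open>(z - J \<L>) U = F\<close> multiplied by \<open>J\<close> reads \<open>U'' = rhs z x U - J F\<close>, because \<open>J\<^sup>2 = - 1\<close>.\<close>

definition rhs :: "complex \<Rightarrow> real \<Rightarrow> complex^4 \<Rightarrow> complex^4" where
  "rhs z x v = \<omega> *\<^sub>R v - (\<psi> x ^ 4) *\<^sub>R (mat_S \<kappa> \<gamma> B *v v) + mat_J *v (z *s v)"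

text \<open>The second antiderivative of \<open>- J F\<close> with value \<open>0\<close> and slope \<open>p\<close> at \<open>0\<close>.\<close>

definition data :: "(real \<Rightarrow> complex^4) \<Rightarrow> complex^4 \<Rightarrow> real \<Rightarrow> complex^4" where
  "data F p x = x *\<^sub>R p - integral {0..x} (\<lambda>s. (x - s) *\<^sub>R (mat_J *v F s))"

text \<open>\<open>U'' = rhs z x U - J F\<close> with \<open>U(0) = 0\<close> and \<open>U'(0) = p\<close>, in integrated form: \<open>F\<close> is only square-integrable, and
  \<open>Y\<close> need not have a second derivative at every point.\<close>

definition sol :: "complex \<Rightarrow> (real \<Rightarrow> complex^4) \<Rightarrow> complex^4 \<Rightarrow> (real \<Rightarrow> complex^4) \<Rightarrow> bool" where
  "sol z F p Y \<longleftrightarrow> continuous_on {0..L / 2} Y \<and>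
     (\<forall>x\<in>{0..L / 2}. Y x = data F p x + integral {0..x} (\<lambda>s. (x - s) *\<^sub>R rhs z s (Y s)))"

lemma linear_rhs: "linear (rhs z x)"
proof -
  have "linear (\<lambda>v. \<omega> *\<^sub>R v - (\<psi> x ^ 4) *\<^sub>R (mat_S \<kappa> \<gamma> B *v v) + mat_J *v (z *s v))"
    by (intro linear_compose_add linear_compose_sub linear_compose_scale_right linear_matrix_vector
          linear_compose[OF linear_vector_smult linear_matrix_vector, unfolded o_def] linear_id[unfolded id_def])
  then show ?thesis by (simp add: rhs_def[abs_def])
qed

lemma rhs_continuous:
  assumes Y: "continuous_on S Y" shows "continuous_on S (\<lambda>x. rhs z x (Y x))"
proof -
  have mv: "continuous_on S (\<lambda>x. A *v W x)" if "continuous_on S W" for A :: "complex^4^4" and W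
    by (rule bounded_linear.continuous_on[OF bounded_linear_matrix_vector that])
  have "bounded_linear (\<lambda>v::complex^4. z *s v)"
    using linear_vector_smult by (simp add: linear_conv_bounded_linear)
  then have "continuous_on S (\<lambda>x. z *s Y x)" using Y by (rule bounded_linear.continuous_on)
  then show ?thesis unfolding rhs_def
    by (intro continuous_on_add continuous_on_diff continuous_on_scaleR continuous_on_power continuous_on_const
          mv Y continuous_on_subset[OF \<psi>_cont]) auto
qed

lemma \<psi>4_bounded: obtains b where "b \<ge> 0" "\<And>x. \<psi> x ^ 4 \<le> b"
proof -
  have "bounded ((\<lambda>x. \<psi> x ^ 4) ` {0..L})"
    by (intro compact_imp_bounded compact_continuous_image continuous_intros continuous_on_subset[OF \<psi>_cont]) auto
  then obtain b where "\<forall>y\<in>(\<lambda>x. \<psi> x ^ 4) ` {0..L}. norm y \<le> b" unfolding bounded_iff by blast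
  then have b: "\<psi> x ^ 4 \<le> b" if "x \<in> {0..L}" for x using that by simp
  have pern: "\<psi> (x + of_int n * L) = \<psi> x" for n x
  proof (induction n rule: int_induct[of _ 0])
    case (step1 i)
    then show ?case using \<psi>_per[of "x + of_int i * L"] by (simp add: algebra_simps)
  next
    case (step2 i)
    then show ?case using \<psi>_per[of "x + of_int (i - 1) * L"] by (simp add: algebra_simps)
  qed simp
  have "\<psi> x ^ 4 \<le> b" for x
  proof -
    define n where "n = \<lfloor>x / L\<rfloor>"
    have "of_int n \<le> x / L" "x / L < of_int n + 1" unfolding n_def by linarith+
    then have "x + of_int (- n) * L \<in> {0..L}" using L by (simp add: field_simps)
    from b[OF this] show ?thesis unfolding pern .
  qed
  moreover have "0 \<le> b"
  proof -
    have "0 \<le> \<psi> 0 ^ 4" by simp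
    also have "\<dots> \<le> b" using b[of 0] L by simp
    finally show ?thesis .
  qed
  ultimately show ?thesis using that by blast
qed

lemma rhs_bounded: obtains C where "C \<ge> 0" "\<And>x v. norm (rhs z x v) \<le> C * norm v"
proof -
  obtain b where b: "b \<ge> 0" "\<And>x. \<psi> x ^ 4 \<le> b" by (rule \<psi>4_bounded) blast
  obtain S where S: "\<And>v. norm (mat_S \<kappa> \<gamma> B *v v) \<le> norm v * S" "S \<ge> 0"
    using bounded_linear.nonneg_bounded[OF bounded_linear_matrix_vector] by blast
  have "bounded_linear (\<lambda>v. mat_J *v (z *s v))"
    using linear_compose[OF linear_vector_smult linear_matrix_vector, unfolded o_def]
    by (simp add: linear_conv_bounded_linear)
  then obtain J where J: "\<And>v. norm (mat_J *v (z *s v)) \<le> norm v * J" "J \<ge> 0"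
    using bounded_linear.nonneg_bounded by blast
  have "norm (rhs z x v) \<le> (\<bar>\<omega>\<bar> + b * S + J) * norm v" for x v
  proof -
    have "norm (rhs z x v) \<le> norm (\<omega> *\<^sub>R v) + norm ((\<psi> x ^ 4) *\<^sub>R (mat_S \<kappa> \<gamma> B *v v)) + norm (mat_J *v (z *s v))"
      unfolding rhs_def by (intro norm_triangle_mono norm_triangle_ineq4) auto
    also have "norm ((\<psi> x ^ 4) *\<^sub>R (mat_S \<kappa> \<gamma> B *v v)) \<le> b * (norm v * S)"
      using b S by (simp add: mult_mono)
    also have "norm (mat_J *v (z *s v)) \<le> norm v * J" by (rule J)
    finally show ?thesis by (simp add: algebra_simps)
  qed
  then show ?thesis using that[of "\<bar>\<omega>\<bar> + b * S + J"] b S J by simp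
qed

lemma HH_component:
  assumes "U \<in> HH_per_odd s L"
  shows "(\<lambda>x. U x $ j) \<in> L2_per L" "U (- x) = - U x"
  using assms by (auto simp: HH_per_odd_def H_per_odd_def H_per_def vec_eq_iff)

lemma L2_\<psi>4: "f \<in> L2_per L \<Longrightarrow> (\<lambda>x. of_real (\<psi> x ^ 4) * f x) \<in> L2_per L"
proof -
  assume f: "f \<in> L2_per L"
  obtain b where b: "b \<ge> 0" "\<And>x. \<psi> x ^ 4 \<le> b" by (rule \<psi>4_bounded) blast
  have "(\<lambda>x. complex_of_real (\<psi> x ^ 4)) \<in> borel_measurable borel"
    by (intro borel_measurable_continuous_onI continuous_intros \<psi>_cont)
  then show ?thesis by (rule L2_per_mult[OF f, where C = b]) (use b \<psi>_per in \<open>auto simp: norm_power\<close>)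
qed

lemma L2_rhs: "(\<And>j. (\<lambda>x. U x $ j) \<in> L2_per L) \<Longrightarrow> (\<lambda>x. rhs z x (U x) $ j) \<in> L2_per L"
proof -
  assume U: "\<And>j. (\<lambda>x. U x $ j) \<in> L2_per L"
  have z: "(\<lambda>x. (z *s U x) $ j) \<in> L2_per L" for j using L2_per_const_mult[OF U[of j]] by simp
  have "(\<lambda>x. of_real \<omega> * U x $ j - of_real (\<psi> x ^ 4) * (mat_S \<kappa> \<gamma> B *v U x) $ j + (mat_J *v (z *s U x)) $ j) \<in> L2_per L"
    by (intro L2_per_add L2_per_diff L2_per_const_mult U L2_\<psi>4 L2_matrix z)
  then show ?thesis by (simp add: rhs_def scaleR_conv_of_real[where 'a = complex])
qed

lemma rhs_odd: "rhs z (- x) (- v) = - rhs z x v"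
  using linear_rhs[of z x] by (simp add: rhs_def \<psi>_odd linear_neg linear_neg[OF linear_matrix_vector] linear_neg[OF linear_vector_smult])

text \<open>On odd functions, the coefficients of \<open>fourier_coeff\<close> and the sine coefficients on the half period differ by one
  constant factor.\<close>

lemma fourier_sine_relation:
  assumes f: "f \<in> L2_per L" "\<And>x. f (- x) = - f x" and g: "g \<in> L2_per L" "\<And>x. g (- x) = - g x"
  shows "fourier_coeff L g n = (2 * complex_of_real pi * \<i> * of_int n / complex_of_real L) ^ 2 * fourier_coeff L f n
     \<longleftrightarrow> sine_coeff (L / 2) g n = - ((of_int n * pi / (L / 2))\<^sup>2 *\<^sub>R sine_coeff (L / 2) f n)"
proof -
  have c: "fourier_coeff L h n = (- 2 * \<i> / of_real L) * sine_coeff (L / 2) h n"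
    if "h \<in> L2_per L" "\<And>x. h (- x) = - h x" for h
    using odd_fourier_coeff[OF L that, of n] L by (simp add: sine_coeff_def field_simps)
  have k: "(2 * complex_of_real pi * \<i> * of_int n / complex_of_real L) ^ 2 = - complex_of_real ((of_int n * pi / (L / 2))\<^sup>2)"
    by (simp add: power_divide power_mult_distrib)
  have "fourier_coeff L g n = (2 * complex_of_real pi * \<i> * of_int n / complex_of_real L) ^ 2 * fourier_coeff L f n
    \<longleftrightarrow> (- 2 * \<i> / of_real L) * sine_coeff (L / 2) g n = (- 2 * \<i> / of_real L) * (- complex_of_real ((of_int n * pi / (L / 2))\<^sup>2) * sine_coeff (L / 2) f n)"
    unfolding c[OF f] c[OF g] k by (simp add: mult_ac)
  also have "\<dots> \<longleftrightarrow> sine_coeff (L / 2) g n = - complex_of_real ((of_int n * pi / (L / 2))\<^sup>2) * sine_coeff (L / 2) f n"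
    using L by (subst mult_cancel_left) simp
  finally show ?thesis by (simp add: scaleR_conv_of_real)
qed

lemma half_integrable: "f \<in> L2_per L \<Longrightarrow> set_integrable lborel {0..L / 2} f"
  by (rule set_integrable_subset[OF L2_per_integrable]) (use L in auto)

lemma kernel_integrable:
  assumes f: "f \<in> L2_per L" and x: "x \<in> {0..L / 2}"
  shows "(\<lambda>s. (x - s) *\<^sub>R f s) integrable_on {0..x}"
proof -
  have i: "set_integrable lborel {0..x} f"
    by (rule set_integrable_subset[OF half_integrable[OF f]]) (use x in auto)
  have c: "continuous_on UNIV (\<lambda>s. x - s)" by (intro continuous_intros)
  show ?thesis by (rule set_borel_integral_eq_integral(1)[OF set_integrable_cont_mult[OF i c]])
qed

text \<open>Every solution of the resolvent equation agrees almost everywhere on the half period with a continuous solution of the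
  two-point problem. The second derivative of \<open>U\<close>, given through Fourier coefficients, is first replaced
  by the odd function \<open>W\<close> that the equation prescribes for it, to which the Green representation applies.\<close>

lemma resolvent_forward:
  assumes F: "F \<in> LL_per_odd L" and res: "resolvent_eq (op_JL_odd L \<kappa> \<gamma> B \<omega> \<psi>) z U F"
  obtains p Y where "sol z F p Y" "Y (L / 2) = 0" "AE x in lborel. x \<in> {0..L / 2} \<longrightarrow> U x = Y x"
    "U \<in> HH_per_odd 2 L"
proof -
  obtain V U'' where U: "U \<in> HH_per_odd 2 L" and V: "V \<in> LL_per_odd L"
    and U'': "\<And>j. is_per_deriv 2 L (\<lambda>x. U x $ j) (\<lambda>x. U'' x $ j)"
    and Veq: "ae_eq V (\<lambda>x. - U'' x + \<omega> *\<^sub>R U x - (\<psi> x ^ 4) *\<^sub>R (mat_S \<kappa> \<gamma> B *v U x))"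
    and Feq: "ae_eq (\<lambda>x. z *s U x - mat_J *v V x) F"
    using res unfolding resolvent_eq_def op_JL_odd_def op_L_odd_def by blast
  define W where "W = (\<lambda>x. \<omega> *\<^sub>R U x - (\<psi> x ^ 4) *\<^sub>R (mat_S \<kappa> \<gamma> B *v U x) - V x)"
  have W2: "(\<lambda>x. W x $ j) \<in> L2_per L" for j
  proof -
    have "(\<lambda>x. of_real \<omega> * U x $ j - of_real (\<psi> x ^ 4) * (mat_S \<kappa> \<gamma> B *v U x) $ j - V x $ j) \<in> L2_per L"
      by (intro L2_per_diff L2_per_const_mult HH_component(1)[OF U] L2_\<psi>4 L2_matrix HH_component(1)[OF V])
    then show ?thesis by (simp add: W_def scaleR_conv_of_real[where 'a = complex])
  qed
  have Wodd: "W (- x) = - W x" for x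
    by (simp add: W_def HH_component(2)[OF U] HH_component(2)[OF V] \<psi>_odd linear_neg[OF linear_matrix_vector])
  have WU: "AE x in lborel. U'' x $ j = W x $ j" for j
    using Veq by eventually_elim (simp add: W_def)
  have coeff: "fourier_coeff L (\<lambda>x. W x $ j) n = (2 * complex_of_real pi * \<i> * of_int n / complex_of_real L) ^ 2 * fourier_coeff L (\<lambda>x. U x $ j) n" for j n
  proof -
    have "fourier_coeff L (\<lambda>x. U'' x $ j) n = fourier_coeff L (\<lambda>x. W x $ j) n"
      by (rule fourier_coeff_AE_cong[OF _ _ WU]) (use U''[of j] W2[of j] in \<open>auto simp: is_per_deriv_def L2_per_def\<close>)
    then show ?thesis using U''[of j] by (simp add: is_per_deriv_def)
  qed
  have T: "L / 2 > 0" using L by simp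
  have ex: "\<exists>p. (AE x in lborel. x \<in> {0..L / 2} \<longrightarrow> U x $ j = x *\<^sub>R p + green (\<lambda>x. W x $ j) x) \<and>
      (L / 2) *\<^sub>R p + green (\<lambda>x. W x $ j) (L / 2) = 0" for j
  proof -
    have "sine_coeff (L / 2) (\<lambda>x. W x $ j) n = - ((of_int n * pi / (L / 2))\<^sup>2 *\<^sub>R sine_coeff (L / 2) (\<lambda>x. U x $ j) n)" for n
      using fourier_sine_relation[OF HH_component(1)[OF U, of j] _ W2[of j], of n] coeff[of j n]
        HH_component(2)[OF U] Wodd by simp
    then show ?thesis
      by (rule green_representation[OF T half_integrable[OF HH_component(1)[OF U, of j]] half_integrable[OF W2[of j]]]) blast
  qed
  have "\<exists>q. \<forall>j. (AE x in lborel. x \<in> {0..L / 2} \<longrightarrow> U x $ j = x *\<^sub>R q j + green (\<lambda>x. W x $ j) x) \<and>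
      (L / 2) *\<^sub>R q j + green (\<lambda>x. W x $ j) (L / 2) = 0"
    by (rule choice, rule allI, rule ex)
  then
  obtain q where q: "\<And>j. AE x in lborel. x \<in> {0..L / 2} \<longrightarrow> U x $ j = x *\<^sub>R q j + green (\<lambda>x. W x $ j) x"
    "\<And>j. (L / 2) *\<^sub>R q j + green (\<lambda>x. W x $ j) (L / 2) = 0" by blast
  define p :: "complex^4" where "p = (\<chi> j. q j)"
  define Y :: "real \<Rightarrow> complex^4" where "Y = (\<lambda>x. \<chi> j. x *\<^sub>R q j + green (\<lambda>x. W x $ j) x)"
  have Yj: "Y x $ j = x *\<^sub>R q j + green (\<lambda>x. W x $ j) x" for x j by (simp add: Y_def)
  have YT: "Y (L / 2) = 0" by (simp add: Y_def q(2) vec_eq_iff)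
  have UY: "AE x in lborel. x \<in> {0..L / 2} \<longrightarrow> U x = Y x"
  proof -
    have "AE x in lborel. \<forall>j\<in>UNIV. x \<in> {0..L / 2} \<longrightarrow> U x $ j = x *\<^sub>R q j + green (\<lambda>x. W x $ j) x"
      by (rule eventually_ball_finite) (use q(1) in auto)
    then show ?thesis by eventually_elim (simp add: Y_def vec_eq_iff)
  qed
  have cY: "continuous_on {0..L / 2} Y"
    unfolding Y_def
    by (intro continuous_on_vec_lambda continuous_intros continuous_on_vector_derivative[OF green_deriv[OF T half_integrable[OF W2]]])
  have WY: "AE x in lborel. x \<in> {0..L / 2} \<longrightarrow> W x = rhs z x (Y x) - mat_J *v F x"
    using UY Feq
  proof eventually_elim
    case (elim x)
    have "mat_J *v F x = mat_J *v (z *s U x) + V x"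
      unfolding elim(2)[symmetric] by (simp add: linear_diff[OF linear_matrix_vector] mat_J_J)
    then show ?case using elim(1) by (auto simp: W_def rhs_def)
  qed
  have JF2: "(\<lambda>x. (mat_J *v F x) $ j) \<in> L2_per L" for j by (rule L2_matrix[OF HH_component(1)[OF F]])
  have "Y x = data F p x + integral {0..x} (\<lambda>s. (x - s) *\<^sub>R rhs z s (Y s))" if x: "x \<in> {0..L / 2}" for x
  proof -
    have rc: "continuous_on {0..x} (\<lambda>s. rhs z s (Y s))"
      by (rule continuous_on_subset[OF rhs_continuous[OF cY]]) (use x in auto)
    have i1: "(\<lambda>s. (x - s) *\<^sub>R rhs z s (Y s)) integrable_on {0..x}"
      by (intro integrable_continuous_interval continuous_intros rc)
    have i2: "(\<lambda>s. (x - s) *\<^sub>R (mat_J *v F s)) integrable_on {0..x}"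
      using kernel_integrable[OF JF2 x] by (intro integrable_vec) simp
    have "Y x $ j = (data F p x + integral {0..x} (\<lambda>s. (x - s) *\<^sub>R rhs z s (Y s))) $ j" for j
    proof -
      have "green (\<lambda>x. W x $ j) x = integral {0..x} (\<lambda>s. ((x - s) *\<^sub>R rhs z s (Y s)) $ j - ((x - s) *\<^sub>R (mat_J *v F s)) $ j)"
        unfolding green_def
      proof (rule integral_AE_cong)
        show "AE s in lborel. s \<in> {0..x} \<longrightarrow> (x - s) *\<^sub>R W s $ j = ((x - s) *\<^sub>R rhs z s (Y s)) $ j - ((x - s) *\<^sub>R (mat_J *v F s)) $ j"
          using WY by eventually_elim (use x in \<open>auto simp: scaleR_diff_right\<close>)
      qed
      also have "\<dots> = integral {0..x} (\<lambda>s. ((x - s) *\<^sub>R rhs z s (Y s)) $ j) - integral {0..x} (\<lambda>s. ((x - s) *\<^sub>R (mat_J *v F s)) $ j)"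
        using integrable_linear[OF i1 bounded_linear_vec_nth[of j]] integrable_linear[OF i2 bounded_linear_vec_nth[of j]]
        by (intro integral_diff) (simp_all only: o_def)
      finally show ?thesis
        by (simp add: Yj data_def p_def integral_nth[OF i1] integral_nth[OF i2])
    qed
    then show ?thesis by (simp add: vec_eq_iff)
  qed
  then have "sol z F p Y" using cY by (simp add: sol_def)
  then show ?thesis using YT UY U that by blast
qed

text \<open>For the weight, \<open>(1 + n\<^sup>2)\<^sup>2 \<le> 2 + 2 n\<^sup>4\<close>; the two parts are controlled by Bessel's inequality for \<open>f\<close> and for its
  second derivative \<open>g\<close>.\<close>

lemma H_per_2I:
  assumes f: "f \<in> L2_per L" and g: "g \<in> L2_per L"
    and rel: "\<And>n. fourier_coeff L g n = (2 * complex_of_real pi * \<i> * of_int n / complex_of_real L) ^ 2 * fourier_coeff L f n"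
  shows "f \<in> H_per 2 L"
proof -
  define k where "k = (L / (2 * pi)) ^ 4"
  have k: "k > 0" using L by (simp add: k_def)
  have n4: "of_int n ^ 4 * (cmod (fourier_coeff L f n))\<^sup>2 = k * (cmod (fourier_coeff L g n))\<^sup>2" for n
    unfolding rel k_def using L
    by (simp add: norm_mult norm_power norm_divide power_mult_distrib power_divide field_simps flip: power_mult)
  have "(\<lambda>n. 2 * (cmod (fourier_coeff L f n))\<^sup>2 + 2 * (k * (cmod (fourier_coeff L g n))\<^sup>2)) summable_on UNIV"
    by (intro summable_on_add summable_on_cmult_right bessel L f g)
  then have "(\<lambda>n::int. (1 + (real_of_int n)\<^sup>2) powr 2 * (cmod (fourier_coeff L f n))\<^sup>2) summable_on UNIV"
  proof (rule summable_on_comparison_test)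
    fix n :: int
    have "(1 + (real_of_int n)\<^sup>2) powr 2 = (1 + (real_of_int n)\<^sup>2)\<^sup>2"
      by (simp add: powr_numeral add_pos_nonneg)
    also have "\<dots> \<le> 2 + 2 * of_int n ^ 4"
    proof -
      have "0 \<le> (1 - (real_of_int n)\<^sup>2)\<^sup>2" by simp
      then show ?thesis by (simp add: power2_eq_square algebra_simps eval_nat_numeral)
    qed
    finally have "(1 + (real_of_int n)\<^sup>2) powr 2 * (cmod (fourier_coeff L f n))\<^sup>2 \<le> (2 + 2 * of_int n ^ 4) * (cmod (fourier_coeff L f n))\<^sup>2"
      by (rule mult_right_mono) simp
    also have "\<dots> = 2 * (cmod (fourier_coeff L f n))\<^sup>2 + 2 * (of_int n ^ 4 * (cmod (fourier_coeff L f n))\<^sup>2)"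
      by (simp add: algebra_simps)
    finally show "(1 + (real_of_int n)\<^sup>2) powr 2 * (cmod (fourier_coeff L f n))\<^sup>2
        \<le> 2 * (cmod (fourier_coeff L f n))\<^sup>2 + 2 * (k * (cmod (fourier_coeff L g n))\<^sup>2)" by (simp only: n4)
  qed auto
  then show ?thesis using f by (simp add: H_per_def)
qed

lemma LL_I:
  assumes "\<And>j. (\<lambda>x. V x $ j) \<in> L2_per L" "\<And>x. V (- x) = - V x"
  shows "V \<in> LL_per_odd L"
proof -
  have "(1 + (real_of_int n)\<^sup>2) powr 0 = 1" for n
    using add_pos_nonneg[OF zero_less_one, of "(real_of_int n)\<^sup>2"] by simp
  then show ?thesis using assms bessel[OF L assms(1)]
    by (simp add: HH_per_odd_def H_per_odd_def H_per_def vec_eq_iff)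
qed

text \<open>Conversely, the odd periodic extension of a solution of the two-point problem solves the resolvent
  equation: its sine coefficients satisfy the relation for a second derivative, and oddness carries the relation over
  to the Fourier coefficients.\<close>

lemma resolvent_backward:
  assumes F: "F \<in> LL_per_odd L" and Y: "sol z F p Y" "Y (L / 2) = 0"
  obtains U where "resolvent_eq (op_JL_odd L \<kappa> \<gamma> B \<omega> \<psi>) z U F" "\<And>x. x \<in> {0..L / 2} \<Longrightarrow> U x = Y x"
proof -
  have T: "L / 2 > 0" using L by simp
  have cY: "continuous_on {0..L / 2} Y" using Y by (simp add: sol_def)
  have cYj: "continuous_on {0..L / 2} (\<lambda>x. Y x $ j)" for j
    by (rule bounded_linear.continuous_on[OF bounded_linear_vec_nth cY])
  have Y0: "Y 0 = 0" using Y(1) L by (simp add: sol_def data_def)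
  define U :: "real \<Rightarrow> complex^4" where "U = (\<lambda>x. \<chi> j. oddext L (\<lambda>x. Y x $ j) x)"
  have UY: "U x = Y x" if "x \<in> {0..L / 2}" for x
    using oddext_eq[OF L _ that, of "\<lambda>x. Y x $ _"] Y(2) by (simp add: U_def vec_eq_iff)
  have U2: "(\<lambda>x. U x $ j) \<in> L2_per L" for j using oddext_L2_per[OF L cYj[of j]] by (simp add: U_def)
  have Uodd: "U (- x) = - U x" for x
    using oddext_odd[OF L, of "\<lambda>x. Y x $ _" x] Y0 Y(2) by (simp add: U_def vec_eq_iff)
  define R where "R = (\<lambda>x. rhs z x (U x) - mat_J *v F x)"
  have JF2: "(\<lambda>x. (mat_J *v F x) $ j) \<in> L2_per L" for j by (rule L2_matrix[OF HH_component(1)[OF F]])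
  have R2: "(\<lambda>x. R x $ j) \<in> L2_per L" for j
    using L2_per_diff[OF L2_rhs[OF U2] JF2, of z j j] by (simp add: R_def)
  have Rodd: "R (- x) = - R x" for x
    by (simp add: R_def Uodd rhs_odd HH_component(2)[OF F] linear_neg[OF linear_matrix_vector])
  have green: "U x $ j = x *\<^sub>R p $ j + green (\<lambda>x. R x $ j) x" if x: "x \<in> {0..L / 2}" for x j
  proof -
    have rc: "continuous_on {0..x} (\<lambda>s. rhs z s (Y s))"
      by (rule continuous_on_subset[OF rhs_continuous[OF cY]]) (use x in auto)
    have i1: "(\<lambda>s. (x - s) *\<^sub>R rhs z s (Y s)) integrable_on {0..x}"
      by (intro integrable_continuous_interval continuous_intros rc)
    have i2: "(\<lambda>s. (x - s) *\<^sub>R (mat_J *v F s)) integrable_on {0..x}"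
      using kernel_integrable[OF JF2 x] by (intro integrable_vec) simp
    have "green (\<lambda>x. R x $ j) x = integral {0..x} (\<lambda>s. ((x - s) *\<^sub>R rhs z s (Y s)) $ j - ((x - s) *\<^sub>R (mat_J *v F s)) $ j)"
      unfolding green_def by (rule integral_cong) (use x UY in \<open>auto simp: R_def scaleR_diff_right\<close>)
    also have "\<dots> = integral {0..x} (\<lambda>s. ((x - s) *\<^sub>R rhs z s (Y s)) $ j) - integral {0..x} (\<lambda>s. ((x - s) *\<^sub>R (mat_J *v F s)) $ j)"
      using integrable_linear[OF i1 bounded_linear_vec_nth[of j]] integrable_linear[OF i2 bounded_linear_vec_nth[of j]]
      by (intro integral_diff) (simp_all only: o_def)
    finally have "x *\<^sub>R p $ j + green (\<lambda>x. R x $ j) x = (data F p x + integral {0..x} (\<lambda>s. (x - s) *\<^sub>R rhs z s (Y s))) $ j"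
      by (simp add: data_def integral_nth[OF i1] integral_nth[OF i2])
    then show ?thesis using Y(1) x UY[OF x] by (simp add: sol_def)
  qed
  have rel: "fourier_coeff L (\<lambda>x. R x $ j) n = (2 * complex_of_real pi * \<i> * of_int n / complex_of_real L) ^ 2 * fourier_coeff L (\<lambda>x. U x $ j) n" for j n
  proof -
    have "sine_coeff (L / 2) (\<lambda>x. R x $ j) n = - ((of_int n * pi / (L / 2))\<^sup>2 *\<^sub>R sine_coeff (L / 2) (\<lambda>x. U x $ j) n)"
    proof (rule sine_coeff_green[OF T half_integrable[OF R2[of j]], where p = "p $ j"])
      show "U (L / 2) $ j = 0" using UY[of "L / 2"] L Y(2) by simp
    qed (rule green)
    then show ?thesis
      using fourier_sine_relation[OF U2[of j] _ R2[of j], of n] Uodd Rodd by simp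
  qed
  have dU: "is_per_deriv 2 L (\<lambda>x. U x $ j) (\<lambda>x. R x $ j)" for j
    using R2[of j] rel[of j] by (simp add: is_per_deriv_def)
  have UH: "U \<in> HH_per_odd 2 L"
    using H_per_2I[OF U2 R2 rel] Uodd by (simp add: HH_per_odd_def H_per_odd_def)
  (* The only candidate for L U; multiplied by J it gives z U - F. *)
  define V where "V = (\<lambda>x. - (mat_J *v (z *s U x - F x)))"
  have V: "V x = - R x + \<omega> *\<^sub>R U x - (\<psi> x ^ 4) *\<^sub>R (mat_S \<kappa> \<gamma> B *v U x)" for x
    by (simp add: V_def R_def rhs_def linear_diff[OF linear_matrix_vector])
  have VL: "V \<in> LL_per_odd L"
  proof (rule LL_I)
    show "(\<lambda>x. V x $ j) \<in> L2_per L" for j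
    proof -
      have "(\<lambda>x. (z *s U x - F x) $ i) \<in> L2_per L" for i
        using L2_per_diff[OF L2_per_const_mult[OF U2[of i]] HH_component(1)[OF F, of i]] by simp
      from L2_per_const_mult[OF L2_matrix[OF this], of "-1"] show ?thesis by (simp add: V_def)
    qed
    show "V (- x) = - V x" for x
      by (simp add: V_def Uodd HH_component(2)[OF F] linear_neg[OF linear_vector_smult] linear_diff[OF linear_matrix_vector] linear_neg[OF linear_matrix_vector])
  qed
  have "(U, V) \<in> op_L_odd L \<kappa> \<gamma> B \<omega> \<psi>"
    unfolding op_L_odd_def using UH VL dU V by auto
  then have "(U, \<lambda>x. mat_J *v V x) \<in> op_JL_odd L \<kappa> \<gamma> B \<omega> \<psi>" by (auto simp: op_JL_odd_def)
  moreover have "z *s U x - mat_J *v V x = F x" for x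
    by (simp add: V_def linear_neg[OF linear_matrix_vector] mat_J_J)
  ultimately have "resolvent_eq (op_JL_odd L \<kappa> \<gamma> B \<omega> \<psi>) z U F"
    unfolding resolvent_eq_def by (intro exI conjI) auto
  then show ?thesis using UY that by blast
qed

section \<open>The resolvent set by linear shooting\<close>

lemma sol_lincomb:
  assumes Y: "sol z F p Y" and Z: "sol z G q Z"
    and d: "\<And>x. x \<in> {0..L / 2} \<Longrightarrow> data H r x = a *\<^sub>R data F p x + data G q x"
  shows "sol z H r (\<lambda>x. a *\<^sub>R Y x + Z x)"
proof -
  have cY: "continuous_on {0..L / 2} Y" and cZ: "continuous_on {0..L / 2} Z" using Y Z by (simp_all add: sol_def)
  have "a *\<^sub>R Y x + Z x = data H r x + integral {0..x} (\<lambda>s. (x - s) *\<^sub>R rhs z s (a *\<^sub>R Y s + Z s))"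
    if x: "x \<in> {0..L / 2}" for x
  proof -
    have sub: "continuous_on {0..x} (\<lambda>s. rhs z s (Y s))" "continuous_on {0..x} (\<lambda>s. rhs z s (Z s))"
      by (rule continuous_on_subset[OF rhs_continuous[OF cY]], use x in auto)
         (rule continuous_on_subset[OF rhs_continuous[OF cZ]], use x in auto)
    have "((\<lambda>s. a *\<^sub>R ((x - s) *\<^sub>R rhs z s (Y s)) + (x - s) *\<^sub>R rhs z s (Z s)) has_integral
        a *\<^sub>R integral {0..x} (\<lambda>s. (x - s) *\<^sub>R rhs z s (Y s)) + integral {0..x} (\<lambda>s. (x - s) *\<^sub>R rhs z s (Z s))) {0..x}"
      by (intro has_integral_add has_integral_cmul integrable_integral integrable_continuous_interval continuous_intros sub)
    moreover have "a *\<^sub>R ((x - s) *\<^sub>R rhs z s (Y s)) + (x - s) *\<^sub>R rhs z s (Z s) = (x - s) *\<^sub>R rhs z s (a *\<^sub>R Y s + Z s)" for s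
      by (simp add: linear_add[OF linear_rhs] linear_scale[OF linear_rhs] scaleR_add_right)
    ultimately have "integral {0..x} (\<lambda>s. (x - s) *\<^sub>R rhs z s (a *\<^sub>R Y s + Z s))
       = a *\<^sub>R integral {0..x} (\<lambda>s. (x - s) *\<^sub>R rhs z s (Y s)) + integral {0..x} (\<lambda>s. (x - s) *\<^sub>R rhs z s (Z s))"
      by (simp add: integral_unique)
    then show ?thesis using Y Z x d[OF x] by (simp add: sol_def scaleR_add_right)
  qed
  then show ?thesis unfolding sol_def by (auto intro!: continuous_intros cY cZ)
qed

lemma sol_bound:
  obtains E where "E > 0" "\<And>F p Y h x. sol z F p Y \<Longrightarrow> (\<And>x. x \<in> {0..L / 2} \<Longrightarrow> norm (data F p x) \<le> h) \<Longrightarrow> x \<in> {0..L / 2} \<Longrightarrow> norm (Y x) \<le> E * h"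
proof -
  obtain C where C: "C \<ge> 0" "\<And>x v. norm (rhs z x v) \<le> C * norm v" by (rule rhs_bounded) blast
  have T: "L / 2 > 0" using L by simp
  show ?thesis
  proof (rule that[of "2 * exp ((2 * C * (L / 2) + 1) * (L / 2))"])
    fix F p Y h x
    assume Y: "sol z F p Y" and h: "\<And>x. x \<in> {0..L / 2} \<Longrightarrow> norm (data F p x) \<le> h" and x: "x \<in> {0..L / 2}"
    have cY: "continuous_on {0..L / 2} Y" using Y by (simp add: sol_def)
    show "norm (Y x) \<le> 2 * exp ((2 * C * (L / 2) + 1) * (L / 2)) * h"
      by (rule volterra_bound[OF T C rhs_continuous[OF cY] cY _ h x]) (use Y in \<open>auto simp: sol_def\<close>)
  qed simp
qed

lemma sol_unique:
  assumes "sol z F p Y" "sol z F p Z" "x \<in> {0..L / 2}" shows "Y x = Z x"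
proof -
  obtain E where E: "E > 0" "\<And>F p Y h x. sol z F p Y \<Longrightarrow> (\<And>x. x \<in> {0..L / 2} \<Longrightarrow> norm (data F p x) \<le> h) \<Longrightarrow> x \<in> {0..L / 2} \<Longrightarrow> norm (Y x) \<le> E * h"
    by (rule sol_bound) blast
  have "sol z (\<lambda>_. 0) 0 (\<lambda>x. (-1) *\<^sub>R Y x + Z x)"
    by (rule sol_lincomb[OF assms(1,2)]) (simp add: data_def linear_0[OF linear_matrix_vector])
  from E(2)[OF this _ assms(3), of 0] show ?thesis by (simp add: data_def linear_0[OF linear_matrix_vector])
qed

lemma data_0: "data (\<lambda>_. 0) p x = x *\<^sub>R p"
  by (simp add: data_def linear_0[OF linear_matrix_vector])

lemma sol_exists:
  assumes F: "F \<in> LL_per_odd L"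
  obtains Y where "sol z F p Y"
proof -
  obtain C where C: "C \<ge> 0" "\<And>x v. norm (rhs z x v) \<le> C * norm v" by (rule rhs_bounded) blast
  have T: "L / 2 > 0" using L by simp
  have JF2: "(\<lambda>x. (mat_J *v F x) $ j) \<in> L2_per L" for j by (rule L2_matrix[OF HH_component(1)[OF F]])
  have c: "continuous_on {0..L / 2} (\<lambda>x. \<chi> j. x *\<^sub>R p $ j - green (\<lambda>x. (mat_J *v F x) $ j) x)"
    by (intro continuous_on_vec_lambda continuous_intros continuous_on_vector_derivative[OF green_deriv[OF T half_integrable[OF JF2]]])
  have d: "data F p x = (\<chi> j. x *\<^sub>R p $ j - green (\<lambda>x. (mat_J *v F x) $ j) x)" if x: "x \<in> {0..L / 2}" for x
  proof -
    have i: "(\<lambda>s. (x - s) *\<^sub>R (mat_J *v F s)) integrable_on {0..x}"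
      using kernel_integrable[OF JF2 x] by (intro integrable_vec) simp
    show ?thesis by (simp add: data_def vec_eq_iff integral_nth[OF i] green_def)
  qed
  have cd: "continuous_on {0..L / 2} (data F p)" by (rule continuous_on_eq[OF c d[symmetric]])
  obtain Y where "continuous_on {0..L / 2} Y"
    "\<And>x. x \<in> {0..L / 2} \<Longrightarrow> Y x = data F p x + integral {0..x} (\<lambda>s. (x - s) *\<^sub>R rhs z s (Y s))"
    by (rule volterra_exists[OF T C(1), where M = "rhs z" and H = "data F p"])
       (use C(2) cd in \<open>auto simp: linear_diff[OF linear_rhs] rhs_continuous\<close>)
  then have "sol z F p Y" unfolding sol_def by blast
  then show ?thesis by (rule that)
qed

text \<open>The inequality of Cauchy and Schwarz with a cruder constant, from \<open>y \<le> e/2 + y\<^sup>2 / (2 e)\<close> with \<open>e\<close> equal to the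
  norm on the right.\<close>

lemma L1_le_L2:
  assumes F2: "\<And>j. (\<lambda>x. F x $ j) \<in> L2_per L"
  shows "(\<lambda>x. norm (F x :: complex^4)) integrable_on {0..L / 2}"
    "integral {0..L / 2} (\<lambda>x. norm (F x)) \<le> (L + 1) / 2 * LL_norm L F"
proof -
  define N where "N = LL_norm L F"
  note i2 = norm_square_integrable[OF F2]
  have m [measurable]: "(\<lambda>x. norm (F x)) \<in> borel_measurable borel" by (rule norm_measurable[OF F2])
  have I2: "((\<lambda>x. (norm (F x))\<^sup>2) has_integral N\<^sup>2) {0..L}"
  proof -
    have "0 \<le> (LINT x:{0..L}|lborel. (norm (F x))\<^sup>2)"
      unfolding set_lebesgue_integral_def by (rule integral_nonneg_AE) simp
    then have "integral {0..L} (\<lambda>x. (norm (F x))\<^sup>2) = N\<^sup>2"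
      using set_borel_integral_eq_integral(2)[OF i2] by (simp add: N_def LL_norm_def)
    then show ?thesis using set_borel_integral_eq_integral(1)[OF i2] by (metis integrable_integral)
  qed
  have le: "y \<le> e / 2 + y\<^sup>2 / (2 * e)" if "e > 0" for e y :: real
  proof -
    have "0 \<le> (y - e)\<^sup>2" by simp
    then have "2 * e * y \<le> e * e + y\<^sup>2" by (simp add: power2_diff power2_eq_square algebra_simps)
    then show ?thesis using that by (simp add: field_simps power2_eq_square)
  qed
  have i1: "set_integrable lborel {0..L} (\<lambda>x. norm (F x))"
    unfolding set_integrable_def
  proof (rule Bochner_Integration.integrable_bound)
    show "integrable lborel (\<lambda>x. indicat_real {0..L} x + indicat_real {0..L} x *\<^sub>R (norm (F x))\<^sup>2)"
      using i2 unfolding set_integrable_def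
      by (intro Bochner_Integration.integrable_add integrable_real_indicator) (simp_all add: emeasure_lborel_Icc_eq)
    have "norm (indicat_real {0..L} x *\<^sub>R norm (F x)) \<le> norm (indicat_real {0..L} x + indicat_real {0..L} x *\<^sub>R (norm (F x))\<^sup>2)" for x
    proof -
      have "norm (F x) \<le> 1 + (norm (F x))\<^sup>2" using le[of 1 "norm (F x)"] zero_le_power2[of "norm (F x)"] by linarith
      then show ?thesis by (auto simp: indicator_def)
    qed
    then show "AE x in lborel. norm (indicat_real {0..L} x *\<^sub>R norm (F x)) \<le> norm (indicat_real {0..L} x + indicat_real {0..L} x *\<^sub>R (norm (F x))\<^sup>2)" by simp
  qed measurable
  have h1: "(\<lambda>x. norm (F x)) integrable_on {0..L}" by (rule set_borel_integral_eq_integral(1)[OF i1])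
  show h2: "(\<lambda>x. norm (F x)) integrable_on {0..L / 2}" by (rule integrable_on_subinterval[OF h1]) (use L in auto)
  have half: "integral {0..L / 2} (\<lambda>x. norm (F x)) \<le> integral {0..L} (\<lambda>x. norm (F x))"
    by (rule integral_subset_le[OF _ h2 h1]) (use L in auto)
  have eps: "integral {0..L / 2} (\<lambda>x. norm (F x)) \<le> e / 2 * L + N\<^sup>2 / (2 * e)" if e: "e > 0" for e
  proof -
    have "((\<lambda>x. e / 2) has_integral (L - 0) *\<^sub>R (e / 2)) {0..L}"
      using has_integral_const_real[of "e / 2" 0 L] L by simp
    from has_integral_add[OF this has_integral_divide[OF I2, of "2 * e"]]
    have "((\<lambda>x. e / 2 + (norm (F x))\<^sup>2 / (2 * e)) has_integral e / 2 * L + N\<^sup>2 / (2 * e)) {0..L}"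
      by (simp only: diff_zero real_scaleR_def mult.commute[of L])
    from has_integral_le[OF integrable_integral[OF h1] this le[OF e]]
    have "integral {0..L} (\<lambda>x. norm (F x)) \<le> e / 2 * L + N\<^sup>2 / (2 * e)" .
    then show ?thesis using half by linarith
  qed
  have N0: "N \<ge> 0" by (simp add: N_def LL_norm_def set_lebesgue_integral_def integral_nonneg_AE)
  have "integral {0..L / 2} (\<lambda>x. norm (F x)) \<le> (L + 1) / 2 * N"
  proof (cases "N = 0")
    case True
    (* For N = 0 the optimal e is 0, which is only approached. *)
    have "integral {0..L / 2} (\<lambda>x. norm (F x)) \<le> 0"
    proof (rule field_le_epsilon)
      fix d :: real assume "d > 0"
      moreover from this have "0 < 2 * d / L" using L by simp
      moreover have "2 * d / L / 2 * L = d" using L by simp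
      ultimately show "integral {0..L / 2} (\<lambda>x. norm (F x)) \<le> 0 + d"
        using eps[of "2 * d / L"] by (simp only: True power_zero_numeral div_0 add_0_right add_0_left)
    qed
    then show ?thesis using True by simp
  next
    case False
    then have "N\<^sup>2 / (2 * N) = N / 2" by (simp add: power2_eq_square)
    then have "integral {0..L / 2} (\<lambda>x. norm (F x)) \<le> N / 2 * L + N / 2" using eps[of N] N0 False by simp
    also have "\<dots> = (L + 1) / 2 * N" by (simp add: field_simps)
    finally show ?thesis .
  qed
  then show "integral {0..L / 2} (\<lambda>x. norm (F x)) \<le> (L + 1) / 2 * LL_norm L F" by (simp add: N_def)
qed

lemma data_bound:
  assumes F: "F \<in> LL_per_odd L" and x: "x \<in> {0..L / 2}"
  shows "norm (data F p x) \<le> L / 2 * norm p + L / 2 * ((L + 1) / 2 * LL_norm L F)"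
proof -
  have JF2: "(\<lambda>x. (mat_J *v F x) $ j) \<in> L2_per L" for j by (rule L2_matrix[OF HH_component(1)[OF F]])
  have i: "(\<lambda>s. (x - s) *\<^sub>R (mat_J *v F s)) integrable_on {0..x}"
    using kernel_integrable[OF JF2 x] by (intro integrable_vec) simp
  note N = L1_le_L2[OF HH_component(1)[OF F]]
  have Nx: "(\<lambda>s. norm (F s)) integrable_on {0..x}" by (rule integrable_on_subinterval[OF N(1)]) (use x in auto)
  have "norm (integral {0..x} (\<lambda>s. (x - s) *\<^sub>R (mat_J *v F s))) \<le> integral {0..x} (\<lambda>s. L / 2 * norm (F s))"
  proof (rule integral_norm_bound_integral[OF i])
    show "(\<lambda>s. L / 2 * norm (F s)) integrable_on {0..x}" using integrable_cmul[OF Nx, of "L / 2"] by simp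
    show "norm ((x - s) *\<^sub>R (mat_J *v F s)) \<le> L / 2 * norm (F s)" if "s \<in> {0..x}" for s
    proof -
      have "(x - s) * norm (F s) \<le> L / 2 * norm (F s)" using that x by (intro mult_right_mono) auto
      then show ?thesis using that by (simp add: norm_mat_J)
    qed
  qed
  also have "\<dots> = L / 2 * integral {0..x} (\<lambda>s. norm (F s))" by (rule integral_mult_right)
  also have "\<dots> \<le> L / 2 * integral {0..L / 2} (\<lambda>s. norm (F s))"
    using L x by (intro mult_left_mono integral_subset_le Nx N(1)) auto
  also have "\<dots> \<le> L / 2 * ((L + 1) / 2 * LL_norm L F)" using N(2) L by (intro mult_left_mono) auto
  finally have "norm (integral {0..x} (\<lambda>s. (x - s) *\<^sub>R (mat_J *v F s))) \<le> L / 2 * ((L + 1) / 2 * LL_norm L F)" .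
  moreover have "norm (x *\<^sub>R p) \<le> L / 2 * norm p"
  proof -
    have "x * norm p \<le> L / 2 * norm p" using x by (intro mult_right_mono) auto
    then show ?thesis using x by simp
  qed
  ultimately show ?thesis unfolding data_def by (meson add_mono norm_triangle_ineq4 order_trans)
qed

lemma LL_norm_le:
  assumes U: "U \<in> HH_per_odd 2 L" and m: "m \<ge> 0"
    and le: "AE x in lborel. x \<in> {0..L / 2} \<longrightarrow> norm (U x) \<le> m"
  shows "LL_norm L U \<le> sqrt L * m"
proof -
  have per: "U (x + L) = U x" for x
    using HH_component(1)[OF U] by (simp add: vec_eq_iff L2_per_def)
  have [measurable]: "(\<lambda>x. norm (U x)) \<in> borel_measurable borel" by (rule norm_measurable[OF HH_component(1)[OF U]])
  have "AE x in lborel. norm (U x) \<le> m"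
    by (rule AE_odd_periodic_extend[OF L _ _ _ le]) (simp_all add: per HH_component(2)[OF U])
  then have AE: "AE x in lborel. indicat_real {0..L} x *\<^sub>R (norm (U x))\<^sup>2 \<le> indicat_real {0..L} x *\<^sub>R m\<^sup>2"
    by eventually_elim (auto simp: indicator_def intro!: power_mono)
  have "(LINT x:{0..L}|lborel. (norm (U x))\<^sup>2) \<le> (LINT x:{0..L}|lborel. m\<^sup>2)"
    unfolding set_lebesgue_integral_def
  proof (rule integral_mono_AE[OF _ _ AE])
    show "integrable lborel (\<lambda>x. indicat_real {0..L} x *\<^sub>R (norm (U x))\<^sup>2)"
      using norm_square_integrable[OF HH_component(1)[OF U]] by (simp add: set_integrable_def)
    show "integrable lborel (\<lambda>x. indicat_real {0..L} x *\<^sub>R m\<^sup>2)"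
      by (intro integrable_scaleR_left integrable_real_indicator) (simp_all add: emeasure_lborel_Icc_eq)
  qed
  also have "\<dots> = L * m\<^sup>2" using L by (simp add: set_lebesgue_integral_def)
  finally have "LL_norm L U \<le> sqrt (L * m\<^sup>2)" by (simp add: LL_norm_def)
  then show ?thesis using m by (simp add: real_sqrt_mult)
qed

text \<open>The Fredholm alternative for the two-point problem. For \<open>F = 0\<close>, the value at \<open>L/2\<close> is a linear function
  \<open>\<Lambda>\<close> of the slope \<open>p\<close>; the assumption says that it is injective, hence it is bijective with a bounded inverse. So a
  solution for any \<open>F\<close> can be corrected to vanish at \<open>L/2\<close> by a unique \<open>p\<close>, whose norm is controlled by that of \<open>F\<close>.\<close>

lemma resolvent_setI:
  assumes rigid: "\<And>p Y x. sol z (\<lambda>_. 0) p Y \<Longrightarrow> Y (L / 2) = 0 \<Longrightarrow> x \<in> {0..L / 2} \<Longrightarrow> Y x = 0"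
  shows "z \<in> resolvent_set L (op_JL_odd L \<kappa> \<gamma> B \<omega> \<psi>)"
proof -
  let ?A = "op_JL_odd L \<kappa> \<gamma> B \<omega> \<psi>"
  have T: "L / 2 > 0" using L by simp
  have zero: "(\<lambda>_. 0) \<in> LL_per_odd L"
    by (rule LL_I) (simp_all add: L2_per_def set_integrable_def)
  have Yex: "\<exists>Y. sol z (\<lambda>_. 0) p Y" for p by (rule sol_exists[OF zero]) blast
  define Y0 where "Y0 = (\<lambda>p. SOME Y. sol z (\<lambda>_. 0) p Y)"
  have Y0: "sol z (\<lambda>_. 0) p (Y0 p)" for p unfolding Y0_def by (rule someI_ex[OF Yex])
  define \<Lambda> where "\<Lambda> = (\<lambda>p. Y0 p (L / 2))"
  have \<Lambda>: "\<Lambda> p = Y (L / 2)" if "sol z (\<lambda>_. 0) p Y" for p Y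
    unfolding \<Lambda>_def by (rule sol_unique[OF Y0 that]) (use T in auto)
  have lin1: "\<Lambda> (a *\<^sub>R p + q) = a *\<^sub>R \<Lambda> p + \<Lambda> q" for a p q
    using \<Lambda>[OF sol_lincomb[OF Y0 Y0, of "\<lambda>_. 0" "a *\<^sub>R p + q" a p q]]
    by (simp add: data_0 scaleR_add_right \<Lambda>_def mult.commute)
  have lin: "linear \<Lambda>"
  proof (rule linearI)
    show "\<Lambda> (p + q) = \<Lambda> p + \<Lambda> q" for p q using lin1[of 1 p q] by simp
    have "\<Lambda> 0 = 0" using lin1[of "-1" 0 0] by simp
    then show "\<Lambda> (a *\<^sub>R p) = a *\<^sub>R \<Lambda> p" for a p using lin1[of a p 0] by simp
  qed
  have "p = 0" if "\<Lambda> p = 0" for p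
  proof -
    have z: "Y0 p x = 0" if "x \<in> {0..L / 2}" for x
      using rigid[OF Y0 _ that] \<open>\<Lambda> p = 0\<close> by (simp add: \<Lambda>_def)
    have "Y0 p (L / 2) = data (\<lambda>_. 0) p (L / 2) + integral {0..L / 2} (\<lambda>s. (L / 2 - s) *\<^sub>R rhs z s (Y0 p s))"
      using Y0[of p] T unfolding sol_def by auto
    also have "integral {0..L / 2} (\<lambda>s. (L / 2 - s) *\<^sub>R rhs z s (Y0 p s)) = integral {0..L / 2} (\<lambda>s. 0)"
      by (rule integral_cong) (simp add: z linear_0[OF linear_rhs])
    finally show ?thesis using T that by (simp add: data_0 \<Lambda>_def)
  qed
  then have inj: "inj \<Lambda>" by (simp add: linear_injective_0[OF lin])
  then have surj: "surj \<Lambda>" using linear_injective_imp_surjective[OF lin] by simp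
  obtain b where b: "b > 0" "\<And>p. b * norm p \<le> norm (\<Lambda> p)"
    using linear_inj_bounded_below_pos[OF lin inj] by blast
  obtain E where E: "E > 0" "\<And>F p Y h x. sol z F p Y \<Longrightarrow> (\<And>x. x \<in> {0..L / 2} \<Longrightarrow> norm (data F p x) \<le> h) \<Longrightarrow> x \<in> {0..L / 2} \<Longrightarrow> norm (Y x) \<le> E * h"
    by (rule sol_bound) blast
  have diff: "sol z F p Y \<Longrightarrow> sol z F q Z \<Longrightarrow> sol z (\<lambda>_. 0) (q - p) (\<lambda>x. (-1) *\<^sub>R Y x + Z x)" for F p q Y Z
    by (rule sol_lincomb) (auto simp: data_0, simp add: data_def algebra_simps)
  have ex: "\<exists>U. resolvent_eq ?A z U F" if F: "F \<in> LL_per_odd L" for F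
  proof -
    obtain Z where Z: "sol z F 0 Z" by (rule sol_exists[OF F])
    obtain p where p: "\<Lambda> p = - Z (L / 2)" using surjD[OF surj, of "- Z (L / 2)"] by metis
    have "sol z F p (\<lambda>x. 1 *\<^sub>R Y0 p x + Z x)"
      by (rule sol_lincomb[OF Y0 Z]) (simp add: data_0, simp add: data_def)
    moreover have "1 *\<^sub>R Y0 p (L / 2) + Z (L / 2) = 0" using p by (simp add: \<Lambda>_def)
    ultimately show ?thesis using resolvent_backward[OF F] by blast
  qed
  have uniq: "ae_eq U U'" if F: "F \<in> LL_per_odd L" and U: "resolvent_eq ?A z U F" and U': "resolvent_eq ?A z U' F" for F U U'
  proof -
    obtain p Y where Y: "sol z F p Y" "Y (L / 2) = 0" "AE x in lborel. x \<in> {0..L / 2} \<longrightarrow> U x = Y x" "U \<in> HH_per_odd 2 L"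
      by (rule resolvent_forward[OF F U]) blast
    obtain q Z where Z: "sol z F q Z" "Z (L / 2) = 0" "AE x in lborel. x \<in> {0..L / 2} \<longrightarrow> U' x = Z x" "U' \<in> HH_per_odd 2 L"
      by (rule resolvent_forward[OF F U']) blast
    have YZ: "Y x = Z x" if "x \<in> {0..L / 2}" for x
      using rigid[OF diff[OF Y(1) Z(1)] _ that] Y(2) Z(2) by simp
    have "AE x in lborel. x \<in> {0..L / 2} \<longrightarrow> U x = U' x"
      using Y(3) Z(3) by eventually_elim (simp add: YZ)
    then have j: "AE x in lborel. U x $ j = U' x $ j" for j
    proof (intro AE_odd_periodic_extend[OF L, of "\<lambda>x. U x $ j = U' x $ j"])
      have [measurable]: "(\<lambda>x. U x $ j) \<in> borel_measurable borel" "(\<lambda>x. U' x $ j) \<in> borel_measurable borel"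
        using HH_component(1)[OF Y(4), of j] HH_component(1)[OF Z(4), of j] by (simp_all add: L2_per_def)
      show "Measurable.pred borel (\<lambda>x. U x $ j = U' x $ j)" by measurable
      show "(U (x + L) $ j = U' (x + L) $ j) = (U x $ j = U' x $ j)" for x
        using HH_component(1)[OF Y(4), of j] HH_component(1)[OF Z(4), of j] by (simp add: L2_per_def)
      show "(U (- x) $ j = U' (- x) $ j) = (U x $ j = U' x $ j)" for x
        by (simp add: HH_component(2)[OF Y(4)] HH_component(2)[OF Z(4)])
    qed (auto elim: eventually_mono)
    have "AE x in lborel. \<forall>j\<in>UNIV. U x $ j = U' x $ j"
      by (rule eventually_ball_finite) (use j in auto)
    then show ?thesis by (simp add: vec_eq_iff)
  qed
  define K where "K = L / 2 * ((L + 1) / 2)"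
  have K: "K \<ge> 0" using L by (simp add: K_def)
  (* The constant collects the bound on p, the Volterra bound E and the length of the period. *)
  define M where "M = sqrt L * (E * (L / 2 * (E * K / b) + K))"
  have bound: "LL_norm L U \<le> M * LL_norm L F" if F: "F \<in> LL_per_odd L" and U: "resolvent_eq ?A z U F" for F U
  proof -
    define N where "N = LL_norm L F"
    have N: "N \<ge> 0" by (simp add: N_def LL_norm_def set_lebesgue_integral_def integral_nonneg_AE)
    obtain p Y where Y: "sol z F p Y" "Y (L / 2) = 0" "AE x in lborel. x \<in> {0..L / 2} \<longrightarrow> U x = Y x" "U \<in> HH_per_odd 2 L"
      by (rule resolvent_forward[OF F U]) blast
    obtain Z where Z: "sol z F 0 Z" by (rule sol_exists[OF F])
    have db: "norm (data F p x) \<le> L / 2 * norm p + K * N" if "x \<in> {0..L / 2}" for x p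
      using data_bound[OF F that, of p] by (simp add: K_def N_def mult.assoc)
    have Zb: "norm (Z x) \<le> E * (K * N)" if "x \<in> {0..L / 2}" for x
      by (rule E(2)[OF Z _ that]) (use db[of _ 0] in simp)
    have "\<Lambda> (p - 0) = - Z (L / 2)" using \<Lambda>[OF diff[OF Z Y(1)]] Y(2) by simp
    then have "b * norm p \<le> E * (K * N)" using b(2)[of p] Zb[of "L / 2"] T by simp
    then have p: "norm p \<le> E * (K * N) / b" using b(1) by (simp add: field_simps)
    have "norm (Y x) \<le> E * (L / 2 * (E * (K * N) / b) + K * N)" if "x \<in> {0..L / 2}" for x
    proof (rule E(2)[OF Y(1) _ that])
      fix x assume "x \<in> {0..L / 2}"
      from db[OF this, of p] show "norm (data F p x) \<le> L / 2 * (E * (K * N) / b) + K * N"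
        using mult_left_mono[OF p, of "L / 2"] T by linarith
    qed
    then have "AE x in lborel. x \<in> {0..L / 2} \<longrightarrow> norm (U x) \<le> E * (L / 2 * (E * (K * N) / b) + K * N)"
      using Y(3) by (auto elim: eventually_mono)
    moreover have "0 \<le> E * (L / 2 * (E * (K * N) / b) + K * N)"
      using E(1) b(1) T K N by (intro mult_nonneg_nonneg add_nonneg_nonneg divide_nonneg_nonneg) auto
    ultimately have "LL_norm L U \<le> sqrt L * (E * (L / 2 * (E * (K * N) / b) + K * N))"
      by (intro LL_norm_le[OF Y(4)])
    also have "\<dots> = M * N" by (simp add: M_def algebra_simps)
    finally show ?thesis by (simp add: N_def)
  qed
  show ?thesis unfolding resolvent_set_def using ex uniq bound by blast
qed

text \<open>For \<open>F = 0\<close> solutions are classical.\<close>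

lemma sol_derivatives:
  assumes Y: "sol z (\<lambda>_. 0) p Y"
  obtains Y' where "Y 0 = 0"
    "\<And>x. x \<in> {0..L / 2} \<Longrightarrow> (Y has_vector_derivative Y' x) (at x within {0..L / 2})"
    "\<And>x. x \<in> {0..L / 2} \<Longrightarrow> (Y' has_vector_derivative rhs z x (Y x)) (at x within {0..L / 2})"
proof -
  define R where "R = (\<lambda>s. rhs z s (Y s))"
  define Y' where "Y' = (\<lambda>x. p + integral {0..x} R)"
  have cY: "continuous_on {0..L / 2} Y" using Y by (simp add: sol_def)
  have cR: "continuous_on {0..L / 2} R" unfolding R_def by (rule rhs_continuous[OF cY])
  have eq: "Y x = x *\<^sub>R p + integral {0..x} (\<lambda>s. (x - s) *\<^sub>R R s)" if "x \<in> {0..L / 2}" for x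
    using Y that by (simp add: sol_def data_0 R_def)
  show ?thesis
  proof (rule that)
    show "Y 0 = 0" using eq[of 0] L by simp
    fix x assume x: "x \<in> {0..L / 2}"
    have "((\<lambda>x. x *\<^sub>R p) has_vector_derivative p) (at x within {0..L / 2})"
      by (auto intro!: derivative_eq_intros)
    from has_vector_derivative_add[OF this volterra_integral_deriv[OF cR x]]
    have "((\<lambda>x. x *\<^sub>R p + integral {0..x} (\<lambda>s. (x - s) *\<^sub>R R s)) has_vector_derivative Y' x) (at x within {0..L / 2})"
      by (simp add: Y'_def)
    then show "(Y has_vector_derivative Y' x) (at x within {0..L / 2})"
      by (rule has_vector_derivative_transform[OF x, rotated]) (rule eq)
    show "(Y' has_vector_derivative rhs z x (Y x)) (at x within {0..L / 2})"
      unfolding Y'_def using has_vector_derivative_add[OF has_vector_derivative_const integral_has_vector_derivative[OF cR x]]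
      by (simp add: R_def)
  qed
qed

lemma sol_of_derivatives:
  assumes Y0: "Y 0 = 0"
    and dY: "\<And>x. x \<in> {0..L / 2} \<Longrightarrow> (Y has_vector_derivative Y' x) (at x within {0..L / 2})"
    and dY': "\<And>x. x \<in> {0..L / 2} \<Longrightarrow> (Y' has_vector_derivative rhs z x (Y x)) (at x within {0..L / 2})"
  shows "sol z (\<lambda>_. 0) (Y' 0) Y"
proof -
  define R where "R = (\<lambda>s. rhs z s (Y s))"
  have cY: "continuous_on {0..L / 2} Y" by (rule continuous_on_vector_derivative[OF dY])
  have cR: "continuous_on {0..L / 2} R" unfolding R_def by (rule rhs_continuous[OF cY])
  have c: "convex {0..L / 2}" by simp
  have T: "0 \<in> {0..L / 2}" using L by simp
  have d1: "((\<lambda>x. Y' x - integral {0..x} R) has_vector_derivative 0) (at x within {0..L / 2})" if x: "x \<in> {0..L / 2}" for x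
    using has_vector_derivative_diff[OF dY'[OF x] integral_has_vector_derivative[OF cR x]] by (simp add: R_def)
  obtain a where a: "\<And>x. x \<in> {0..L / 2} \<Longrightarrow> Y' x - integral {0..x} R = a"
    using has_vector_derivative_zero_constant[OF c d1] by blast
  have Y': "Y' x = Y' 0 + integral {0..x} R" if "x \<in> {0..L / 2}" for x
    using a[OF that] a[OF T] by (simp add: algebra_simps)
  have d2: "((\<lambda>x. Y x - (x *\<^sub>R Y' 0 + integral {0..x} (\<lambda>s. (x - s) *\<^sub>R R s))) has_vector_derivative 0) (at x within {0..L / 2})"
    if x: "x \<in> {0..L / 2}" for x
  proof -
    have "((\<lambda>x. x *\<^sub>R Y' 0) has_vector_derivative Y' 0) (at x within {0..L / 2})"
      by (auto intro!: derivative_eq_intros)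
    from has_vector_derivative_diff[OF dY[OF x] has_vector_derivative_add[OF this volterra_integral_deriv[OF cR x]]]
    show ?thesis unfolding Y'[OF x, symmetric] by simp
  qed
  obtain b where b: "\<And>x. x \<in> {0..L / 2} \<Longrightarrow> Y x - (x *\<^sub>R Y' 0 + integral {0..x} (\<lambda>s. (x - s) *\<^sub>R R s)) = b"
    using has_vector_derivative_zero_constant[OF c d2] by blast
  have "b = 0" using b[OF T] Y0 by simp
  then have "Y x = x *\<^sub>R Y' 0 + integral {0..x} (\<lambda>s. (x - s) *\<^sub>R R s)" if "x \<in> {0..L / 2}" for x
    using b[OF that] by simp
  then show ?thesis using cY by (simp add: sol_def data_0 R_def)
qed

end

section \<open>Splitting along the wave\<close>

locale linearized_wave = odd_linearization L \<kappa> \<gamma> B \<omega> \<psi> + quintic_wave \<phi> \<phi>1 \<omega> "L / 4" "L / 2"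
  for L \<kappa> \<gamma> B \<omega> :: real and \<psi> \<phi> \<phi>1 +
  fixes c d :: real
  assumes c: "c = \<kappa> + \<gamma> * B ^ 3" "c = \<kappa> * B ^ 4 + \<gamma> * B" "c > 0"
    and d: "d = 3 * \<gamma> * B * (1 + B\<^sup>2)"
    and \<phi>4: "\<And>x. \<phi> x ^ 4 = c * \<psi> x ^ 4"
begin

text \<open>Components of the real and the imaginary part of the perturbation along \<open>(1, B)\<close>, the direction of the wave, without
  normalisation.\<close>

definition along :: "complex^4 \<Rightarrow> complex \<times> complex" where
  "along v = (v $ 1 + of_real B * v $ 2, v $ 3 + of_real B * v $ 4)"

text \<open>Components along \<open>(-B, 1)\<close>, orthogonal to the wave.\<close>

definition across :: "complex^4 \<Rightarrow> complex \<times> complex" where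
  "across v = (- of_real B * v $ 1 + v $ 2, - of_real B * v $ 3 + v $ 4)"

text \<open>\<open>(1, B)\<close> is an eigenvector of both blocks of \<open>S\<close>, with eigenvalues \<open>5 c\<close> and \<open>c\<close>. This is where
  the equation \<open>\<kappa> + \<gamma> B\<^sup>3 = \<kappa> B\<^sup>4 + \<gamma> B\<close> enters.\<close>

lemma along_rhs:
  "fst (along (rhs z x v)) = of_real (\<omega> - 5 * \<phi> x ^ 4) * fst (along v) + z * snd (along v)"
  "snd (along (rhs z x v)) = of_real (\<omega> - 1 * \<phi> x ^ 4) * snd (along v) - z * fst (along v)"
proof -
  define q where "q = complex_of_real (\<psi> x ^ 4)"
  define K G b C where "K = complex_of_real \<kappa>" and "G = complex_of_real \<gamma>" and "b = complex_of_real B" and "C = complex_of_real c"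
  have C: "C = K + G * b ^ 3" "C = K * b ^ 4 + G * b"
    unfolding C_def K_def G_def b_def by (simp add: c(1)) (simp add: c(2))
  have 1: "(5 * K + 2 * G * b ^ 3) + b * (3 * G * b\<^sup>2) = 5 * C" "3 * G * b\<^sup>2 + b * (5 * K * b ^ 4 + 2 * G * b) = 5 * C * b"
    "(K - 2 * G * b ^ 3) + b * (3 * G * b\<^sup>2) = C" "3 * G * b\<^sup>2 + b * (K * b ^ 4 - 2 * G * b) = C * b"
    using C by algebra+
  have r: "rhs z x v $ 1 = of_real \<omega> * v $ 1 - q * ((5 * K + 2 * G * b ^ 3) * v $ 1 + 3 * G * b\<^sup>2 * v $ 2) + z * v $ 3"
    "rhs z x v $ 2 = of_real \<omega> * v $ 2 - q * (3 * G * b\<^sup>2 * v $ 1 + (5 * K * b ^ 4 + 2 * G * b) * v $ 2) + z * v $ 4"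
    "rhs z x v $ 3 = of_real \<omega> * v $ 3 - q * ((K - 2 * G * b ^ 3) * v $ 3 + 3 * G * b\<^sup>2 * v $ 4) - z * v $ 1"
    "rhs z x v $ 4 = of_real \<omega> * v $ 4 - q * (3 * G * b\<^sup>2 * v $ 3 + (K * b ^ 4 - 2 * G * b) * v $ 4) - z * v $ 2"
    by (simp_all add: rhs_def mat_S_nth q_def K_def G_def b_def scaleR_conv_of_real[where 'a = complex])
  have \<phi>q: "complex_of_real (\<phi> x ^ 4) = C * q" unfolding \<phi>4 by (simp add: C_def q_def)
  have "fst (along (rhs z x v)) = of_real \<omega> * (v $ 1 + b * v $ 2)
     - q * (((5 * K + 2 * G * b ^ 3) + b * (3 * G * b\<^sup>2)) * v $ 1 + (3 * G * b\<^sup>2 + b * (5 * K * b ^ 4 + 2 * G * b)) * v $ 2)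
     + z * (v $ 3 + b * v $ 4)"
    by (simp add: along_def r b_def[symmetric] algebra_simps)
  then show "fst (along (rhs z x v)) = of_real (\<omega> - 5 * \<phi> x ^ 4) * fst (along v) + z * snd (along v)"
    unfolding 1 of_real_diff of_real_mult \<phi>q by (simp add: along_def b_def[symmetric] algebra_simps)
  have "snd (along (rhs z x v)) = of_real \<omega> * (v $ 3 + b * v $ 4)
     - q * (((K - 2 * G * b ^ 3) + b * (3 * G * b\<^sup>2)) * v $ 3 + (3 * G * b\<^sup>2 + b * (K * b ^ 4 - 2 * G * b)) * v $ 4)
     - z * (v $ 1 + b * v $ 2)"
    by (simp add: along_def r b_def[symmetric] algebra_simps)
  then show "snd (along (rhs z x v)) = of_real (\<omega> - 1 * \<phi> x ^ 4) * snd (along v) - z * fst (along v)"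
    unfolding 1 of_real_diff of_real_mult \<phi>q by (simp add: along_def b_def[symmetric] algebra_simps)
qed

text \<open>The blocks of \<open>S\<close> are symmetric, so \<open>(-B, 1)\<close> is an eigenvector as well; the eigenvalues are \<open>5 c - d\<close> and \<open>c - d\<close>.\<close>

lemma across_rhs:
  "fst (across (rhs z x v)) = of_real (\<omega> - (5 * c - d) / c * \<phi> x ^ 4) * fst (across v) + z * snd (across v)"
  "snd (across (rhs z x v)) = of_real (\<omega> - (c - d) / c * \<phi> x ^ 4) * snd (across v) - z * fst (across v)"
proof -
  define q where "q = complex_of_real (\<psi> x ^ 4)"
  define K G b C D where "K = complex_of_real \<kappa>" and "G = complex_of_real \<gamma>" and "b = complex_of_real B"
    and "C = complex_of_real c" and "D = complex_of_real d"
  have C: "C = K + G * b ^ 3" "C = K * b ^ 4 + G * b"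
    unfolding C_def K_def G_def b_def by (simp add: c(1)) (simp add: c(2))
  have D: "D = 3 * G * b * (1 + b\<^sup>2)" by (simp add: D_def G_def b_def d)
  have 1: "- b * (5 * K + 2 * G * b ^ 3) + 3 * G * b\<^sup>2 = (5 * C - D) * - b" "- b * (3 * G * b\<^sup>2) + (5 * K * b ^ 4 + 2 * G * b) = 5 * C - D"
    "- b * (K - 2 * G * b ^ 3) + 3 * G * b\<^sup>2 = (C - D) * - b" "- b * (3 * G * b\<^sup>2) + (K * b ^ 4 - 2 * G * b) = C - D"
    using C D by algebra+
  have r: "rhs z x v $ 1 = of_real \<omega> * v $ 1 - q * ((5 * K + 2 * G * b ^ 3) * v $ 1 + 3 * G * b\<^sup>2 * v $ 2) + z * v $ 3"
    "rhs z x v $ 2 = of_real \<omega> * v $ 2 - q * (3 * G * b\<^sup>2 * v $ 1 + (5 * K * b ^ 4 + 2 * G * b) * v $ 2) + z * v $ 4"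
    "rhs z x v $ 3 = of_real \<omega> * v $ 3 - q * ((K - 2 * G * b ^ 3) * v $ 3 + 3 * G * b\<^sup>2 * v $ 4) - z * v $ 1"
    "rhs z x v $ 4 = of_real \<omega> * v $ 4 - q * (3 * G * b\<^sup>2 * v $ 3 + (K * b ^ 4 - 2 * G * b) * v $ 4) - z * v $ 2"
    by (simp_all add: rhs_def mat_S_nth q_def K_def G_def b_def scaleR_conv_of_real[where 'a = complex])
  have \<phi>q: "complex_of_real ((5 * c - d) / c * \<phi> x ^ 4) = (5 * C - D) * q" "complex_of_real ((c - d) / c * \<phi> x ^ 4) = (C - D) * q"
    unfolding \<phi>4 using c(3) by (simp_all add: C_def D_def q_def)
  have "fst (across (rhs z x v)) = of_real \<omega> * (- b * v $ 1 + v $ 2)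
     - q * ((- b * (5 * K + 2 * G * b ^ 3) + 3 * G * b\<^sup>2) * v $ 1 + (- b * (3 * G * b\<^sup>2) + (5 * K * b ^ 4 + 2 * G * b)) * v $ 2)
     + z * (- b * v $ 3 + v $ 4)"
    by (simp add: across_def r b_def[symmetric] algebra_simps)
  then show "fst (across (rhs z x v)) = of_real (\<omega> - (5 * c - d) / c * \<phi> x ^ 4) * fst (across v) + z * snd (across v)"
    unfolding 1 of_real_diff[of \<omega>] \<phi>q by (simp add: across_def b_def[symmetric] algebra_simps)
  have "snd (across (rhs z x v)) = of_real \<omega> * (- b * v $ 3 + v $ 4)
     - q * ((- b * (K - 2 * G * b ^ 3) + 3 * G * b\<^sup>2) * v $ 3 + (- b * (3 * G * b\<^sup>2) + (K * b ^ 4 - 2 * G * b)) * v $ 4)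
     - z * (- b * v $ 1 + v $ 2)"
    by (simp add: across_def r b_def[symmetric] algebra_simps)
  then show "snd (across (rhs z x v)) = of_real (\<omega> - (c - d) / c * \<phi> x ^ 4) * snd (across v) - z * fst (across v)"
    unfolding 1 of_real_diff[of \<omega>] \<phi>q by (simp add: across_def b_def[symmetric] algebra_simps)
qed

lemma bounded_linear_pairs:
  "bounded_linear (\<lambda>v. fst (along v))" "bounded_linear (\<lambda>v. snd (along v))"
  "bounded_linear (\<lambda>v. fst (across v))" "bounded_linear (\<lambda>v. snd (across v))"
  unfolding along_def across_def
  by (auto intro!: linearI simp: linear_conv_bounded_linear[symmetric] algebra_simps)

lemma pair_vanishes:
  fixes P Q :: "complex^4 \<Rightarrow> complex"
  assumes z: "Re z \<noteq> 0" and PQ: "bounded_linear P" "bounded_linear Q"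
    and rel: "\<And>x v. P (rhs z x v) = of_real (\<omega> - \<sigma> * \<phi> x ^ 4) * P v + z * Q v"
      "\<And>x v. Q (rhs z x v) = of_real (\<omega> - \<tau> * \<phi> x ^ 4) * Q v - z * P v"
    and st: "\<sigma> = 5 \<and> \<tau> = 1 \<or> \<sigma> \<le> 1 \<and> \<tau> \<le> 1"
    and Y: "sol z (\<lambda>_. 0) p Y" "Y (L / 2) = 0" and x: "x \<in> {0..L / 2}"
  shows "P (Y x) = 0 \<and> Q (Y x) = 0"
proof -
  obtain Y' where Y0: "Y 0 = 0"
    and dY: "\<And>x. x \<in> {0..L / 2} \<Longrightarrow> (Y has_vector_derivative Y' x) (at x within {0..L / 2})"
    and dY': "\<And>x. x \<in> {0..L / 2} \<Longrightarrow> (Y' has_vector_derivative rhs z x (Y x)) (at x within {0..L / 2})"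
    by (rule sol_derivatives[OF Y(1)]) blast
  have d: "((\<lambda>x. f (g (W x))) has_real_derivative f (g W')) F"
    if "bounded_linear f" "bounded_linear g" "(W has_vector_derivative W') F" for f :: "complex \<Rightarrow> real" and g :: "complex^4 \<Rightarrow> complex" and W W' F
    using bounded_linear.has_vector_derivative[OF that(1) bounded_linear.has_vector_derivative[OF that(2,3)]]
    by (simp add: has_real_derivative_iff_has_vector_derivative)
  note re = bounded_linear_Re and im = bounded_linear_Im
  have dir: "dirichlet (\<lambda>x. f (g (Y x))) (\<lambda>x. f (g (Y' x)))"
    if "bounded_linear f" "bounded_linear g" for f :: "complex \<Rightarrow> real" and g :: "complex^4 \<Rightarrow> complex"
    unfolding dirichlet_def
  proof (intro conjI ballI)
    show "((\<lambda>x. f (g (Y x))) has_real_derivative f (g (Y' x))) (at x within {0..L / 2})" if "x \<in> {0..L / 2}" for x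
      by (rule d[OF \<open>bounded_linear f\<close> \<open>bounded_linear g\<close> dY[OF that]])
    show "continuous_on {0..L / 2} (\<lambda>x. f (g (Y' x)))"
      by (intro bounded_linear.continuous_on[OF \<open>bounded_linear f\<close>] bounded_linear.continuous_on[OF \<open>bounded_linear g\<close>]
           continuous_on_vector_derivative[OF dY'])
    show "f (g (Y 0)) = 0" "f (g (Y (L / 2))) = 0"
      by (simp_all add: Y0 Y(2) bounded_linear.linear[OF \<open>bounded_linear f\<close>] bounded_linear.linear[OF \<open>bounded_linear g\<close>] linear_0)
  qed
  note D = dir[OF re PQ(1)] dir[OF im PQ(1)] dir[OF re PQ(2)] dir[OF im PQ(2)]
  have p1: "((\<lambda>x. Re (P (Y' x))) has_real_derivative (\<omega> - \<sigma> * \<phi> t ^ 4) * Re (P (Y t)) + (Re z * Re (Q (Y t)) - Im z * Im (Q (Y t)))) (at t within {0..L / 2})"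
    if "t \<in> {0..L / 2}" for t
    by (rule DERIV_cong[OF d[OF re PQ(1) dY'[OF that]]]) (simp add: rel)
  have p2: "((\<lambda>x. Im (P (Y' x))) has_real_derivative (\<omega> - \<sigma> * \<phi> t ^ 4) * Im (P (Y t)) + (Re z * Im (Q (Y t)) + Im z * Re (Q (Y t)))) (at t within {0..L / 2})"
    if "t \<in> {0..L / 2}" for t
    by (rule DERIV_cong[OF d[OF im PQ(1) dY'[OF that]]]) (simp add: rel)
  have q1: "((\<lambda>x. Re (Q (Y' x))) has_real_derivative (\<omega> - \<tau> * \<phi> t ^ 4) * Re (Q (Y t)) - (Re z * Re (P (Y t)) - Im z * Im (P (Y t)))) (at t within {0..L / 2})"
    if "t \<in> {0..L / 2}" for t
    by (rule DERIV_cong[OF d[OF re PQ(2) dY'[OF that]]]) (simp add: rel)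
  have q2: "((\<lambda>x. Im (Q (Y' x))) has_real_derivative (\<omega> - \<tau> * \<phi> t ^ 4) * Im (Q (Y t)) - (Re z * Im (P (Y t)) + Im z * Re (P (Y t)))) (at t within {0..L / 2})"
    if "t \<in> {0..L / 2}" for t
    by (rule DERIV_cong[OF d[OF im PQ(2) dY'[OF that]]]) (simp add: rel)
  from st have "Re (P (Y x)) = 0 \<and> Im (P (Y x)) = 0 \<and> Re (Q (Y x)) = 0 \<and> Im (Q (Y x)) = 0"
  proof
    assume "\<sigma> = 5 \<and> \<tau> = 1"
    then have e: "\<sigma> = 5" "\<tau> = 1" by auto
    show ?thesis by (rule pair_rigid_5_1[OF z D p1[unfolded e] p2[unfolded e] q1[unfolded e] q2[unfolded e] x])
  next
    assume "\<sigma> \<le> 1 \<and> \<tau> \<le> 1"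
    then have e: "\<sigma> \<le> 1" "\<tau> \<le> 1" by auto
    show ?thesis by (rule pair_rigid_le_1[OF z e D p1 p2 q1 q2 x])
  qed
  then show ?thesis by (simp add: complex_eq_iff)
qed

lemma stable:
  assumes "d = 0 \<or> 4 * c \<le> d"
  shows "spectrally_stable L \<kappa> \<gamma> B \<omega> \<psi>"
proof -
  have "z \<in> resolvent_set L (op_JL_odd L \<kappa> \<gamma> B \<omega> \<psi>)" if z: "Re z \<noteq> 0" for z
  proof (rule resolvent_setI)
    fix p Y x assume Y: "sol z (\<lambda>_. 0) p Y" "Y (L / 2) = 0" and x: "x \<in> {0..L / 2}"
    have "(5 * c - d) / c = 5 \<and> (c - d) / c = 1 \<or> (5 * c - d) / c \<le> 1 \<and> (c - d) / c \<le> 1"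
      using assms c(3) by (auto simp: field_simps)
    from pair_vanishes[OF z bounded_linear_pairs(3,4) across_rhs this Y x]
    have ac: "- of_real B * Y x $ 1 + Y x $ 2 = 0" "- of_real B * Y x $ 3 + Y x $ 4 = 0"
      by (simp_all add: across_def)
    have "(5::real) = 5 \<and> (1::real) = 1 \<or> (5::real) \<le> 1 \<and> (1::real) \<le> 1" by simp
    from pair_vanishes[OF z bounded_linear_pairs(1,2) along_rhs this Y x]
    have al: "Y x $ 1 + of_real B * Y x $ 2 = 0" "Y x $ 3 + of_real B * Y x $ 4 = 0"
      by (simp_all add: along_def)
    have nz: "1 + (of_real B :: complex)\<^sup>2 \<noteq> 0"
    proof -
      have "1 + (of_real B :: complex)\<^sup>2 = of_real (1 + B\<^sup>2)" by simp
      moreover have "1 + B\<^sup>2 \<noteq> 0" by (simp add: add_pos_nonneg less_imp_neq[symmetric])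
      ultimately show ?thesis by (metis of_real_eq_0_iff)
    qed
    have k: "u = 0 \<and> v = 0" if "- of_real B * u + v = 0" "u + of_real B * v = 0" for u v :: complex
    proof -
      have "v = of_real B * u" using that(1) by (simp add: algebra_simps)
      then have "(1 + (of_real B)\<^sup>2) * u = 0" using that(2) by (simp add: algebra_simps power2_eq_square)
      then show ?thesis using nz \<open>v = of_real B * u\<close> by simp
    qed
    show "Y x = 0" using k[OF ac(1) al(1)] k[OF ac(2) al(2)] by (simp add: vec_eq_iff forall_4)
  qed
  then show ?thesis by (auto simp: spectrally_stable_def op_spectrum_def)
qed

text \<open>The eigenfunction of the pair across the wave, lifted to the direction \<open>(-B, 1)\<close> and extended to an odd periodic function.\<close>

lemma unstable:
  assumes "0 < d" "d < 4 * c"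
  shows "spectrally_unstable L \<kappa> \<gamma> B \<omega> \<psi>"
proof -
  define \<sigma> \<tau> where "\<sigma> = (5 * c - d) / c" and "\<tau> = (c - d) / c"
  have "1 < \<sigma>" "\<sigma> < 5" "\<tau> < 1" using assms c(3) by (auto simp: \<sigma>_def \<tau>_def field_simps)
  then obtain \<rho> P P' Q Q' t where \<rho>: "\<rho> > 0" and P: "dirichlet P P'" and Q: "dirichlet Q Q'"
    and dP: "\<And>t. t \<in> {0..L / 2} \<Longrightarrow> (P' has_real_derivative (\<omega> - \<sigma> * \<phi> t ^ 4) * P t + \<rho> * Q t) (at t within {0..L / 2})"
    and dQ: "\<And>t. t \<in> {0..L / 2} \<Longrightarrow> (Q' has_real_derivative (\<omega> - \<tau> * \<phi> t ^ 4) * Q t - \<rho> * P t) (at t within {0..L / 2})"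
    and t: "t \<in> {0..L / 2}" "P t \<noteq> 0 \<or> Q t \<noteq> 0"
    by (rule unstable_pair) blast
  (* The inverse of across on vectors with no component along (1, B), up to the factor 1 + B^2. *)
  define lift :: "real \<Rightarrow> real \<Rightarrow> complex^4" where
    "lift = (\<lambda>p q. vector [of_real (- B * p), of_real p, of_real (- B * q), of_real q])"
  have lift_nth: "lift p q $ 1 = of_real (- B * p)" "lift p q $ 2 = of_real p" "lift p q $ 3 = of_real (- B * q)" "lift p q $ 4 = of_real q" for p q
    by (simp_all add: lift_def vector_def)
  have along_lift: "along (lift p q) = (0, 0)" for p q by (simp add: along_def lift_nth)
  have across_lift: "across (lift p q) = (of_real ((1 + B\<^sup>2) * p), of_real ((1 + B\<^sup>2) * q))" for p q
    by (simp add: across_def lift_nth power2_eq_square algebra_simps)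
  have inj: "v = lift p q" if "along v = (0, 0)" "across v = (of_real ((1 + B\<^sup>2) * p), of_real ((1 + B\<^sup>2) * q))" for v p q
  proof -
    have k: "w = of_real r \<and> u = of_real (- B * r)"
      if "u + of_real B * w = 0" "- of_real B * u + w = of_real ((1 + B\<^sup>2) * r)" for u w :: complex and r
    proof -
      have u: "u = - (of_real B * w)" using that(1) by (simp add: eq_neg_iff_add_eq_0)
      have "of_real (1 + B\<^sup>2) * w = of_real (1 + B\<^sup>2) * of_real r"
        using that(2) unfolding u by (simp add: algebra_simps power2_eq_square)
      moreover have "of_real (1 + B\<^sup>2) \<noteq> (0 :: complex)"
        by (simp only: of_real_eq_0_iff) (simp add: add_pos_nonneg less_imp_neq[symmetric])
      ultimately show ?thesis unfolding u by simp
    qed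
    have "v $ 2 = of_real p \<and> v $ 1 = of_real (- B * p)" "v $ 4 = of_real q \<and> v $ 3 = of_real (- B * q)"
      by (rule k; use that in \<open>simp add: along_def across_def\<close>)+
    then show ?thesis by (simp add: vec_eq_iff forall_4 lift_nth)
  qed
  have rhs_lift: "rhs (of_real \<rho>) x (lift p q) = lift ((\<omega> - \<sigma> * \<phi> x ^ 4) * p + \<rho> * q) ((\<omega> - \<tau> * \<phi> x ^ 4) * q - \<rho> * p)" for x p q
  proof (rule inj)
    show "along (rhs (of_real \<rho>) x (lift p q)) = (0, 0)"
      by (rule prod_eqI) (simp_all add: along_rhs along_lift)
    show "across (rhs (of_real \<rho>) x (lift p q)) = (of_real ((1 + B\<^sup>2) * ((\<omega> - \<sigma> * \<phi> x ^ 4) * p + \<rho> * q)), of_real ((1 + B\<^sup>2) * ((\<omega> - \<tau> * \<phi> x ^ 4) * q - \<rho> * p)))"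
      by (rule prod_eqI) (simp_all add: across_rhs across_lift \<sigma>_def \<tau>_def algebra_simps)
  qed
  have blift: "((\<lambda>x. lift (p x) (q x)) has_vector_derivative lift p' q') (at x within X)"
    if "(p has_real_derivative p') (at x within X)" "(q has_real_derivative q') (at x within X)" for p q p' q' x X
  proof -
    have bl: "bounded_linear (\<lambda>u. lift (fst u) (snd u))"
      unfolding linear_conv_bounded_linear[symmetric]
      by (rule linearI) (simp_all add: vec_eq_iff forall_4 lift_nth algebra_simps scaleR_conv_of_real[where 'a = complex])
    have "((\<lambda>x. (p x, q x)) has_vector_derivative (p', q')) (at x within X)"
      using that unfolding has_real_derivative_iff_has_vector_derivative by (rule has_vector_derivative_Pair)
    from bounded_linear.has_vector_derivative[OF bl this] show ?thesis by simp
  qed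
  define Y where "Y = (\<lambda>x. lift (P x) (Q x))"
  define Y' where "Y' = (\<lambda>x. lift (P' x) (Q' x))"
  have l0: "lift 0 0 = 0" by (simp add: vec_eq_iff forall_4 lift_nth)
  have sol: "sol (of_real \<rho>) (\<lambda>_. 0) (Y' 0) Y"
  proof (rule sol_of_derivatives)
    show "Y 0 = 0" using P Q by (simp add: Y_def dirichlet_def l0)
    show "(Y has_vector_derivative Y' x) (at x within {0..L / 2})" if "x \<in> {0..L / 2}" for x
      unfolding Y_def Y'_def by (rule blift) (use P Q that in \<open>auto simp: dirichlet_def\<close>)
    show "(Y' has_vector_derivative rhs (of_real \<rho>) x (Y x)) (at x within {0..L / 2})" if "x \<in> {0..L / 2}" for x
      unfolding Y_def Y'_def rhs_lift by (rule blift[OF dP[OF that] dQ[OF that]])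
  qed
  have YT: "Y (L / 2) = 0" using P Q by (simp add: Y_def dirichlet_def l0)
  have zero: "(\<lambda>_. 0) \<in> LL_per_odd L"
    by (rule LL_I) (simp_all add: L2_per_def set_integrable_def)
  obtain U where U: "resolvent_eq (op_JL_odd L \<kappa> \<gamma> B \<omega> \<psi>) (of_real \<rho>) U (\<lambda>_. 0)" "\<And>x. x \<in> {0..L / 2} \<Longrightarrow> U x = Y x"
    by (rule resolvent_backward[OF zero sol YT]) blast
  then obtain V where V: "(U, V) \<in> op_JL_odd L \<kappa> \<gamma> B \<omega> \<psi>" "ae_eq (\<lambda>x. of_real \<rho> *s U x - V x) (\<lambda>_. 0)"
    unfolding resolvent_eq_def by blast
  have "\<not> ae_eq U (\<lambda>x. 0)"
  proof
    assume "ae_eq U (\<lambda>x. 0)"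
    then have "AE x in lborel. x \<in> {0..L / 2} \<longrightarrow> (P x)\<^sup>2 + (Q x)\<^sup>2 = 0"
    proof eventually_elim
      case (elim x)
      show ?case
      proof
        assume "x \<in> {0..L / 2}"
        then have "lift (P x) (Q x) = 0" using U(2)[of x] elim by (simp add: Y_def)
        then have "lift (P x) (Q x) $ 2 = 0" "lift (P x) (Q x) $ 4 = 0" by simp_all
        then show "(P x)\<^sup>2 + (Q x)\<^sup>2 = 0" by (simp add: lift_nth)
      qed
    qed
    then have "integral {0..L / 2} (\<lambda>x. (P x)\<^sup>2 + (Q x)\<^sup>2) = integral {0..L / 2} (\<lambda>_. 0)"
      by (rule integral_AE_cong)
    then have "(P t)\<^sup>2 + (Q t)\<^sup>2 = 0"
      using t L by (intro nonneg_integral_zero[where f = "\<lambda>x. (P x)\<^sup>2 + (Q x)\<^sup>2" and a = 0 and b = "L / 2"])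
        (auto intro!: continuous_intros dirichlet_cont(1)[OF P] dirichlet_cont(1)[OF Q])
    then show False using t by (simp add: sum_power2_eq_zero_iff)
  qed
  moreover have "ae_eq V (\<lambda>x. of_real \<rho> *s U x)" using V(2) by eventually_elim simp
  ultimately have "op_eigenvalue (op_JL_odd L \<kappa> \<gamma> B \<omega> \<psi>) (of_real \<rho>)"
    unfolding op_eigenvalue_def using V(1) by blast
  then show ?thesis unfolding spectrally_unstable_def using \<rho> by (intro exI conjI) auto
qed

end

lemma linearized_waveI:
  assumes L: "L > 0" and B: "\<kappa> + \<gamma> * B ^ 3 = \<kappa> * B ^ 4 + \<gamma> * B" and pos: "\<kappa> + \<gamma> * B ^ 3 > 0"
    and odd: "(\<lambda>x. complex_of_real (\<psi> x)) \<in> H_per_odd 1 L"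
    and sno: "has_snoidal_profile L \<kappa> \<gamma> B \<omega> \<psi>" and sol: "solves_profile_eq \<kappa> \<gamma> B \<omega> \<psi>"
  obtains \<phi> \<phi>1 where "linearized_wave L \<kappa> \<gamma> B \<omega> \<psi> \<phi> \<phi>1 (\<kappa> + \<gamma> * B ^ 3) (3 * \<gamma> * B * (1 + B\<^sup>2))"
proof -
  obtain \<phi> \<phi>1 where W: "quintic_wave \<phi> \<phi>1 \<omega> (L / 4) (L / 2)" "\<And>x. \<phi> x ^ 4 = (\<kappa> + \<gamma> * B ^ 3) * \<psi> x ^ 4"
    by (rule snoidal_quintic_wave[OF L pos sno sol]) blast
  have "\<exists>\<psi>'. \<forall>x. (\<psi> has_real_derivative \<psi>' x) (at x)" using sol unfolding solves_profile_eq_def by blast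
  then obtain \<psi>' where "\<And>x. (\<psi> has_real_derivative \<psi>' x) (at x)" by blast
  then have "isCont \<psi> x" for x by (rule DERIV_isCont)
  then have cont: "continuous_on UNIV \<psi>" by (simp add: continuous_at_imp_continuous_on)
  have per: "complex_of_real (\<psi> (x + L)) = of_real (\<psi> x)" "complex_of_real (\<psi> (- x)) = - of_real (\<psi> x)" for x
    using odd by (auto simp: H_per_odd_def H_per_def L2_per_def)
  have per': "\<psi> (x + L) = \<psi> x" "\<psi> (- x) = - \<psi> x" for x
    using per[of x] by (simp_all only: of_real_eq_iff flip: of_real_minus)
  have "odd_linearization L \<psi>" by unfold_locales (use L cont per' in auto)
  then have "linearized_wave L \<kappa> \<gamma> B \<omega> \<psi> \<phi> \<phi>1 (\<kappa> + \<gamma> * B ^ 3) (3 * \<gamma> * B * (1 + B\<^sup>2))"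
    using W(1) by (intro linearized_wave.intro linearized_wave_axioms.intro) (use B pos W(2) in auto)
  then show ?thesis by (rule that)
qed

section \<open>Spectral stability of the snoidal waves\<close>

theorem theorem1p5:
  fixes L \<kappa> \<gamma> \<omega> B :: real and \<psi> :: "real \<Rightarrow> real"
  assumes "L > 0" and "\<kappa> > 0" and "\<gamma> \<ge> 0"
    and "\<omega> > 4 * pi\<^sup>2 / L\<^sup>2"
    and "\<kappa> + \<gamma> * B ^ 3 = \<kappa> * B ^ 4 + \<gamma> * B"
    and "(\<lambda>x. complex_of_real (\<psi> x)) \<in> H_per_odd 1 L"
    and "has_snoidal_profile L \<kappa> \<gamma> B \<omega> \<psi>"
    and "solves_profile_eq \<kappa> \<gamma> B \<omega> \<psi>"
  shows
    "(\<gamma> > 2 * \<kappa> \<longrightarrow>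
        B = (\<gamma> + sqrt (\<gamma>\<^sup>2 - 4 * \<kappa>\<^sup>2)) / (2 * \<kappa>) \<or> B = (\<gamma> - sqrt (\<gamma>\<^sup>2 - 4 * \<kappa>\<^sup>2)) / (2 * \<kappa>) \<longrightarrow>
        spectrally_unstable L \<kappa> \<gamma> B \<omega> \<psi>) \<and>
     (B = 1 \<longrightarrow>
        (0 < \<gamma> \<and> \<gamma> < 2 * \<kappa> \<longrightarrow> spectrally_unstable L \<kappa> \<gamma> B \<omega> \<psi>) \<and>
        (\<gamma> = 0 \<or> \<gamma> \<ge> 2 * \<kappa> \<longrightarrow> spectrally_stable L \<kappa> \<gamma> B \<omega> \<psi>)) \<and>
     (B = - 1 \<longrightarrow> \<gamma> = 0 \<longrightarrow> spectrally_stable L \<kappa> \<gamma> B \<omega> \<psi>)"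
proof -
  define c d where "c = \<kappa> + \<gamma> * B ^ 3" and "d = 3 * \<gamma> * B * (1 + B\<^sup>2)"
  have unstable: "spectrally_unstable L \<kappa> \<gamma> B \<omega> \<psi>" if "c > 0" "0 < d" "d < 4 * c"
    by (rule linearized_waveI[OF assms(1,5) that(1)[unfolded c_def] assms(6-8)])
       (rule linearized_wave.unstable, assumption, use that in \<open>simp_all add: c_def d_def\<close>)
  have stable: "spectrally_stable L \<kappa> \<gamma> B \<omega> \<psi>" if "c > 0" "d = 0 \<or> 4 * c \<le> d"
    by (rule linearized_waveI[OF assms(1,5) that(1)[unfolded c_def] assms(6-8)])
       (rule linearized_wave.stable, assumption, use that in \<open>simp add: c_def d_def\<close>)
  have 1: "spectrally_unstable L \<kappa> \<gamma> B \<omega> \<psi>"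
    if \<gamma>: "\<gamma> > 2 * \<kappa>" and B: "B = (\<gamma> + sqrt (\<gamma>\<^sup>2 - 4 * \<kappa>\<^sup>2)) / (2 * \<kappa>) \<or> B = (\<gamma> - sqrt (\<gamma>\<^sup>2 - 4 * \<kappa>\<^sup>2)) / (2 * \<kappa>)"
  proof -
    (* B is a root of kappa (B^2 + 1) = gamma B. *)
    define s where "s = sqrt (\<gamma>\<^sup>2 - 4 * \<kappa>\<^sup>2)"
    have "(2 * \<kappa>)\<^sup>2 < \<gamma>\<^sup>2" using \<gamma> assms(2) by (intro power_strict_mono) auto
    then have s2: "s\<^sup>2 = \<gamma>\<^sup>2 - 4 * \<kappa>\<^sup>2" by (simp add: s_def power_mult_distrib)
    have "2 * \<kappa> * B - \<gamma> = s \<or> 2 * \<kappa> * B - \<gamma> = - s" using B assms(2) by (auto simp: s_def field_simps)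
    then have "(2 * \<kappa> * B - \<gamma>)\<^sup>2 = s\<^sup>2" by auto
    then have "\<kappa> * (\<kappa> * (B\<^sup>2 + 1) - \<gamma> * B) = 0" unfolding s2 by (simp add: power2_eq_square algebra_simps)
    then have q: "\<gamma> * B = \<kappa> * (B\<^sup>2 + 1)" using assms(2) by simp
    have cB: "c = \<kappa> * (1 + B\<^sup>2 + B ^ 4)"
    proof -
      have "c = \<kappa> + (\<gamma> * B) * B\<^sup>2" by (simp add: c_def eval_nat_numeral)
      then show ?thesis unfolding q by (simp add: algebra_simps eval_nat_numeral)
    qed
    have dB: "d = 3 * \<kappa> * (1 + B\<^sup>2)\<^sup>2"
    proof -
      have "d = 3 * (\<gamma> * B) * (1 + B\<^sup>2)" by (simp add: d_def)
      then show ?thesis unfolding q by (simp add: algebra_simps power2_eq_square)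
    qed
    have B1: "B\<^sup>2 \<noteq> 1"
    proof
      assume "B\<^sup>2 = 1"
      then have "B = 1 \<or> B = - 1" by (simp add: power2_eq_1_iff)
      then show False using q \<gamma> assms(2) by auto
    qed
    have "0 \<le> B\<^sup>2" "0 \<le> B ^ 4" by simp_all
    then have pos: "1 + B\<^sup>2 + B ^ 4 > 0" "1 + B\<^sup>2 > 0" by linarith+
    have "4 * c - d = \<kappa> * (B\<^sup>2 - 1)\<^sup>2" unfolding cB dB by (simp add: power2_eq_square algebra_simps eval_nat_numeral)
    moreover have "\<dots> > 0" using B1 assms(2) by simp
    ultimately have "d < 4 * c" by simp
    moreover have "c > 0" "d > 0" unfolding cB dB using pos assms(2) by simp_all
    ultimately show ?thesis by (intro unstable)
  qed
  have 2: "spectrally_unstable L \<kappa> \<gamma> B \<omega> \<psi>" if "B = 1" "0 < \<gamma>" "\<gamma> < 2 * \<kappa>"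
    using that assms(2) by (intro unstable) (simp_all add: c_def d_def)
  have 3: "spectrally_stable L \<kappa> \<gamma> B \<omega> \<psi>" if "B = 1" "\<gamma> = 0 \<or> \<gamma> \<ge> 2 * \<kappa>"
    using that assms(2,3) by (intro stable) (auto simp: c_def d_def)
  have 4: "spectrally_stable L \<kappa> \<gamma> B \<omega> \<psi>" if "B = - 1" "\<gamma> = 0"
    using that assms(2) by (intro stable) (simp_all add: c_def d_def)
  show ?thesis using 1 2 3 4 by blast
qed

end
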